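(* Let $(X,\omega)$ be a one-connected and integral symplectic manifold. The cohomology class $[c_{x_0,\sigma,w}]\in H^3_{\mathrm{grp}}(\mathrm{Symp}(X,\omega);\mathbb{Z})$ of the group three-cocycle $$c_{x_0,\sigma,w}(f,g,h)=\int_{\Delta_{x_0,\sigma}(g,h)}f^*w-w$$ is independent of the choice of $x_0$, $\sigma$, and $w$.
   Context: One-connected means connected and simply connected; $(X,\omega)$ is integral if $[\omega]\in H^2(X;\mathbb{R})$ is the image of a class in $H^2(X;\mathbb{Z})$; this integral class is unique since $X$ is one-connected and is denoted $[\omega]_{\mathbb{Z}}$. $\mathrm{Symp}(X,\omega)$ is the symplectomorphism group. Fix a base point $x_0\in X$, let $\mathcal{P}_{x_0}$ be the space of paths $\gamma\colon[0,1]\to X$ with $\gamma(0)=x_0$, and let $\sigma\colon X\to\mathcal{P}_{x_0}$ be a section of $\gamma\mapsto\gamma(1)$. For $g,h\in\mathrm{Symp}(X,\omega)$, $\Delta_{x_0,\sigma}(g,h)$ is a disk in $X$ whose boundary is the one-chain $\sigma(g(x_0))-\sigma(gh(x_0))+g\sigma(h(x_0))$. $w\in C^2(X;\mathbb{Z})$ is a ($C^\infty$-)singular two-cocycle representing $[\omega]_{\mathbb{Z}}$. $\int$ is the pairing of cochains with chains; since $f^*w-w$ is a coboundary, the value does not depend on the choice of the disk. For a group $G$ and trivial $G$-module $M$, $H^*_{\mathrm{grp}}(G;M)$ is the cohomology of the complex of all functions $c\colon G^p\to M$, with $\delta c(g_1,\dots,g_{p+1})=c(g_2,\dots,g_{p+1})+\sum_{i=1}^p(-1)^ic(g_1,\dots,g_ig_{i+1},\dots,g_{p+1})+(-1)^{p+1}c(g_1,\dots,g_p)$.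 *)

theory Defs
  imports "HOL-Analysis.Analysis" "HOL-Algebra.Coset" "HOL-Homology.Simplices"
begin

section \<open>Smooth maps between open subsets of Euclidean spaces\<close>

primrec Ck_on :: "nat \<Rightarrow> ('e::euclidean_space \<Rightarrow> 'f::real_normed_vector) \<Rightarrow> 'e set \<Rightarrow> bool" where
  "Ck_on 0 f S \<longleftrightarrow> continuous_on S f"
| "Ck_on (Suc k) f S \<longleftrightarrow>
     (\<forall>x\<in>S. f differentiable (at x)) \<and>
     (\<forall>v. Ck_on k (\<lambda>x. frechet_derivative f (at x) v) S)"

definition smooth_on :: "('e::euclidean_space \<Rightarrow> 'f::real_normed_vector) \<Rightarrow> 'e set \<Rightarrow> bool" where
  "smooth_on f S \<longleftrightarrow> (\<forall>k. Ck_on k f S)"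


section \<open>Smooth manifolds\<close>

text \<open>The manifold is the whole type \<open>'a\<close>, Hausdorff and second countable by its type class;
  its smooth structure is given by an atlas of charts, a chart being its domain together
  with the coordinate map (only the values on the domain matter).\<close>

type_synonym ('a, 'e) chart = "'a set \<times> ('a \<Rightarrow> 'e)"

definition chart_image :: "('a, 'e) chart \<Rightarrow> 'e set" where
  "chart_image c = snd c ` fst c"

definition chart_inv :: "('a, 'e) chart \<Rightarrow> 'e \<Rightarrow> 'a" where
  "chart_inv c = inv_into (fst c) (snd c)"

definition is_chart :: "('a::topological_space, 'e::euclidean_space) chart \<Rightarrow> bool" where
  "is_chart c \<longleftrightarrow> open (fst c) \<and> open (chart_image c) \<and>
     homeomorphism (fst c) (chart_image c) (snd c) (chart_inv c)"

definition local_rep ::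
    "('a, 'e) chart \<Rightarrow> ('a, 'e) chart \<Rightarrow> ('a \<Rightarrow> 'a) \<Rightarrow> 'e \<Rightarrow> 'e" where
  "local_rep c d f = snd d \<circ> f \<circ> chart_inv c"

definition smooth_atlas :: "('a::topological_space, 'e::euclidean_space) chart set \<Rightarrow> bool" where
  "smooth_atlas A \<longleftrightarrow>
     (\<forall>c\<in>A. is_chart c) \<and> (\<Union>c\<in>A. fst c) = UNIV \<and>
     (\<forall>c\<in>A. \<forall>d\<in>A. smooth_on (local_rep c d id) (snd c ` (fst c \<inter> fst d)))"

definition smooth_map ::
    "('a::topological_space, 'e::euclidean_space) chart set \<Rightarrow> ('a \<Rightarrow> 'a) \<Rightarrow> bool" where
  "smooth_map A f \<longleftrightarrow> continuous_on UNIV f \<and>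
     (\<forall>c\<in>A. \<forall>d\<in>A. smooth_on (local_rep c d f) (snd c ` {x \<in> fst c. f x \<in> fst d}))"

definition diffeomorphism ::
    "('a::topological_space, 'e::euclidean_space) chart set \<Rightarrow> ('a \<Rightarrow> 'a) \<Rightarrow> bool" where
  "diffeomorphism A f \<longleftrightarrow> bij f \<and> smooth_map A f \<and> smooth_map A (inv_into UNIV f)"

definition one_connected :: "'a::topological_space set \<Rightarrow> bool" where
  "one_connected S \<longleftrightarrow> connected S \<and> simply_connected S"


section \<open>Symplectic forms\<close>

text \<open>A two-form is the family of its coordinate expressions: \<open>\<omega> c y\<close> is the bilinear form
  which the chart \<open>c\<close> assigns to the point with coordinates \<open>y\<close>, and the expressions in
  different charts are related by pullback along the transition maps.\<close>

type_synonym ('a, 'e) coord_form = "('a, 'e) chart \<Rightarrow> 'e \<Rightarrow> 'e \<Rightarrow> 'e \<Rightarrow> real"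

definition preserves_form ::
    "('a, 'e::euclidean_space) chart set \<Rightarrow> ('a, 'e) coord_form \<Rightarrow> ('a \<Rightarrow> 'a) \<Rightarrow> bool" where
  "preserves_form A \<omega> f \<longleftrightarrow>
     (\<forall>c\<in>A. \<forall>d\<in>A. \<forall>x. x \<in> fst c \<and> f x \<in> fst d \<longrightarrow>
        (\<forall>v w. let D = frechet_derivative (local_rep c d f) (at (snd c x))
               in \<omega> d (snd d (f x)) (D v) (D w) = \<omega> c (snd c x) v w))"

definition two_form ::
    "('a, 'e::euclidean_space) chart set \<Rightarrow> ('a, 'e) coord_form \<Rightarrow> bool" where
  "two_form A \<omega> \<longleftrightarrow>
     (\<forall>c\<in>A. (\<forall>y\<in>chart_image c. bilinear (\<omega> c y) \<and> (\<forall>v. \<omega> c y v v = 0)) \<and>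
             (\<forall>v w. smooth_on (\<lambda>y. \<omega> c y v w) (chart_image c))) \<and>
     preserves_form A \<omega> id"

definition closed_form ::
    "('a, 'e::euclidean_space) chart set \<Rightarrow> ('a, 'e) coord_form \<Rightarrow> bool" where
  "closed_form A \<omega> \<longleftrightarrow>
     (\<forall>c\<in>A. \<forall>y\<in>chart_image c. \<forall>u v w.
        frechet_derivative (\<lambda>z. \<omega> c z v w) (at y) u
      - frechet_derivative (\<lambda>z. \<omega> c z u w) (at y) v
      + frechet_derivative (\<lambda>z. \<omega> c z u v) (at y) w = 0)"

definition nondegenerate_form ::
    "('a, 'e::euclidean_space) chart set \<Rightarrow> ('a, 'e) coord_form \<Rightarrow> bool" where
  "nondegenerate_form A \<omega> \<longleftrightarrow>
     (\<forall>c\<in>A. \<forall>y\<in>chart_image c. \<forall>v. v \<noteq> 0 \<longrightarrow> (\<exists>w. \<omega> c y v w \<noteq> 0))"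

definition symplectic_manifold ::
    "('a::{t2_space,second_countable_topology}, 'e::euclidean_space) chart set \<Rightarrow>
     ('a, 'e) coord_form \<Rightarrow> bool" where
  "symplectic_manifold A \<omega> \<longleftrightarrow>
     smooth_atlas A \<and> two_form A \<omega> \<and> closed_form A \<omega> \<and> nondegenerate_form A \<omega>"

definition Symp ::
    "('a::topological_space, 'e::euclidean_space) chart set \<Rightarrow> ('a, 'e) coord_form \<Rightarrow>
     ('a \<Rightarrow> 'a) monoid" where
  "Symp A \<omega> = \<lparr>carrier = {f. diffeomorphism A f \<and> preserves_form A \<omega> f},
                 mult = (\<circ>), one = id\<rparr>"


section \<open>Continuous and smooth singular simplices\<close>

text \<open>The library realizes the standard simplices inside \<open>nat \<Rightarrow> real\<close>. Smoothness of
  functions on open subsets of this space means that all iterated partial derivatives exist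
  and are continuous. As a standard \<open>p\<close>-simplex lies in the first \<open>p + 1\<close> coordinates, a
  function on it extends locally to such a function if and only if it extends locally to
  a smooth function of these \<open>p + 1\<close> coordinates.\<close>

definition partial_deriv ::
    "nat \<Rightarrow> ((nat \<Rightarrow> real) \<Rightarrow> 'e::real_normed_vector) \<Rightarrow> (nat \<Rightarrow> real) \<Rightarrow> 'e" where
  "partial_deriv i F t = vector_derivative (\<lambda>h. F (t(i := h))) (at (t i))"

primrec partial_Ck_on ::
    "nat \<Rightarrow> ((nat \<Rightarrow> real) \<Rightarrow> 'e::real_normed_vector) \<Rightarrow> (nat \<Rightarrow> real) set \<Rightarrow> bool" where
  "partial_Ck_on 0 F N \<longleftrightarrow> continuous_on N F"
| "partial_Ck_on (Suc k) F N \<longleftrightarrow>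
     (\<forall>i. (\<forall>t\<in>N. (\<lambda>h. F (t(i := h))) differentiable (at (t i))) \<and>
          partial_Ck_on k (partial_deriv i F) N)"

definition smooth_simplex ::
    "('a::topological_space, 'e::euclidean_space) chart set \<Rightarrow> nat \<Rightarrow>
     ((nat \<Rightarrow> real) \<Rightarrow> 'a) \<Rightarrow> bool" where
  "smooth_simplex A p s \<longleftrightarrow> singular_simplex p euclidean s \<and>
     (\<forall>t\<in>standard_simplex p. \<exists>c\<in>A. \<exists>N F. open N \<and> t \<in> N \<and> (\<forall>k. partial_Ck_on k F N) \<and>
        (\<forall>u \<in> N \<inter> standard_simplex p. s u \<in> fst c \<and> snd c (s u) = F u))"

text \<open>Singular chains and cochains can be taken in the continuous or in the smooth singular
  complex; the complex in use also determines which paths and disks are allowed.\<close>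

datatype regularity = Continuous | Smooth

definition simplices ::
    "('a::topological_space, 'e::euclidean_space) chart set \<Rightarrow> regularity \<Rightarrow> nat \<Rightarrow>
     ((nat \<Rightarrow> real) \<Rightarrow> 'a) set" where
  "simplices A r p = (case r of
      Continuous \<Rightarrow> {s. singular_simplex p euclidean s}
    | Smooth \<Rightarrow> {s. smooth_simplex A p s})"

definition chains ::
    "('a::topological_space, 'e::euclidean_space) chart set \<Rightarrow> regularity \<Rightarrow> nat \<Rightarrow> 'a chain set"
  where "chains A r p = {c. Poly_Mapping.keys c \<subseteq> simplices A r p}"

text \<open>A cochain is given by its values on simplices.\<close>

definition pairing :: "(((nat \<Rightarrow> real) \<Rightarrow> 'a) \<Rightarrow> 'm::ring_1) \<Rightarrow> 'a chain \<Rightarrow> 'm" where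
  "pairing w c = (\<Sum>s\<in>Poly_Mapping.keys c. of_int (Poly_Mapping.lookup c s) * w s)"

definition pullback ::
    "nat \<Rightarrow> ('a \<Rightarrow> 'a) \<Rightarrow> (((nat \<Rightarrow> real) \<Rightarrow> 'a) \<Rightarrow> 'm) \<Rightarrow> ((nat \<Rightarrow> real) \<Rightarrow> 'a) \<Rightarrow> 'm" where
  "pullback p f w s = w (simplex_map p f s)"


section \<open>The class of the symplectic form\<close>

definition barycentric :: "real \<times> real \<Rightarrow> nat \<Rightarrow> real" where
  "barycentric z i = (if i = 0 then 1 - fst z - snd z else if i = 1 then fst z
                      else if i = 2 then snd z else 0)"

text \<open>The integral of \<open>\<omega>\<close> over a smooth two-simplex \<open>s\<close>. By the transformation rule for
  coordinate expressions, the integrand does not depend on the chart chosen at each point;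
  the boundary of the triangle has measure zero.\<close>

definition form_integral ::
    "('a, 'e::euclidean_space) chart set \<Rightarrow> ('a, 'e) coord_form \<Rightarrow> ((nat \<Rightarrow> real) \<Rightarrow> 'a) \<Rightarrow> real"
  where
  "form_integral A \<omega> s = integral {(x, y). 0 < x \<and> 0 < y \<and> x + y < 1}
     (\<lambda>z. let c = (SOME c. c \<in> A \<and> s (barycentric z) \<in> fst c);
              g = snd c \<circ> s \<circ> barycentric;
              D = frechet_derivative g (at z)
          in \<omega> c (g z) (D (1, 0)) (D (0, 1)))"

text \<open>\<open>w\<close> is an integral two-cocycle whose class is mapped to \<open>[\<omega>]\<close> in real cohomology.
  The de Rham class \<open>[\<omega>]\<close> is the class of integration over smooth simplices; a continuous
  singular class is compared with it by restriction to smooth simplices.\<close>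

definition represents_integral_class ::
    "('a::topological_space, 'e::euclidean_space) chart set \<Rightarrow> ('a, 'e) coord_form \<Rightarrow>
     regularity \<Rightarrow> (((nat \<Rightarrow> real) \<Rightarrow> 'a) \<Rightarrow> int) \<Rightarrow> bool" where
  "represents_integral_class A \<omega> r w \<longleftrightarrow>
     (\<forall>T\<in>simplices A r 3. pairing w (chain_boundary 3 (frag_of T)) = 0) \<and>
     (\<exists>\<eta>. \<forall>s\<in>simplices A Smooth 2.
        real_of_int (w s) = form_integral A \<omega> s + pairing \<eta> (chain_boundary 2 (frag_of s)))"

definition integral_form ::
    "('a::topological_space, 'e::euclidean_space) chart set \<Rightarrow> ('a, 'e) coord_form \<Rightarrow> bool" where
  "integral_form A \<omega> \<longleftrightarrow> (\<exists>w. represents_integral_class A \<omega> Continuous w)"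


section \<open>Group cohomology with trivial coefficients\<close>

definition tuples :: "('g, 'x) monoid_scheme \<Rightarrow> nat \<Rightarrow> 'g list set" where
  "tuples G p = {gs. length gs = p \<and> set gs \<subseteq> carrier G}"

text \<open>Functions on \<open>G\<^sup>p\<close>, extended by zero.\<close>

definition grp_cochains ::
    "('g, 'x) monoid_scheme \<Rightarrow> nat \<Rightarrow> ('g list \<Rightarrow> 'm::ab_group_add) set" where
  "grp_cochains G p = {c. \<forall>gs. gs \<notin> tuples G p \<longrightarrow> c gs = 0}"

text \<open>Multiply the \<open>i\<close>-th and the \<open>(i+1)\<close>-st entry, counted from one.\<close>

definition merge :: "('g, 'x) monoid_scheme \<Rightarrow> nat \<Rightarrow> 'g list \<Rightarrow> 'g list" where
  "merge G i gs = take (i - 1) gs @ [gs ! (i - 1) \<otimes>\<^bsub>G\<^esub> gs ! i] @ drop (i + 1) gs"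

definition alt_sign :: "nat \<Rightarrow> 'm::ab_group_add \<Rightarrow> 'm" where
  "alt_sign i a = (if even i then a else - a)"

definition grp_delta ::
    "('g, 'x) monoid_scheme \<Rightarrow> nat \<Rightarrow> ('g list \<Rightarrow> 'm::ab_group_add) \<Rightarrow> 'g list \<Rightarrow> 'm" where
  "grp_delta G p c = (\<lambda>gs. if gs \<in> tuples G (p + 1)
     then c (tl gs) + (\<Sum>i=1..p. alt_sign i (c (merge G i gs))) + alt_sign (p + 1) (c (butlast gs))
     else 0)"

definition grp_cocycles ::
    "('g, 'x) monoid_scheme \<Rightarrow> nat \<Rightarrow> ('g list \<Rightarrow> 'm::ab_group_add) monoid" where
  "grp_cocycles G p = \<lparr>carrier = {c \<in> grp_cochains G p. grp_delta G p c = (\<lambda>_. 0)},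
                        mult = (\<lambda>a b gs. a gs + b gs), one = (\<lambda>_. 0)\<rparr>"

definition grp_coboundaries ::
    "('g, 'x) monoid_scheme \<Rightarrow> nat \<Rightarrow> ('g list \<Rightarrow> 'm::ab_group_add) set" where
  "grp_coboundaries G p =
     (case p of 0 \<Rightarrow> {\<lambda>_. 0} | Suc q \<Rightarrow> grp_delta G q ` grp_cochains G q)"

definition grp_cohomology ::
    "('g, 'x) monoid_scheme \<Rightarrow> nat \<Rightarrow> ('g list \<Rightarrow> 'm::ab_group_add) set monoid" where
  "grp_cohomology G p = grp_cocycles G p Mod grp_coboundaries G p"

definition grp_class ::
    "('g, 'x) monoid_scheme \<Rightarrow> nat \<Rightarrow> ('g list \<Rightarrow> 'm::ab_group_add) \<Rightarrow> ('g list \<Rightarrow> 'm) set" where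
  "grp_class G p c = grp_coboundaries G p #>\<^bsub>grp_cocycles G p\<^esub> c"


section \<open>The three-cocycle\<close>

text \<open>\<open>path_simplex \<gamma>\<close> has boundary \<open>\<gamma>(1) - \<gamma>(0)\<close>.\<close>

definition path_simplex :: "(real \<Rightarrow> 'a) \<Rightarrow> (nat \<Rightarrow> real) \<Rightarrow> 'a" where
  "path_simplex \<gamma> = restrict (\<lambda>t. \<gamma> (t 1)) (standard_simplex 1)"

definition path_space ::
    "('a::topological_space, 'e::euclidean_space) chart set \<Rightarrow> regularity \<Rightarrow> 'a \<Rightarrow>
     (real \<Rightarrow> 'a) set" where
  "path_space A r x0 =
     {\<gamma>. path \<gamma> \<and> pathstart \<gamma> = x0 \<and> path_simplex \<gamma> \<in> simplices A r 1}"

text \<open>A set-theoretic section; it need not be continuous in \<open>x\<close>.\<close>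

definition path_section ::
    "('a::topological_space, 'e::euclidean_space) chart set \<Rightarrow> regularity \<Rightarrow> 'a \<Rightarrow>
     ('a \<Rightarrow> real \<Rightarrow> 'a) \<Rightarrow> bool" where
  "path_section A r x0 \<sigma> \<longleftrightarrow> (\<forall>x. \<sigma> x \<in> path_space A r x0 \<and> pathfinish (\<sigma> x) = x)"

text \<open>A choice of the disks. Cochains are evaluated on a disk through a two-chain
  with the prescribed boundary. Every such chain is admitted, in particular a single singular
  two-simplex, or a triangulated disk.\<close>

definition spanning_disks ::
    "('a::topological_space, 'e::euclidean_space) chart set \<Rightarrow> ('a, 'e) coord_form \<Rightarrow>
     regularity \<Rightarrow> 'a \<Rightarrow> ('a \<Rightarrow> real \<Rightarrow> 'a) \<Rightarrow> (('a \<Rightarrow> 'a) \<Rightarrow> ('a \<Rightarrow> 'a) \<Rightarrow> 'a chain) \<Rightarrow> bool"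
  where
  "spanning_disks A \<omega> r x0 \<sigma> \<Delta> \<longleftrightarrow>
     (\<forall>g\<in>carrier (Symp A \<omega>). \<forall>h\<in>carrier (Symp A \<omega>).
        \<Delta> g h \<in> chains A r 2 \<and>
        chain_boundary 2 (\<Delta> g h) =
            frag_of (path_simplex (\<sigma> (g x0)))
          - frag_of (path_simplex (\<sigma> (g (h x0))))
          + frag_of (path_simplex (g \<circ> \<sigma> (h x0))))"

text \<open>The cochain \<open>c(f,g,h)\<close>; the base point and the section enter through \<open>\<Delta>\<close>.\<close>

definition symp_cocycle ::
    "('a::topological_space, 'e::euclidean_space) chart set \<Rightarrow> ('a, 'e) coord_form \<Rightarrow>
     (('a \<Rightarrow> 'a) \<Rightarrow> ('a \<Rightarrow> 'a) \<Rightarrow> 'a chain) \<Rightarrow> (((nat \<Rightarrow> real) \<Rightarrow> 'a) \<Rightarrow> int) \<Rightarrow>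
     ('a \<Rightarrow> 'a) list \<Rightarrow> int" where
  "symp_cocycle A \<omega> \<Delta> w = (\<lambda>fs.
     if fs \<in> tuples (Symp A \<omega>) 3
     then let f = fs ! 0; g = fs ! 1; h = fs ! 2
          in pairing (\<lambda>s. pullback 2 f w s - w s) (\<Delta> g h)
     else 0)"

end

theory Submission
  imports Defs
begin

text \<open>Write \<open>u f = f\<^sup>*w - w\<close>, so that \<open>u (f \<circ> g) = g\<^sup>*(u f) + u g\<close>. Integration of \<open>\<omega>\<close> over smooth simplices is
  invariant under symplectomorphisms and determines \<open>w\<close> on smooth two-cycles; hence \<open>u f\<close> and the
  difference of two representatives \<open>w\<close>, \<open>w'\<close> vanish on two-cycles. The boundary condition makes
  \<open>\<Delta> f g + \<Delta> (f \<circ> g) h - \<Delta> f (g \<circ> h) - f \<Delta> g h\<close> a two-cycle. On it \<open>u\<close> gives the cocycle identity, and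
  \<open>w - w'\<close> shows that changing \<open>w\<close> adds the coboundary of \<open>(w - w') (\<Delta> g h)\<close>. If \<open>\<rho>\<close> is a path from \<open>x0\<close> to
  \<open>x0'\<close>, then \<open>\<sigma>' (g x0') - \<sigma> (g x0) - g \<rho> + \<rho>\<close> is a one-cycle, hence the boundary of some \<open>K g\<close>, and
  changing the base point and the section adds the coboundary of \<open>- u f (K g)\<close>.

  For continuous chains one needs that a two-cycle is homologous to a smooth one, and for smooth
  chains that a smooth one-cycle which bounds a continuous chain bounds a smooth one. Both follow by
  subdividing until every triangle lies in a chart ball, where smooth cycles bound smooth chains
  and continuous cycles bound continuous chains.\<close>

section \<open>Iterated partial derivatives\<close>

text \<open>Neither u f nor w - w' is ever written as a coboundary: only their values on two-cycles
  are computed. No primitive has to be chosen, and an identity of integers follows from the same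
  identity of real integrals. The cochain \<open>w\<close> is tied to \<omega> on smooth simplices
  alone and only up to the correction \<eta>, which is evaluated on boundaries and so drops out on
  cycles. A continuous cycle therefore needs a smooth representative whose image under f still
  represents the image cycle; if E bounds z - z', then f E bounds f z - f z'. Two obstacles shape
  the technical part. Simplices live on \<open>nat \<Rightarrow> real\<close>, so chain rules must
  be derived from partial derivatives with finitely many coordinates moving at a time. And smoothing
  must leave edges that are already smooth untouched: then one construction yields both the smooth
  representative of a two-cycle and a smooth filling of a smooth one-cycle.\<close>

text \<open>With infinitely many coordinates, \<open>partial_Ck_on (Suc k) F N\<close> does not imply \<open>partial_Ck_on k F N\<close>,
  nor the continuity of \<open>F\<close>.\<close>

definition partial_upto ::
    "nat \<Rightarrow> ((nat \<Rightarrow> real) \<Rightarrow> 'e::real_normed_vector) \<Rightarrow> (nat \<Rightarrow> real) set \<Rightarrow> bool" where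
  "partial_upto k F N \<longleftrightarrow> (\<forall>j\<le>k. partial_Ck_on j F N)"

lemma partial_upto_0: "partial_upto 0 F N \<longleftrightarrow> continuous_on N F"
  by (simp add: partial_upto_def)

lemma partial_upto_Suc:
  "partial_upto (Suc k) F N \<longleftrightarrow> continuous_on N F \<and>
     (\<forall>i. (\<forall>t\<in>N. (\<lambda>h. F (t(i := h))) differentiable (at (t i))) \<and>
          partial_upto k (partial_deriv i F) N)"
  (is "?L \<longleftrightarrow> ?R")
proof
  assume L: ?L
  have "partial_Ck_on (Suc j) F N" if "j \<le> k" for j
    using L that by (auto simp: partial_upto_def)
  then show ?R
    using L by (force simp: partial_upto_def)
next
  assume R: ?R
  then show ?L
    by (auto simp: partial_upto_def le_Suc_eq elim!: le_SucE)
       (metis R nat.exhaust not_less_eq_eq partial_Ck_on.simps partial_upto_def le_SucI)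
qed

lemma all_partial_Ck_on_iff: "(\<forall>k. partial_Ck_on k F N) \<longleftrightarrow> (\<forall>k. partial_upto k F N)"
  by (auto simp: partial_upto_def)

lemma partial_upto_mono: "partial_upto k F N \<Longrightarrow> j \<le> k \<Longrightarrow> partial_upto j F N"
  by (auto simp: partial_upto_def)

lemma partial_upto_continuous: "partial_upto k F N \<Longrightarrow> continuous_on N F"
  by (cases k) (auto simp: partial_upto_0 partial_upto_Suc)

lemma partial_upto_has_derivative:
  assumes "partial_upto (Suc k) F N" "t \<in> N"
  shows "((\<lambda>h. F (t(i := h))) has_vector_derivative partial_deriv i F t) (at (t i))"
  using assms by (auto simp: partial_upto_Suc partial_deriv_def vector_derivative_works)

lemma partial_upto_partial_deriv:
  "partial_upto (Suc k) F N \<Longrightarrow> partial_upto k (partial_deriv i F) N"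
  by (auto simp: partial_upto_Suc)

text \<open>This makes the one-variable derivative at a point of \<open>N\<close> depend only on the
  values of the function in \<open>N\<close>: the slice is the preimage of \<open>N\<close> under a
  continuous curve.\<close>

lemma open_coordinate_slice:
  assumes "open (N :: (nat \<Rightarrow> real) set)"
  shows "open {h. t(i := h) \<in> N}"
proof -
  have "continuous_on UNIV (\<lambda>h. t(i := h :: real))"
  proof (rule continuous_on_coordinatewise_then_product)
    fix j
    show "continuous_on UNIV (\<lambda>h. (t(i := h)) j)"
      by (cases "j = i") auto
  qed
  from open_vimage[OF assms this] show ?thesis
    by (simp add: vimage_def)
qed

lemma partial_upto_cong:
  assumes "open N" "partial_upto k F N" "\<And>t. t \<in> N \<Longrightarrow> F t = G t"
  shows "partial_upto k G N"
  using assms(2,3)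
proof (induction k arbitrary: F G)
  case 0
  then show ?case
    by (simp add: partial_upto_0 cong: continuous_on_cong)
next
  case (Suc k)
  have deriv: "((\<lambda>h. G (t(i := h))) has_vector_derivative partial_deriv i F t) (at (t i))"
    if t: "t \<in> N" for i t
    by (rule has_vector_derivative_transform_within_open
        [OF partial_upto_has_derivative[OF Suc.prems(1) t] open_coordinate_slice[OF assms(1), of t i]])
       (use t Suc.prems(2) in \<open>simp_all only: mem_Collect_eq fun_upd_triv\<close>)
  have "partial_upto k (partial_deriv i G) N" for i
    using vector_derivative_at[OF deriv]
    by (intro Suc.IH[OF partial_upto_partial_deriv[OF Suc.prems(1), of i]])
       (simp add: partial_deriv_def)
  moreover have "continuous_on N G"
    using partial_upto_continuous[OF Suc.prems(1)] Suc.prems(2) by (simp cong: continuous_on_cong)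
  ultimately show ?case
    unfolding partial_upto_Suc using deriv differentiableI_vector by blast
qed

text \<open>\<open>partial_deriv\<close> rests on a choice of derivative, so closure properties are
  proved by exhibiting the expected formula \<open>F'\<close> and its regularity. The product and
  chain rules below all have this shape.\<close>

lemma partial_upto_SucI:
  assumes "open N" "continuous_on N F"
    and "\<And>i t. t \<in> N \<Longrightarrow> ((\<lambda>h. F (t(i := h))) has_vector_derivative F' i t) (at (t i))"
    and "\<And>i. partial_upto k (F' i) N"
  shows "partial_upto (Suc k) F N"
  unfolding partial_upto_Suc
proof (intro conjI allI ballI assms)
  fix i t assume "t \<in> N"
  then show "(\<lambda>h. F (t(i := h))) differentiable at (t i)"
    using assms(3) differentiableI_vector by blast
next
  fix i
  show "partial_upto k (partial_deriv i F) N"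
    by (rule partial_upto_cong[OF assms(1) assms(4)[of i]])
       (simp add: partial_deriv_def vector_derivative_at[OF assms(3)])
qed

lemma partial_upto_subset: "partial_upto k F N \<Longrightarrow> M \<subseteq> N \<Longrightarrow> partial_upto k F M"
proof (induction k arbitrary: F)
  case 0
  then show ?case by (auto simp: partial_upto_0 intro: continuous_on_subset)
next
  case (Suc k)
  then show ?case
    unfolding partial_upto_Suc by (meson continuous_on_subset subsetD)
qed

lemma partial_upto_const: "partial_upto k (\<lambda>_. c) N"
proof (induction k arbitrary: c)
  case (Suc k)
  have "partial_deriv i (\<lambda>_. c) = (\<lambda>_. 0)" for i
    by (simp add: partial_deriv_def fun_eq_iff)
  with Suc show ?case
    by (simp add: partial_upto_Suc)
qed (simp add: partial_upto_0)

lemma partial_upto_coordinate: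
  assumes "open N"
  shows "partial_upto k (\<lambda>t. t j) N"
proof (cases k)
  case 0
  then show ?thesis
    by (simp add: partial_upto_0 continuous_on_subset[OF continuous_on_product_coordinates])
next
  case (Suc l)
  have "partial_upto (Suc l) (\<lambda>t. t j) N"
  proof (rule partial_upto_SucI[where F' = "\<lambda>i _. if i = j then 1 else 0"])
    fix i and t :: "nat \<Rightarrow> real"
    show "((\<lambda>h. (t(i := h)) j) has_vector_derivative (if i = j then 1 else 0)) (at (t i))"
      by auto
  qed (auto simp: assms partial_upto_const continuous_on_subset[OF continuous_on_product_coordinates])
  with Suc show ?thesis by simp
qed

lemma partial_upto_add:
  assumes "open N"
  shows "partial_upto k F N \<Longrightarrow> partial_upto k G N \<Longrightarrow> partial_upto k (\<lambda>t. F t + G t) N"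
proof (induction k arbitrary: F G)
  case 0
  then show ?case by (auto simp: partial_upto_0 intro: continuous_intros)
next
  case (Suc k)
  show ?case
    by (rule partial_upto_SucI[where F' = "\<lambda>i t. partial_deriv i F t + partial_deriv i G t"])
       (intro assms continuous_on_add has_vector_derivative_add Suc.IH
          Suc.prems[THEN partial_upto_continuous] Suc.prems[THEN partial_upto_has_derivative]
          Suc.prems[THEN partial_upto_partial_deriv] | assumption)+
qed

lemma partial_upto_sum:
  assumes "open N" "\<And>j. j \<in> J \<Longrightarrow> partial_upto k (F j) N"
  shows "partial_upto k (\<lambda>t. \<Sum>j\<in>J. F j t) N"
  using assms(2)
  by (induction J rule: infinite_finite_induct)
     (simp_all add: partial_upto_const partial_upto_add[OF assms(1)])

lemma partial_upto_scaleR: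
  assumes "open N"
  shows "partial_upto k f N \<Longrightarrow> partial_upto k G N \<Longrightarrow> partial_upto k (\<lambda>t. f t *\<^sub>R G t) N"
proof (induction k arbitrary: f G)
  case 0
  then show ?case by (auto simp: partial_upto_0 intro: continuous_intros)
next
  case (Suc k)
  have "partial_upto k f N" "partial_upto k G N"
    using Suc.prems partial_upto_mono by (meson le_SucI order_refl)+
  then have part: "partial_upto k (\<lambda>t. f t *\<^sub>R partial_deriv i G t + partial_deriv i f t *\<^sub>R G t) N" for i
    using Suc by (intro partial_upto_add[OF assms] Suc.IH partial_upto_partial_deriv) auto
  have deriv: "((\<lambda>h. f (t(i := h)) *\<^sub>R G (t(i := h))) has_vector_derivative
          f t *\<^sub>R partial_deriv i G t + partial_deriv i f t *\<^sub>R G t) (at (t i))" if "t \<in> N" for i t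
    using has_vector_derivative_scaleR[of "\<lambda>h. f (t(i := h))" "partial_deriv i f t" "t i" UNIV
        "\<lambda>h. G (t(i := h))" "partial_deriv i G t"]
      partial_upto_has_derivative[OF Suc.prems(1) that] partial_upto_has_derivative[OF Suc.prems(2) that]
    by (simp add: has_real_derivative_iff_has_vector_derivative)
  show ?case
    by (rule partial_upto_SucI[OF _ _ deriv part])
       (intro assms continuous_on_scaleR Suc.prems[THEN partial_upto_continuous] | assumption)+
qed

lemma partial_upto_bounded_linear:
  assumes "open N" "bounded_linear L"
  shows "partial_upto k F N \<Longrightarrow> partial_upto k (\<lambda>t. L (F t)) N"
proof (induction k arbitrary: F)
  case 0
  then show ?case
    by (auto simp: partial_upto_0 intro: bounded_linear.continuous_on[OF assms(2)])
next
  case (Suc k)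
  show ?case
    by (rule partial_upto_SucI[where F' = "\<lambda>i t. L (partial_deriv i F t)"])
       (intro assms bounded_linear.continuous_on[OF assms(2)] bounded_linear.has_vector_derivative[OF assms(2)]
          Suc.IH partial_upto_continuous[OF Suc.prems] partial_upto_has_derivative[OF Suc.prems]
          partial_upto_partial_deriv[OF Suc.prems] | assumption)+
qed

text \<open>Only the coordinates in the finite set \<open>J\<close> move, so that the one-variable partial derivatives
  can be combined one coordinate at a time.\<close>

lemma has_vector_derivative_direction:
  fixes F :: "(nat \<Rightarrow> real) \<Rightarrow> 'e::real_normed_vector"
  assumes F: "partial_upto (Suc 0) F N" and "open N" "x \<in> N" "finite J"
  shows "((\<lambda>h. F (\<lambda>j. if j \<in> J then x j + h * w j else x j)) has_vector_derivative
           (\<Sum>j\<in>J. w j *\<^sub>R partial_deriv j F x)) (at 0)"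
  using \<open>finite J\<close>
proof (induction J)
  case empty
  then show ?case by simp
next
  case (insert a J)
  \<comment> \<open>Coordinate \<open>a\<close> gets its own parameter \<open>v\<close>, the earlier
    ones share \<open>u\<close>. The curve of the claim is the line \<open>(h, h * w a)\<close> in
    the parameter plane.\<close>
  define P where "P u v = (\<lambda>j. if j = a then x a + v else if j \<in> J then x j + u * w j else x j)"
    for u v :: real
  have P0: "P 0 0 = x"
    by (auto simp: P_def)
  have contP: "continuous_on UNIV (\<lambda>z. P (fst z) (snd z))"
    unfolding P_def
  proof (rule continuous_on_coordinatewise_then_product)
    fix i
    show "continuous_on UNIV (\<lambda>z. if i = a then x a + snd z else if i \<in> J then x i + fst z * w i else x i)"
      by (cases "i = a"; cases "i \<in> J") (auto intro!: continuous_intros)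
  qed
  have "open ((\<lambda>z. P (fst z) (snd z)) -` N)"
    using open_vimage[OF \<open>open N\<close> contP] .
  moreover have "(0, 0) \<in> (\<lambda>z. P (fst z) (snd z)) -` N"
    using P0 \<open>x \<in> N\<close> by simp
  ultimately obtain U V where UV: "open U" "open V" "0 \<in> U" "0 \<in> V"
    and sub: "U \<times> V \<subseteq> (\<lambda>z. P (fst z) (snd z)) -` N"
    by (auto elim!: open_prod_elim)
  \<comment> \<open>A ball, because \<open>has_derivative_partialsI\<close> needs convexity in the
    second variable.\<close>
  obtain r where r: "r > 0" "ball 0 r \<subseteq> V"
    using UV open_contains_ball by metis
  let ?Y = "ball (0::real) r"
  have inN: "P u v \<in> N" if "u \<in> U" "v \<in> ?Y" for u v
  proof -
    have "(u, v) \<in> U \<times> V"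
      using that r(2) by blast
    then show ?thesis
      using sub by (force dest: subsetD)
  qed
  \<comment> \<open>The derivative in \<open>u\<close> is known at a single point, from the
    induction hypothesis; the one in \<open>v\<close> exists nearby and is continuous. This
    asymmetric input already gives total differentiability.\<close>
  have "((\<lambda>(u, v). F (P u v)) has_derivative
      (\<lambda>(tu, tv). tu *\<^sub>R (\<Sum>j\<in>J. w j *\<^sub>R partial_deriv j F x) +
          blinfun_scaleR_left (partial_deriv a F (P 0 0)) tv)) (at (0, 0) within U \<times> ?Y)"
  proof (rule has_derivative_partialsI[where f = "\<lambda>u v. F (P u v)"
        and fy = "\<lambda>u v. blinfun_scaleR_left (partial_deriv a F (P u v))"])
    have "(\<lambda>u. F (P u 0)) = (\<lambda>h. F (\<lambda>j. if j \<in> J then x j + h * w j else x j))"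
      using insert.hyps by (intro ext arg_cong[of _ _ F]) (auto simp: P_def)
    then show "((\<lambda>u. F (P u 0)) has_derivative (\<lambda>tu. tu *\<^sub>R (\<Sum>j\<in>J. w j *\<^sub>R partial_deriv j F x)))
        (at 0 within U)"
      using insert.IH by (simp add: has_vector_derivative_def has_derivative_at_withinI)
  next
    fix u v assume "u \<in> U" "v \<in> ?Y"
    from partial_upto_has_derivative[OF F inN[OF this], of a]
    have "((\<lambda>h. F ((P u v)(a := h))) has_vector_derivative partial_deriv a F (P u v)) (at (x a + v))"
      by (simp add: P_def)
    then have "((\<lambda>h. F ((P u v)(a := h))) \<circ> (\<lambda>h. x a + h) has_vector_derivative
        1 *\<^sub>R partial_deriv a F (P u v)) (at v)"
      by (intro vector_diff_chain_at) (auto intro!: derivative_eq_intros)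
    moreover have "(\<lambda>h. F ((P u v)(a := h))) \<circ> (\<lambda>h. x a + h) = (\<lambda>v. F (P u v))"
      by (auto simp: P_def fun_eq_iff intro!: arg_cong[of _ _ F])
    ultimately show "((\<lambda>v. F (P u v)) has_derivative
        blinfun_apply (blinfun_scaleR_left (partial_deriv a F (P u v)))) (at v within ?Y)"
      by (simp add: has_vector_derivative_def has_derivative_at_withinI)
  next
    have "continuous_on (U \<times> ?Y) (\<lambda>z. partial_deriv a F (P (fst z) (snd z)))"
      using partial_upto_continuous[OF partial_upto_partial_deriv[OF F, of a]] inN
      by (intro continuous_on_compose2[OF _ continuous_on_subset[OF contP]]) auto
    then have "continuous_on (U \<times> ?Y) (\<lambda>z. blinfun_scaleR_left (partial_deriv a F (P (fst z) (snd z))))"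
      by (rule bounded_linear.continuous_on[OF bounded_linear_blinfun_scaleR_left])
    then show "continuous (at (0, 0) within U \<times> ?Y)
        (\<lambda>(u, v). blinfun_scaleR_left (partial_deriv a F (P u v)))"
      using UV r by (simp add: continuous_on_eq_continuous_within split_beta')
  qed (use r in auto)
  then have D: "((\<lambda>(u, v). F (P u v)) has_derivative
      (\<lambda>(tu, tv). tu *\<^sub>R (\<Sum>j\<in>J. w j *\<^sub>R partial_deriv j F x) + tv *\<^sub>R partial_deriv a F x)) (at (0, 0))"
    using UV r by (simp add: P0 at_within_open[OF _ open_Times])
  have "((\<lambda>h. (h, h * w a)) has_vector_derivative (1, w a)) (at 0)"
    by (auto intro!: derivative_eq_intros has_vector_derivative_Pair
        simp: has_real_derivative_iff_has_vector_derivative[symmetric])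
  then have L: "((\<lambda>h. (h, h * w a)) has_derivative (\<lambda>t. t *\<^sub>R (1, w a))) (at 0)"
    by (simp add: has_vector_derivative_def)
  have D': "((\<lambda>(u, v). F (P u v)) has_derivative
      (\<lambda>(tu, tv). tu *\<^sub>R (\<Sum>j\<in>J. w j *\<^sub>R partial_deriv j F x) + tv *\<^sub>R partial_deriv a F x))
      (at ((\<lambda>h. (h, h * w a)) 0))"
    using D by simp
  have "(\<lambda>(u, v). F (P u v)) \<circ> (\<lambda>h. (h, h * w a)) =
      (\<lambda>h. F (\<lambda>j. if j \<in> insert a J then x j + h * w j else x j))"
    by (auto simp: P_def fun_eq_iff intro!: arg_cong[of _ _ F])
  then show ?case
    using diff_chain_at[OF L D'] insert.hyps
    by (simp add: has_vector_derivative_def o_def scaleR_add_right add.commute)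
qed

text \<open>Along each coordinate \<tau> moves on a line with velocity \<open>W i\<close> in
  finitely many coordinates, so the chain rule is a directional derivative. It yields a combination
  of partial derivatives of \<open>F\<close> composed with the same \<tau>; hence the induction
  varies \<open>F\<close> only.\<close>

lemma partial_upto_affine:
  fixes F :: "(nat \<Rightarrow> real) \<Rightarrow> 'e::real_normed_vector"
  assumes "open N" "open N'" and cont: "continuous_on N' \<tau>" and maps: "\<tau> ` N' \<subseteq> N"
    and fin: "\<And>i. finite (J i)"
    and \<tau>: "\<And>i t h. \<tau> (t(i := h)) =
      (\<lambda>j. if j \<in> J i then \<tau> t j + (h - t i) * W i j else \<tau> t j)"
  shows "partial_upto k F N \<Longrightarrow> partial_upto k (\<lambda>t. F (\<tau> t)) N'"
proof (induction k arbitrary: F)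
  case 0
  then show ?case
    using continuous_on_compose2[OF _ cont maps] by (auto simp: partial_upto_0)
next
  case (Suc k)
  have deriv: "((\<lambda>h. F (\<tau> (t(i := h)))) has_vector_derivative
      (\<Sum>j\<in>J i. W i j *\<^sub>R partial_deriv j F (\<tau> t))) (at (t i))" if t: "t \<in> N'" for i t
  proof -
    have "((\<lambda>h. F (\<lambda>j. if j \<in> J i then \<tau> t j + h * W i j else \<tau> t j)) has_vector_derivative
           (\<Sum>j\<in>J i. W i j *\<^sub>R partial_deriv j F (\<tau> t))) (at ((\<lambda>h. h - t i) (t i)))"
      using has_vector_derivative_direction[OF partial_upto_mono[OF Suc.prems] \<open>open N\<close> _ fin] t maps
      by auto
    from vector_diff_chain_at[of "\<lambda>h. h - t i" 1 "t i", OF _ this]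
    show ?thesis
      unfolding o_def \<tau> scaleR_one by (simp add: has_vector_derivative_diff_const)
  qed
  have part: "partial_upto k (\<lambda>t. \<Sum>j\<in>J i. W i j *\<^sub>R partial_deriv j F (\<tau> t)) N'" for i
    by (intro partial_upto_sum partial_upto_scaleR partial_upto_const \<open>open N'\<close> Suc.IH
        partial_upto_partial_deriv[OF Suc.prems])
  show ?case
    by (rule partial_upto_SucI[OF _ _ deriv part])
       (use \<open>open N'\<close> continuous_on_compose2[OF partial_upto_continuous[OF Suc.prems] cont maps] in auto)
qed

section \<open>Composition with maps between Euclidean spaces\<close>

lemma Ck_on_continuous: "Ck_on k G S \<Longrightarrow> continuous_on S G"
  by (cases k)
     (auto simp: differentiable_imp_continuous_within continuous_at_imp_continuous_on)

text \<open>\<open>Ck_on\<close> controls derivatives in fixed directions only. Expansion in the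
  basis moves a varying direction into scalar coefficients, which reduces the chain rule to sums and
  products.\<close>

lemma frechet_derivative_basis:
  fixes G :: "'e::euclidean_space \<Rightarrow> 'f::real_normed_vector"
  assumes "G differentiable (at x)"
  shows "frechet_derivative G (at x) v = (\<Sum>b\<in>Basis. (v \<bullet> b) *\<^sub>R frechet_derivative G (at x) b)"
proof -
  have "linear (frechet_derivative G (at x))"
    using assms linear_frechet_derivative by blast
  then have "frechet_derivative G (at x) (\<Sum>b\<in>Basis. (v \<bullet> b) *\<^sub>R b) =
      (\<Sum>b\<in>Basis. (v \<bullet> b) *\<^sub>R frechet_derivative G (at x) b)"
    by (simp add: linear_sum linear_cmul)
  then show ?thesis
    by (simp add: euclidean_representation)
qed

lemma partial_upto_compose:
  fixes G :: "'e::euclidean_space \<Rightarrow> 'f::real_normed_vector"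
  assumes "open N" "F ` N \<subseteq> S"
  shows "Ck_on k G S \<Longrightarrow> partial_upto k F N \<Longrightarrow> partial_upto k (\<lambda>t. G (F t)) N"
proof (induction k arbitrary: G)
  case 0
  then show ?case
    using assms by (auto simp: partial_upto_0 intro: continuous_on_compose2)
next
  case (Suc k)
  have deriv: "((\<lambda>h. G (F (t(i := h)))) has_vector_derivative
      (\<Sum>b\<in>Basis. (partial_deriv i F t \<bullet> b) *\<^sub>R frechet_derivative G (at (F t)) b)) (at (t i))"
    if t: "t \<in> N" for i t
  proof -
    have "G differentiable (at (F t))"
      using Suc.prems(1) assms t by auto
    then have "(G has_derivative frechet_derivative G (at (F t))) (at (F (t(i := t i))))"
      by (simp add: frechet_derivative_works)
    from vector_derivative_diff_chain_within[OF partial_upto_has_derivative[OF Suc.prems(2) t, of i]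
        has_derivative_at_withinI[OF this]]
    show ?thesis
      using frechet_derivative_basis[OF \<open>G differentiable (at (F t))\<close>, of "partial_deriv i F t"]
      by (simp only: o_def fun_upd_triv)
  qed
  have part: "partial_upto k (\<lambda>t. \<Sum>b\<in>Basis. (partial_deriv i F t \<bullet> b) *\<^sub>R
      frechet_derivative G (at (F t)) b) N" for i
  proof (intro partial_upto_sum partial_upto_scaleR \<open>open N\<close>)
    fix b :: 'e
    show "partial_upto k (\<lambda>t. partial_deriv i F t \<bullet> b) N"
      by (rule partial_upto_bounded_linear[OF \<open>open N\<close> bounded_linear_inner_left
          partial_upto_partial_deriv[OF Suc.prems(2)]])
    show "partial_upto k (\<lambda>t. frechet_derivative G (at (F t)) b) N"
      using Suc.IH[of "\<lambda>y. frechet_derivative G (at y) b"] Suc.prems(1)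
        partial_upto_mono[OF Suc.prems(2), of k] by auto
  qed
  show ?case
    by (rule partial_upto_SucI[OF _ _ deriv part])
       (use assms continuous_on_compose2[OF Ck_on_continuous[OF Suc.prems(1)]
            partial_upto_continuous[OF Suc.prems(2)]] in auto)
qed

section \<open>Smooth maps and the symplectomorphism group\<close>

lemma frechet_derivative_cong_open:
  assumes "open S" "x \<in> S" "\<And>y. y \<in> S \<Longrightarrow> f y = g y" "f differentiable (at x)"
  shows "g differentiable (at x)" "frechet_derivative g (at x) = frechet_derivative f (at x)"
proof -
  have "(g has_derivative frechet_derivative f (at x)) (at x)"
    using has_derivative_transform_within_open[OF _ assms(1,2,3)] assms(4)
    by (simp add: frechet_derivative_works)
  then show "g differentiable (at x)" "frechet_derivative g (at x) = frechet_derivative f (at x)"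
    using differentiable_def frechet_derivative_at by fastforce+
qed

lemma Ck_on_cong_open:
  assumes "open S" "\<And>y. y \<in> S \<Longrightarrow> f y = g y" "Ck_on k f S"
  shows "Ck_on k g S"
  using assms(2,3)
proof (induction k arbitrary: f g)
  case 0
  then show ?case by (simp cong: continuous_on_cong)
next
  case (Suc k)
  note D = frechet_derivative_cong_open[OF assms(1), of _ f g]
  have "Ck_on k (\<lambda>x. frechet_derivative g (at x) v) S" for v
    by (rule Suc.IH[of "\<lambda>x. frechet_derivative f (at x) v"]) (use Suc.prems D in auto)
  with Suc.prems D show ?case by auto
qed

lemma Ck_on_Suc_imp: "Ck_on (Suc k) f S \<Longrightarrow> Ck_on k f S"
proof (induction k arbitrary: f)
  case 0
  then show ?case using Ck_on_continuous[of "Suc 0"] by simp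
qed auto

lemma Ck_on_subset: "Ck_on k f S \<Longrightarrow> T \<subseteq> S \<Longrightarrow> Ck_on k f T"
  by (induction k arbitrary: f) (auto intro: continuous_on_subset)

text \<open>Needed for composites, whose intermediate point stays in a given chart only
  locally.\<close>

lemma Ck_on_local:
  assumes "\<And>x. x \<in> S \<Longrightarrow> \<exists>T. open T \<and> x \<in> T \<and> Ck_on k f T"
  shows "Ck_on k f S"
  using assms
proof (induction k arbitrary: f)
  case 0
  then show ?case
    by (meson Ck_on.simps(1) continuous_at_imp_continuous_on continuous_on_eq_continuous_at)
next
  case (Suc k)
  have "f differentiable (at x)" if "x \<in> S" for x
    using Suc.prems[OF that] by auto
  moreover have "Ck_on k (\<lambda>x. frechet_derivative f (at x) v) S" for v
    by (rule Suc.IH) (use Suc.prems in fastforce)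
  ultimately show ?case by simp
qed

lemma Ck_on_SucI:
  assumes "open S" "\<And>x. x \<in> S \<Longrightarrow> (f has_derivative f' x) (at x)"
    "\<And>v. Ck_on k (\<lambda>x. f' x v) S"
  shows "Ck_on (Suc k) f S"
proof -
  have "frechet_derivative f (at x) = f' x" if "x \<in> S" for x
    using assms(2)[OF that] frechet_derivative_at by metis
  then have "Ck_on k (\<lambda>x. frechet_derivative f (at x) v) S" for v
    by (intro Ck_on_cong_open[OF assms(1) _ assms(3)[of v]]) simp
  with assms(2) show ?thesis
    unfolding Ck_on.simps differentiable_def by blast
qed

lemma Ck_on_has_derivative:
  "Ck_on (Suc k) f S \<Longrightarrow> x \<in> S \<Longrightarrow> (f has_derivative frechet_derivative f (at x)) (at x)"
  by (simp add: frechet_derivative_works)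

lemma Ck_on_const: "Ck_on k (\<lambda>_. c) S"
  by (induction k arbitrary: c) (auto simp: frechet_derivative_const)

lemma Ck_on_add:
  assumes "open S"
  shows "Ck_on k f S \<Longrightarrow> Ck_on k g S \<Longrightarrow> Ck_on k (\<lambda>x. f x + g x) S"
proof (induction k arbitrary: f g)
  case (Suc k)
  show ?case
    by (rule Ck_on_SucI[OF assms has_derivative_add[OF Suc.prems[THEN Ck_on_has_derivative]]])
       (use Suc in auto)
qed (auto intro: continuous_intros)

lemma Ck_on_sum:
  assumes "open S" "\<And>i. i \<in> I \<Longrightarrow> Ck_on k (f i) S"
  shows "Ck_on k (\<lambda>x. \<Sum>i\<in>I. f i x) S"
  using assms(2)
  by (induction I rule: infinite_finite_induct) (simp_all add: Ck_on_const Ck_on_add[OF assms(1)])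

lemma Ck_on_scaleR:
  assumes "open S"
  shows "Ck_on k f S \<Longrightarrow> Ck_on k g S \<Longrightarrow> Ck_on k (\<lambda>x. f x *\<^sub>R g x) S"
proof (induction k arbitrary: f g)
  case (Suc k)
  show ?case
    by (rule Ck_on_SucI[OF assms has_derivative_scaleR[OF Suc.prems[THEN Ck_on_has_derivative]]])
       (use Suc Suc.prems[THEN Ck_on_Suc_imp] in \<open>auto intro!: Ck_on_add[OF assms]\<close>)
qed (auto intro: continuous_intros)

lemma Ck_on_bounded_linear:
  assumes "open S" "bounded_linear L"
  shows "Ck_on k f S \<Longrightarrow> Ck_on k (\<lambda>x. L (f x)) S"
proof (induction k arbitrary: f)
  case (Suc k)
  show ?case
    by (rule Ck_on_SucI[OF assms(1) bounded_linear.has_derivative[OF assms(2)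
          Suc.prems[THEN Ck_on_has_derivative]]]) (use Suc in auto)
qed (auto intro: bounded_linear.continuous_on[OF assms(2)])

lemma Ck_on_compose:
  fixes g :: "'e::euclidean_space \<Rightarrow> 'f::euclidean_space" and f :: "'f \<Rightarrow> 'h::real_normed_vector"
  assumes "open S" "g ` S \<subseteq> T"
  shows "Ck_on k f T \<Longrightarrow> Ck_on k g S \<Longrightarrow> Ck_on k (\<lambda>x. f (g x)) S"
proof (induction k arbitrary: f)
  case 0
  then show ?case
    using continuous_on_compose2[OF _ _ assms(2)] by auto
next
  case (Suc k)
  have f: "(f has_derivative frechet_derivative f (at (g x))) (at (g x))" if "x \<in> S" for x
    using Ck_on_has_derivative[OF Suc.prems(1)] that assms(2) by auto
  have deriv: "((\<lambda>x. f (g x)) has_derivative (\<lambda>v. \<Sum>b\<in>Basis.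
      (frechet_derivative g (at x) v \<bullet> b) *\<^sub>R frechet_derivative f (at (g x)) b)) (at x)"
    if "x \<in> S" for x
  proof -
    have "frechet_derivative f (at (g x)) \<circ> frechet_derivative g (at x) = (\<lambda>v. \<Sum>b\<in>Basis.
      (frechet_derivative g (at x) v \<bullet> b) *\<^sub>R frechet_derivative f (at (g x)) b)"
      unfolding o_def by (intro ext frechet_derivative_basis differentiableI[OF f[OF that]])
    then show ?thesis
      using diff_chain_at[OF Ck_on_has_derivative[OF Suc.prems(2) that] f[OF that]]
      by (simp only: o_def)
  qed
  show ?case
  proof (rule Ck_on_SucI[OF assms(1) deriv], assumption, intro Ck_on_sum Ck_on_scaleR assms(1))
    fix v and b :: 'f
    show "Ck_on k (\<lambda>x. frechet_derivative g (at x) v \<bullet> b) S"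
      using Suc.prems(2) by (intro Ck_on_bounded_linear[OF assms(1) bounded_linear_inner_left]) simp
    show "Ck_on k (\<lambda>x. frechet_derivative f (at (g x)) b) S"
      using Suc.IH[of "\<lambda>y. frechet_derivative f (at y) b"] Suc.prems Ck_on_Suc_imp by auto
  qed
qed

section \<open>Charts and coordinate representatives of maps\<close>

lemma chart_homeomorphism:
  "is_chart c \<Longrightarrow> homeomorphism (fst c) (chart_image c) (snd c) (chart_inv c)"
  by (simp add: is_chart_def)

lemma chart_inv_chart [simp]: "is_chart c \<Longrightarrow> x \<in> fst c \<Longrightarrow> chart_inv c (snd c x) = x"
  using chart_homeomorphism homeomorphism_apply1 by blast

lemma chart_chart_inv [simp]: "is_chart c \<Longrightarrow> y \<in> chart_image c \<Longrightarrow> snd c (chart_inv c y) = y"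
  using chart_homeomorphism homeomorphism_apply2 by blast

lemma chart_inv_in_domain: "is_chart c \<Longrightarrow> y \<in> chart_image c \<Longrightarrow> chart_inv c y \<in> fst c"
  using chart_homeomorphism homeomorphism_image2 by blast

lemma open_chart_image:
  assumes "is_chart c" "open U"
  shows "open (snd c ` (fst c \<inter> U))"
proof -
  have "openin (top_of_set (chart_image c)) (snd c ` (fst c \<inter> U))"
    using homeomorphism_imp_open_map[OF chart_homeomorphism[OF assms(1)]] assms(2)
    by (simp add: openin_open_Int)
  then show ?thesis
    using assms(1) by (meson is_chart_def openin_open_trans)
qed

lemma open_chart_overlap:
  assumes "is_chart c" "continuous_on UNIV f" "open V"
  shows "open (snd c ` {x \<in> fst c. f x \<in> V})"
proof -
  have "{x \<in> fst c. f x \<in> V} = fst c \<inter> f -` V"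
    by auto
  then show ?thesis
    using open_chart_image[OF assms(1)] open_vimage[OF assms(3,2)] by simp
qed

lemma smooth_map_continuous: "smooth_map A f \<Longrightarrow> continuous_on UNIV f"
  by (simp add: smooth_map_def)

lemma smooth_map_Ck:
  "smooth_map A f \<Longrightarrow> c \<in> A \<Longrightarrow> d \<in> A \<Longrightarrow>
    Ck_on k (local_rep c d f) (snd c ` {x \<in> fst c. f x \<in> fst d})"
  by (simp add: smooth_map_def smooth_on_def)

lemma smooth_atlas_chart: "smooth_atlas A \<Longrightarrow> c \<in> A \<Longrightarrow> is_chart c"
  by (simp add: smooth_atlas_def)

lemma chart_open_domain: "is_chart c \<Longrightarrow> open (fst c)"
  by (simp add: is_chart_def)

lemma smooth_atlas_cover: "smooth_atlas A \<Longrightarrow> \<exists>c\<in>A. x \<in> fst c"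
  by (force simp: smooth_atlas_def)

lemma smooth_map_id: "smooth_atlas A \<Longrightarrow> smooth_map A id"
  by (simp add: smooth_map_def smooth_atlas_def Int_def)

lemma local_rep_has_derivative:
  assumes "smooth_map A f" "c \<in> A" "d \<in> A" "x \<in> fst c" "f x \<in> fst d"
  shows "(local_rep c d f has_derivative frechet_derivative (local_rep c d f) (at (snd c x))) (at (snd c x))"
  using Ck_on_has_derivative[OF smooth_map_Ck[OF assms(1-3), of "Suc 0"]] assms(4,5) by blast

text \<open>A chart \<open>e\<close> at the intermediate point factors the representative into two,
  but only where \<open>g\<close> stays in the domain of \<open>e\<close>;
  \<open>Ck_on_local\<close> removes this restriction.\<close>

lemma smooth_map_comp:
  assumes A: "smooth_atlas A" and f: "smooth_map A f" and g: "smooth_map A g"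
  shows "smooth_map A (f \<circ> g)"
  unfolding smooth_map_def smooth_on_def
proof (intro conjI ballI allI)
  have cont: "continuous_on UNIV f" "continuous_on UNIV g"
    using f g smooth_map_continuous by auto
  show cfg: "continuous_on UNIV (f \<circ> g)"
    by (rule continuous_on_compose) (use cont continuous_on_subset in auto)
  fix c d k assume c: "c \<in> A" and d: "d \<in> A"
  note chart = smooth_atlas_chart[OF A]
  show "Ck_on k (local_rep c d (f \<circ> g)) (snd c ` {x \<in> fst c. (f \<circ> g) x \<in> fst d})"
  proof (rule Ck_on_local)
    fix y assume "y \<in> snd c ` {x \<in> fst c. (f \<circ> g) x \<in> fst d}"
    then obtain x where x: "x \<in> fst c" "f (g x) \<in> fst d" "y = snd c x"
      by auto
    obtain e where e: "e \<in> A" "g x \<in> fst e"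
      using smooth_atlas_cover[OF A] by blast
    let ?T = "snd c ` {x \<in> fst c. x \<in> {x. g x \<in> fst e} \<inter> {x. (f \<circ> g) x \<in> fst d}}"
    have "{x. g x \<in> fst e} = g -` fst e" "{x. (f \<circ> g) x \<in> fst d} = (f \<circ> g) -` fst d"
      by auto
    then have "open ({x. g x \<in> fst e} \<inter> {x. (f \<circ> g) x \<in> fst d})"
      using open_vimage[OF chart_open_domain[OF chart[OF e(1)]] cont(2)]
        open_vimage[OF chart_open_domain[OF chart[OF d]] cfg] by (simp add: open_Int)
    then have T: "open ?T"
      using open_chart_overlap[OF chart[OF c] continuous_on_id] by blast
    have "Ck_on k (\<lambda>y. local_rep e d f (local_rep c e g y)) ?T"
    proof (rule Ck_on_compose[OF T, where g = "local_rep c e g" and f = "local_rep e d f"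
          and T = "snd e ` {x \<in> fst e. f x \<in> fst d}"])
      show "Ck_on k (local_rep c e g) ?T"
        by (rule Ck_on_subset[OF smooth_map_Ck[OF g c e(1)]]) auto
      show "Ck_on k (local_rep e d f) (snd e ` {x \<in> fst e. f x \<in> fst d})"
        by (rule smooth_map_Ck[OF f e(1) d])
      show "local_rep c e g ` ?T \<subseteq> snd e ` {x \<in> fst e. f x \<in> fst d}"
        using chart[OF c] by (auto simp: local_rep_def)
    qed
    then have "Ck_on k (local_rep c d (f \<circ> g)) ?T"
      by (rule Ck_on_cong_open[OF T, rotated])
         (use chart[OF c] chart[OF e(1)] in \<open>auto simp: local_rep_def\<close>)
    moreover have "y \<in> ?T"
      using x e by auto
    ultimately show "\<exists>T. open T \<and> y \<in> T \<and> Ck_on k (local_rep c d (f \<circ> g)) T"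
      using T by blast
  qed
qed

text \<open>Through a chart \<open>e\<close> at the intermediate point the derivative of the
  composite is \<open>?D \<circ> ?E\<close>, so the invariance of the form applies once for each
  factor.\<close>

lemma preserves_form_comp:
  assumes A: "smooth_atlas A" and f: "smooth_map A f" "preserves_form A \<omega> f"
    and g: "smooth_map A g" "preserves_form A \<omega> g"
  shows "preserves_form A \<omega> (f \<circ> g)"
  unfolding preserves_form_def Let_def
proof (intro ballI allI impI)
  fix c d x v w assume c: "c \<in> A" and d: "d \<in> A" and x: "x \<in> fst c \<and> (f \<circ> g) x \<in> fst d"
  note chart = smooth_atlas_chart[OF A]
  obtain e where e: "e \<in> A" "g x \<in> fst e"
    using smooth_atlas_cover[OF A] by blast
  let ?D = "frechet_derivative (local_rep e d f) (at (snd e (g x)))"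
  let ?E = "frechet_derivative (local_rep c e g) (at (snd c x))"
  let ?T = "snd c ` {x \<in> fst c. g x \<in> fst e}"
  have T: "open ?T" "snd c x \<in> ?T"
    using open_chart_overlap[OF chart[OF c] smooth_map_continuous[OF g(1)]
        chart_open_domain[OF chart[OF e(1)]]] x e by auto
  have "local_rep c e g (snd c x) = snd e (g x)"
    using chart[OF c] x by (simp add: local_rep_def)
  then have "(local_rep e d f \<circ> local_rep c e g has_derivative ?D \<circ> ?E) (at (snd c x))"
    using diff_chain_at[OF local_rep_has_derivative[OF g(1) c e(1), of x], of "local_rep e d f" ?D]
      local_rep_has_derivative[OF f(1) e(1) d, of "g x"] x e by simp
  then have "(local_rep c d (f \<circ> g) has_derivative ?D \<circ> ?E) (at (snd c x))"
    by (rule has_derivative_transform_within_open[OF _ T])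
       (use chart[OF c] chart[OF e(1)] in \<open>auto simp: local_rep_def\<close>)
  then have D: "frechet_derivative (local_rep c d (f \<circ> g)) (at (snd c x)) = ?D \<circ> ?E"
    using frechet_derivative_at by metis
  show "\<omega> d (snd d ((f \<circ> g) x))
      (frechet_derivative (local_rep c d (f \<circ> g)) (at (snd c x)) v)
      (frechet_derivative (local_rep c d (f \<circ> g)) (at (snd c x)) w) = \<omega> c (snd c x) v w"
    using f(2) g(2) c d e x unfolding D preserves_form_def Let_def by auto
qed

lemma Symp_carrier:
  "f \<in> carrier (Symp A \<omega>) \<longleftrightarrow> diffeomorphism A f \<and> preserves_form A \<omega> f"
  by (simp add: Symp_def)

lemma Symp_mult [simp]: "f \<otimes>\<^bsub>Symp A \<omega>\<^esub> g = f \<circ> g"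
  by (simp add: Symp_def)

lemma Symp_smooth: "f \<in> carrier (Symp A \<omega>) \<Longrightarrow> smooth_map A f"
  by (simp add: Symp_carrier diffeomorphism_def)

lemma Symp_comp_closed:
  assumes A: "smooth_atlas A" and "f \<in> carrier (Symp A \<omega>)" "g \<in> carrier (Symp A \<omega>)"
  shows "f \<circ> g \<in> carrier (Symp A \<omega>)"
proof -
  have "inv_into UNIV (f \<circ> g) = inv_into UNIV g \<circ> inv_into UNIV f"
    using assms by (simp add: Symp_carrier diffeomorphism_def o_inv_distrib)
  then show ?thesis
    using assms smooth_map_comp[OF A] preserves_form_comp[OF A]
    by (simp add: Symp_carrier diffeomorphism_def bij_comp)
qed

section \<open>Smooth simplices\<close>

lemma continuous_on_euclidean_simplex:
  "continuous_map (subtopology (powertop_real UNIV) S) euclidean s \<longleftrightarrow> continuous_on S s"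
  by (metis continuous_map_iff_continuous euclidean_product_topology)

lemma singular_simplex_euclidean:
  "singular_simplex p euclidean s \<longleftrightarrow>
    continuous_on (standard_simplex p) s \<and> s \<in> extensional (standard_simplex p)"
  by (simp add: singular_simplex_def continuous_on_euclidean_simplex)

text \<open>The chart-free core of \<open>smooth_simplex\<close>: values lie in a vector space and
  only the restriction to the simplex near \<open>t\<close> counts. Simplices can thus be given by
  formulas and read through a chart afterwards.\<close>

definition loc_smooth ::
    "nat \<Rightarrow> ((nat \<Rightarrow> real) \<Rightarrow> 'e::real_normed_vector) \<Rightarrow> (nat \<Rightarrow> real) \<Rightarrow> bool" where
  "loc_smooth p G t \<longleftrightarrow> (\<exists>N F. open N \<and> t \<in> N \<and> (\<forall>k. partial_upto k F N) \<and>
     (\<forall>u\<in>N \<inter> standard_simplex p. G u = F u))"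

lemma loc_smoothI:
  "open N \<Longrightarrow> t \<in> N \<Longrightarrow> (\<And>k. partial_upto k F N) \<Longrightarrow>
    (\<And>u. u \<in> N \<Longrightarrow> u \<in> standard_simplex p \<Longrightarrow> G u = F u) \<Longrightarrow> loc_smooth p G t"
  unfolding loc_smooth_def by blast

lemma loc_smooth_cong:
  assumes "\<And>u. u \<in> standard_simplex p \<Longrightarrow> G u = H u"
  shows "loc_smooth p G t \<longleftrightarrow> loc_smooth p H t"
  using assms unfolding loc_smooth_def by (metis IntD2)

lemma loc_smooth_const: "loc_smooth p (\<lambda>_. c) t"
  by (rule loc_smoothI[of UNIV _ "\<lambda>_. c"]) (auto simp: partial_upto_const)

lemma loc_smooth_coordinate: "loc_smooth p (\<lambda>u. u i) t"
  by (rule loc_smoothI[of UNIV _ "\<lambda>u. u i"]) (auto simp: partial_upto_coordinate)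

lemma loc_smooth_add:
  assumes "loc_smooth p G t" "loc_smooth p H t"
  shows "loc_smooth p (\<lambda>u. G u + H u) t"
proof -
  obtain N F N' F' where *: "open N" "t \<in> N" "\<And>k. partial_upto k F N"
    "\<And>u. u \<in> N \<inter> standard_simplex p \<Longrightarrow> G u = F u"
    "open N'" "t \<in> N'" "\<And>k. partial_upto k F' N'"
    "\<And>u. u \<in> N' \<inter> standard_simplex p \<Longrightarrow> H u = F' u"
    using assms unfolding loc_smooth_def by blast
  show ?thesis
    by (rule loc_smoothI[of "N \<inter> N'" _ "\<lambda>u. F u + F' u"])
       (use * in \<open>auto intro!: partial_upto_add intro: partial_upto_subset\<close>)
qed

lemma loc_smooth_scaleR:
  assumes "loc_smooth p f t" "loc_smooth p H t"
  shows "loc_smooth p (\<lambda>u. f u *\<^sub>R H u) t"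
proof -
  obtain N F N' F' where *: "open N" "t \<in> N" "\<And>k. partial_upto k F N"
    "\<And>u. u \<in> N \<inter> standard_simplex p \<Longrightarrow> f u = F u"
    "open N'" "t \<in> N'" "\<And>k. partial_upto k F' N'"
    "\<And>u. u \<in> N' \<inter> standard_simplex p \<Longrightarrow> H u = F' u"
    using assms unfolding loc_smooth_def by blast
  show ?thesis
    by (rule loc_smoothI[of "N \<inter> N'" _ "\<lambda>u. F u *\<^sub>R F' u"])
       (use * in \<open>auto intro!: partial_upto_scaleR intro: partial_upto_subset\<close>)
qed

lemma loc_smooth_continuous:
  assumes "\<And>t. t \<in> standard_simplex p \<Longrightarrow> loc_smooth p G t"
  shows "continuous_on (standard_simplex p) G"
  unfolding continuous_on_eq_continuous_within
proof
  fix t assume t: "t \<in> standard_simplex p"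
  then obtain N F where *: "open N" "t \<in> N" "\<And>k. partial_upto k F N"
    "\<forall>u\<in>N \<inter> standard_simplex p. G u = F u"
    using assms[OF t] unfolding loc_smooth_def by blast
  have "continuous_on (N \<inter> standard_simplex p) F"
    using partial_upto_continuous[OF *(3)[of 0]] continuous_on_subset by blast
  then have "continuous_on (standard_simplex p \<inter> N) G"
    using *(4) continuous_on_cong[OF refl, of "N \<inter> standard_simplex p" G F] by (simp add: Int_commute)
  then have "continuous (at t within standard_simplex p \<inter> N) G"
    using t *(2) by (simp add: continuous_on_eq_continuous_within)
  moreover have "at t within standard_simplex p \<inter> N = at t within standard_simplex p"
    by (rule at_within_nhd[OF *(2,1)]) auto
  ultimately show "continuous (at t within standard_simplex p) G"
    by simp
qed

text \<open>On \<open>nat \<Rightarrow> real\<close> the chain rule needs the change of one coordinate to affect only finitely many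
  others.\<close>

definition coord_affine :: "((nat \<Rightarrow> real) \<Rightarrow> nat \<Rightarrow> real) \<Rightarrow> bool" where
  "coord_affine \<tau> \<longleftrightarrow> continuous_on UNIV \<tau> \<and> (\<exists>J W. (\<forall>i. finite (J i)) \<and>
     (\<forall>i t h. \<tau> (t(i := h)) = (\<lambda>j. if j \<in> J i then \<tau> t j + (h - t i) * W i j else \<tau> t j)))"

text \<open>The local extension composed with \<tau> is defined on a preimage which is open because
  \<tau> is continuous on the whole space and not merely on the simplex.\<close>

lemma loc_smooth_affine:
  assumes G: "loc_smooth p G (\<tau> t)" and \<tau>: "coord_affine \<tau>"
    "\<tau> ` standard_simplex q \<subseteq> standard_simplex p"
  shows "loc_smooth q (\<lambda>u. G (\<tau> u)) t"
proof -
  obtain J W where JW: "\<And>i. finite (J i)" "continuous_on UNIV \<tau>"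
    "\<And>i t h. \<tau> (t(i := h)) = (\<lambda>j. if j \<in> J i then \<tau> t j + (h - t i) * W i j else \<tau> t j)"
    using \<tau>(1) unfolding coord_affine_def by blast
  obtain N F where *: "open N" "\<tau> t \<in> N" "\<And>k. partial_upto k F N"
    "\<And>u. u \<in> N \<inter> standard_simplex p \<Longrightarrow> G u = F u"
    using G unfolding loc_smooth_def by blast
  show ?thesis
  proof (rule loc_smoothI[of "\<tau> -` N" _ "\<lambda>u. F (\<tau> u)"])
    show "open (\<tau> -` N)"
      by (rule open_vimage[OF *(1) JW(2)])
    then show "partial_upto k (\<lambda>u. F (\<tau> u)) (\<tau> -` N)" for k
      by (intro partial_upto_affine[OF *(1) _ _ _ JW(1,3) *(3)])
         (use JW(2) continuous_on_subset in auto)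
  qed (use * \<tau>(2) in auto)
qed

text \<open>Moving \<open>x j\<close> moves the combination along the point \<open>l j\<close>, so
  finite support of these points gives the locality that \<open>coord_affine\<close>
  demands.\<close>

lemma coord_affine_combination:
  assumes "\<And>j. j \<le> p \<Longrightarrow> finite {m. l j m \<noteq> 0}"
  shows "coord_affine (\<lambda>x i. \<Sum>j\<le>p. l j i * x j)"
  unfolding coord_affine_def
proof (intro conjI exI allI)
  show "continuous_on UNIV (\<lambda>x i. \<Sum>j\<le>p. l j i * x j)"
    by (rule continuous_on_coordinatewise_then_product) (auto intro!: continuous_intros)
  fix i h and t :: "nat \<Rightarrow> real"
  let ?J = "\<lambda>i. if i \<le> p then {m. l i m \<noteq> 0} else {}"
  show "finite (?J i)"
    using assms by auto
  have "(\<Sum>j\<le>p. l j m * (t(i := h)) j) = (\<Sum>j\<le>p. l j m * t j + (if j = i then l i m * (h - t i) else 0))" for m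
    by (intro sum.cong) (auto simp: algebra_simps)
  then have "(\<Sum>j\<le>p. l j m * (t(i := h)) j) = (\<Sum>j\<le>p. l j m * t j) + (if i \<le> p then l i m * (h - t i) else 0)" for m
    by (simp add: sum.distrib)
  then show "(\<lambda>m. \<Sum>j\<le>p. l j m * (t(i := h)) j) = (\<lambda>m. if m \<in> ?J i
      then (\<Sum>j\<le>p. l j m * t j) + (h - t i) * l i m else (\<Sum>j\<le>p. l j m * t j))"
    by (auto simp: fun_eq_iff)
qed

text \<open>The definition wants a whole neighbourhood on which the simplex stays in the chart
  domain. Continuity of \<open>s\<close> provides it, so membership has to be checked at
  \<open>t\<close> alone.\<close>

lemma smooth_simplex_iff:
  assumes A: "smooth_atlas A"
  shows "smooth_simplex A p s \<longleftrightarrow> singular_simplex p euclidean s \<and>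
    (\<forall>t\<in>standard_simplex p. \<exists>c\<in>A. s t \<in> fst c \<and> loc_smooth p (\<lambda>u. snd c (s u)) t)"
    (is "_ \<longleftrightarrow> _ \<and> ?R")
proof (intro iffI conjI)
  assume s: "smooth_simplex A p s"
  then show "singular_simplex p euclidean s"
    by (simp add: smooth_simplex_def)
  show ?R
  proof
    fix t assume t: "t \<in> standard_simplex p"
    then obtain c N F where *: "c \<in> A" "open N" "t \<in> N" "\<forall>k. partial_upto k F N"
      "\<forall>u\<in>N \<inter> standard_simplex p. s u \<in> fst c \<and> snd c (s u) = F u"
      using s unfolding smooth_simplex_def all_partial_Ck_on_iff by blast
    then have "loc_smooth p (\<lambda>u. snd c (s u)) t"
      by (intro loc_smoothI[of N]) auto
    with * t show "\<exists>c\<in>A. s t \<in> fst c \<and> loc_smooth p (\<lambda>u. snd c (s u)) t"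
      by blast
  qed
next
  assume R: "singular_simplex p euclidean s \<and> ?R"
  have "\<exists>c\<in>A. \<exists>N F. open N \<and> t \<in> N \<and> (\<forall>k. partial_Ck_on k F N) \<and>
        (\<forall>u \<in> N \<inter> standard_simplex p. s u \<in> fst c \<and> snd c (s u) = F u)"
    if t: "t \<in> standard_simplex p" for t
  proof -
    obtain c N F where *: "c \<in> A" "s t \<in> fst c" "open N" "t \<in> N" "\<forall>k. partial_upto k F N"
      "\<forall>u\<in>N \<inter> standard_simplex p. snd c (s u) = F u"
      using R t unfolding loc_smooth_def by blast
    have "continuous_on (standard_simplex p) s"
      using R by (simp add: singular_simplex_euclidean)
    then obtain V where V: "open V" "V \<inter> standard_simplex p = s -` fst c \<inter> standard_simplex p"
      using chart_open_domain[OF smooth_atlas_chart[OF A *(1)]] continuous_on_open_invariant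
      by metis
    have "\<forall>k. partial_Ck_on k F (N \<inter> V)"
      using *(5) partial_upto_subset[of _ F N "N \<inter> V"] by (auto simp: all_partial_Ck_on_iff)
    moreover have "t \<in> N \<inter> V"
      using V t * by auto
    moreover have "\<forall>u \<in> N \<inter> V \<inter> standard_simplex p. s u \<in> fst c \<and> snd c (s u) = F u"
      using V *(6) by auto
    ultimately show ?thesis
      using *(1,3) V(1) by (meson open_Int)
  qed
  with R show "smooth_simplex A p s"
    unfolding smooth_simplex_def by blast
qed

lemma smooth_simplex_singular: "smooth_simplex A p s \<Longrightarrow> singular_simplex p euclidean s"
  by (simp add: smooth_simplex_def)

text \<open>Smoothness is given in some chart at \<open>s t\<close>; composing the local extension
  with the representative of \<open>f\<close> carries it to any chart at \<open>f (s t)\<close>. For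
  the identity this is the change of charts.\<close>

lemma smooth_simplex_chart:
  assumes A: "smooth_atlas A" and s: "smooth_simplex A p s" and f: "smooth_map A f"
    and t: "t \<in> standard_simplex p" and d: "d \<in> A" "f (s t) \<in> fst d"
  shows "loc_smooth p (\<lambda>u. snd d (f (s u))) t"
proof -
  obtain c N F where *: "c \<in> A" "open N" "t \<in> N" "\<forall>k. partial_Ck_on k F N"
    "\<forall>u\<in>N \<inter> standard_simplex p. s u \<in> fst c \<and> snd c (s u) = F u"
    using s t unfolding smooth_simplex_def by blast
  have F: "partial_upto k F N" for k
    using *(4) by (simp add: all_partial_Ck_on_iff)
  note chart = smooth_atlas_chart[OF A]
  let ?S = "snd c ` {x \<in> fst c. f x \<in> fst d}"
  have "open ?S"
    by (rule open_chart_overlap[OF chart[OF *(1)] smooth_map_continuous[OF f]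
        chart_open_domain[OF chart[OF d(1)]]])
  then have N': "open (F -` ?S \<inter> N)"
    using continuous_open_preimage[OF partial_upto_continuous[OF F[of 0]] *(2)]
    by (simp add: Int_commute)
  show ?thesis
  proof (rule loc_smoothI[OF N', where F = "\<lambda>u. local_rep c d f (F u)"])
    show "t \<in> F -` ?S \<inter> N"
      using * t d(2) by (auto simp: image_iff)
    show "partial_upto k (\<lambda>u. local_rep c d f (F u)) (F -` ?S \<inter> N)" for k
      by (rule partial_upto_compose[OF N' _ smooth_map_Ck[OF f *(1) d(1)]
          partial_upto_subset[OF F]]) auto
    fix u assume u: "u \<in> F -` ?S \<inter> N" "u \<in> standard_simplex p"
    then have "s u \<in> fst c" "snd c (s u) = F u"
      using *(5) by auto
    then show "snd d (f (s u)) = local_rep c d f (F u)"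
      using chart_inv_chart[OF chart[OF *(1)], of "s u"] by (simp add: local_rep_def)
  qed
qed

lemma smooth_simplex_local_chart:
  assumes A: "smooth_atlas A" and s: "smooth_simplex A p s"
    and t: "t \<in> standard_simplex p" and d: "d \<in> A" "s t \<in> fst d"
  shows "loc_smooth p (\<lambda>u. snd d (s u)) t"
  using smooth_simplex_chart[OF A s smooth_map_id[OF A] t d(1)] d(2) by simp

lemma smooth_simplex_map:
  assumes A: "smooth_atlas A" and s: "smooth_simplex A p s" and f: "smooth_map A f"
  shows "smooth_simplex A p (simplex_map p f s)"
  unfolding smooth_simplex_iff[OF A]
proof (intro conjI ballI)
  show "singular_simplex p euclidean (simplex_map p f s)"
    by (rule singular_simplex_simplex_map[OF smooth_simplex_singular[OF s]])
       (use smooth_map_continuous[OF f] in simp)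
  fix t assume t: "t \<in> standard_simplex p"
  obtain d where d: "d \<in> A" "f (s t) \<in> fst d"
    using smooth_atlas_cover[OF A] by blast
  moreover have "loc_smooth p (\<lambda>u. snd d (simplex_map p f s u)) t"
    using smooth_simplex_chart[OF A s f t d]
    by (subst loc_smooth_cong[where H = "\<lambda>u. snd d (f (s u))"]) (auto simp: simplex_map_def)
  ultimately show "\<exists>c\<in>A. simplex_map p f s t \<in> fst c \<and> loc_smooth p (\<lambda>u. snd c (simplex_map p f s u)) t"
    using t by (auto simp: simplex_map_def)
qed

text \<open>An affine change of parameters keeps the chart. This is the reason why subdivision stays
  inside the smooth complex.\<close>

lemma smooth_simplex_affine:
  assumes A: "smooth_atlas A" and s: "smooth_simplex A p s"
    and \<tau>: "coord_affine \<tau>" "\<tau> ` standard_simplex q \<subseteq> standard_simplex p"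
  shows "smooth_simplex A q (restrict (s \<circ> \<tau>) (standard_simplex q))"
  unfolding smooth_simplex_iff[OF A]
proof (intro conjI ballI)
  have "continuous_on (standard_simplex q) (s \<circ> \<tau>)"
  proof (rule continuous_on_compose)
    show "continuous_on (standard_simplex q) \<tau>"
      using \<tau>(1) continuous_on_subset unfolding coord_affine_def by blast
    show "continuous_on (\<tau> ` standard_simplex q) s"
      using smooth_simplex_singular[OF s] \<tau>(2) continuous_on_subset
      unfolding singular_simplex_euclidean by blast
  qed
  then show "singular_simplex q euclidean (restrict (s \<circ> \<tau>) (standard_simplex q))"
    by (simp add: singular_simplex_euclidean cong: continuous_on_cong)
  fix t assume t: "t \<in> standard_simplex q"
  then have t': "\<tau> t \<in> standard_simplex p"
    using \<tau> by auto
  then obtain c where c: "c \<in> A" "s (\<tau> t) \<in> fst c" "loc_smooth p (\<lambda>u. snd c (s u)) (\<tau> t)"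
    using s unfolding smooth_simplex_iff[OF A] by blast
  have "loc_smooth q (\<lambda>u. snd c (restrict (s \<circ> \<tau>) (standard_simplex q) u)) t"
    using loc_smooth_affine[OF c(3) \<tau>]
    by (subst loc_smooth_cong[where H = "\<lambda>u. snd c (s (\<tau> u))"]) auto
  then show "\<exists>c\<in>A. restrict (s \<circ> \<tau>) (standard_simplex q) t \<in> fst c \<and>
      loc_smooth q (\<lambda>u. snd c (restrict (s \<circ> \<tau>) (standard_simplex q) u)) t"
    using c t by auto
qed

text \<open>Constants, segments and contractions are all produced in this way, from formulas in the
  coordinates of one chart.\<close>

lemma smooth_simplex_chart_inv:
  assumes A: "smooth_atlas A" and c: "c \<in> A"
    and G: "G ` standard_simplex p \<subseteq> chart_image c"
    and smooth: "\<And>t. t \<in> standard_simplex p \<Longrightarrow> loc_smooth p G t"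
  shows "smooth_simplex A p (restrict (\<lambda>u. chart_inv c (G u)) (standard_simplex p))"
  unfolding smooth_simplex_iff[OF A]
proof (intro conjI ballI)
  note chart = smooth_atlas_chart[OF A c]
  have "continuous_on (chart_image c) (chart_inv c)"
    using chart_homeomorphism[OF chart] homeomorphism_cont2 by blast
  then have "continuous_on (standard_simplex p) (\<lambda>u. chart_inv c (G u))"
    using continuous_on_compose2[OF _ loc_smooth_continuous[OF smooth] G] by blast
  then show "singular_simplex p euclidean (restrict (\<lambda>u. chart_inv c (G u)) (standard_simplex p))"
    by (simp add: singular_simplex_euclidean cong: continuous_on_cong)
  fix t assume t: "t \<in> standard_simplex p"
  have "loc_smooth p (\<lambda>u. snd c (restrict (\<lambda>u. chart_inv c (G u)) (standard_simplex p) u)) t"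
    using smooth[OF t] G chart
    by (subst loc_smooth_cong[where H = G]) auto
  then show "\<exists>d\<in>A. restrict (\<lambda>u. chart_inv c (G u)) (standard_simplex p) t \<in> fst d \<and>
      loc_smooth p (\<lambda>u. snd d (restrict (\<lambda>u. chart_inv c (G u)) (standard_simplex p) u)) t"
    using c t G chart_inv_in_domain[OF chart] by auto
qed

lemma smooth_simplex_const:
  assumes A: "smooth_atlas A"
  shows "smooth_simplex A p (restrict (\<lambda>_. a) (standard_simplex p))"
proof -
  obtain c where c: "c \<in> A" "a \<in> fst c"
    using smooth_atlas_cover[OF A] by blast
  have "smooth_simplex A p (restrict (\<lambda>u. chart_inv c (snd c a)) (standard_simplex p))"
    by (rule smooth_simplex_chart_inv[OF A c(1)]) (use c in \<open>auto simp: chart_image_def loc_smooth_const\<close>)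
  then show ?thesis
    using smooth_atlas_chart[OF A c(1)] c(2) by simp
qed

section \<open>Integration over smooth simplices\<close>

lemma barycentric_in_simplex:
  assumes "0 < fst z" "0 < snd z" "fst z + snd z < 1"
  shows "barycentric z \<in> standard_simplex 2"
proof -
  have "(\<Sum>i\<le>2. barycentric z i) = 1"
    by (simp add: barycentric_def numeral_2_eq_2)
  then show ?thesis
    using assms by (auto simp: standard_simplex_def barycentric_def)
qed

lemma continuous_barycentric: "continuous_on UNIV barycentric"
proof (rule continuous_on_coordinatewise_then_product)
  fix i
  show "continuous_on UNIV (\<lambda>z. barycentric z i)"
    unfolding barycentric_def
    by (cases "i = 0"; cases "i = 1"; cases "i = 2") (auto intro!: continuous_intros)
qed

text \<open>Both partial derivatives in the parameters of the triangle are directional derivatives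
  of \<open>F\<close> in two coordinates. Their continuity gives total differentiability, as for
  directional derivatives above.\<close>

lemma differentiable_barycentric:
  fixes F :: "(nat \<Rightarrow> real) \<Rightarrow> 'e::real_normed_vector"
  assumes F: "partial_upto (Suc 0) F N" and "open N" "barycentric z \<in> N"
  shows "(\<lambda>z. F (barycentric z)) differentiable (at z)"
proof -
  obtain x y where z: "z = (x, y)" by (cases z)
  have "open (barycentric -` N)"
    by (rule open_vimage[OF \<open>open N\<close> continuous_barycentric])
  then obtain U V where UV: "open U" "open V" "x \<in> U" "y \<in> V" and sub: "U \<times> V \<subseteq> barycentric -` N"
    using assms(3) z by (auto elim!: open_prod_elim)
  obtain r where r: "r > 0" "ball y r \<subseteq> V"
    using UV open_contains_ball by metis
  let ?Y = "ball y r"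
  have inN: "barycentric (u, v) \<in> N" if "u \<in> U" "v \<in> ?Y" for u v
  proof -
    have "(u, v) \<in> U \<times> V"
      using that r(2) by blast
    then show ?thesis
      using sub by auto
  qed
  \<comment> \<open>The velocity of the barycentric coordinates when the parameter of vertex
    \<open>a\<close> grows: coordinate 0 is \<open>1 - x - y\<close> and compensates.\<close>
  define W where "W a j = (if j = 0 then -1 else if j = a then 1 else 0 :: real)" for a j :: nat
  let ?D = "\<lambda>a u v. \<Sum>j\<in>{0, a}. W a j *\<^sub>R partial_deriv j F (barycentric (u, v))"
  have dir: "((\<lambda>h. F (\<lambda>j. if j \<in> {0, a} then barycentric (u, v) j + h * W a j else barycentric (u, v) j))
      has_vector_derivative ?D a u v) (at 0)" if "u \<in> U" "v \<in> ?Y" for u v a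
    by (rule has_vector_derivative_direction[OF F \<open>open N\<close> inN[OF that]]) simp
  have "((\<lambda>(u, v). F (barycentric (u, v))) has_derivative
      (\<lambda>(tu, tv). tu *\<^sub>R ?D 1 x y + blinfun_scaleR_left (?D 2 x y) tv)) (at (x, y) within U \<times> ?Y)"
  proof (rule has_derivative_partialsI[where f = "\<lambda>u v. F (barycentric (u, v))"
        and fy = "\<lambda>u v. blinfun_scaleR_left (?D 2 u v)"])
    have "((\<lambda>h. F (\<lambda>j. if j \<in> {0, 1} then barycentric (x, y) j + h * W 1 j else barycentric (x, y) j))
      has_vector_derivative ?D 1 x y) (at ((\<lambda>u. u - x) x))"
      using dir[of x y 1] UV r by simp
    from vector_diff_chain_at[of "\<lambda>u. u - x" 1 x, OF _ this]
    have "((\<lambda>h. F (\<lambda>j. if j \<in> {0, 1} then barycentric (x, y) j + h * W 1 j else barycentric (x, y) j))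
      \<circ> (\<lambda>u. u - x) has_vector_derivative ?D 1 x y) (at x)"
      by (simp add: has_vector_derivative_diff_const)
    moreover have "(\<lambda>h. F (\<lambda>j. if j \<in> {0, 1} then barycentric (x, y) j + h * W 1 j else barycentric (x, y) j))
      \<circ> (\<lambda>u. u - x) = (\<lambda>u. F (barycentric (u, y)))"
      by (auto simp: fun_eq_iff barycentric_def W_def intro!: arg_cong[of _ _ F])
    ultimately show "((\<lambda>u. F (barycentric (u, y))) has_derivative (\<lambda>tu. tu *\<^sub>R ?D 1 x y)) (at x within U)"
      by (simp add: has_vector_derivative_def has_derivative_at_withinI)
  next
    fix u v assume uv: "u \<in> U" "v \<in> ?Y"
    have "((\<lambda>h. F (\<lambda>j. if j \<in> {0, 2} then barycentric (u, v) j + h * W 2 j else barycentric (u, v) j))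
      has_vector_derivative ?D 2 u v) (at ((\<lambda>h. h - v) v))"
      using dir[OF uv, of 2] by simp
    from vector_diff_chain_at[of "\<lambda>h. h - v" 1 v, OF _ this]
    have "((\<lambda>h. F (\<lambda>j. if j \<in> {0, 2} then barycentric (u, v) j + h * W 2 j else barycentric (u, v) j))
      \<circ> (\<lambda>h. h - v) has_vector_derivative ?D 2 u v) (at v)"
      by (simp add: has_vector_derivative_diff_const)
    moreover have "(\<lambda>h. F (\<lambda>j. if j \<in> {0, 2} then barycentric (u, v) j + h * W 2 j else barycentric (u, v) j))
      \<circ> (\<lambda>h. h - v) = (\<lambda>v. F (barycentric (u, v)))"
      by (auto simp: fun_eq_iff barycentric_def W_def intro!: arg_cong[of _ _ F])
    ultimately show "((\<lambda>v. F (barycentric (u, v))) has_derivative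
        blinfun_apply (blinfun_scaleR_left (?D 2 u v))) (at v within ?Y)"
      by (simp add: has_vector_derivative_def has_derivative_at_withinI)
  next
    have "continuous_on (U \<times> ?Y) (\<lambda>z. partial_deriv j F (barycentric z))" for j
      by (rule continuous_on_compose2[OF partial_upto_continuous[OF partial_upto_partial_deriv[OF F, of j]]
            continuous_on_subset[OF continuous_barycentric]]) (use inN in auto)
    then have "continuous_on (U \<times> ?Y) (\<lambda>z. blinfun_scaleR_left (?D 2 (fst z) (snd z)))"
      by (intro bounded_linear.continuous_on[OF bounded_linear_blinfun_scaleR_left]
          continuous_on_sum continuous_on_scaleR continuous_on_const) simp
    then show "continuous (at (x, y) within U \<times> ?Y) (\<lambda>(u, v). blinfun_scaleR_left (?D 2 u v))"
      using UV r by (simp add: continuous_on_eq_continuous_within split_beta')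
  qed (use r in auto)
  then have "(\<lambda>z. F (barycentric z)) differentiable (at (x, y) within U \<times> ?Y)"
    unfolding case_prod_beta prod.collapse by (rule differentiableI)
  then show ?thesis
    using UV r z at_within_open[of "(x, y)" "U \<times> ?Y"] by (simp add: open_Times)
qed

text \<open>The open triangle contains a neighbourhood of \<open>z\<close>, so the local extension
  may stand for the simplex there.\<close>

lemma smooth_simplex_differentiable:
  assumes A: "smooth_atlas A" and s: "smooth_simplex A 2 s" and c: "c \<in> A"
    and z: "0 < fst z" "0 < snd z" "fst z + snd z < 1" "s (barycentric z) \<in> fst c"
  shows "(snd c \<circ> s \<circ> barycentric) differentiable (at z)"
proof -
  obtain N F where *: "open N" "barycentric z \<in> N" "\<forall>k. partial_upto k F N"
    "\<And>u. u \<in> N \<inter> standard_simplex 2 \<Longrightarrow> snd c (s u) = F u"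
    using smooth_simplex_local_chart[OF A s barycentric_in_simplex[OF z(1-3)] c z(4)]
    unfolding loc_smooth_def by metis
  let ?T = "{z. 0 < fst z \<and> 0 < snd z \<and> fst z + snd z < 1} \<inter> barycentric -` N"
  have "open {z :: real \<times> real. 0 < fst z \<and> 0 < snd z \<and> fst z + snd z < 1}"
    by (intro open_Collect_conj open_Collect_less continuous_intros)
  then have T: "open ?T" "z \<in> ?T"
    using open_vimage[OF *(1) continuous_barycentric] * z by auto
  have "F (barycentric y) = (snd c \<circ> s \<circ> barycentric) y" if "y \<in> ?T" for y
    using that *(4) barycentric_in_simplex by auto
  then show ?thesis
    using frechet_derivative_cong_open(1)[OF T _ differentiable_barycentric[OF _ *(1,2)]] *(3) by blast
qed

text \<open>The integrands agree pointwise. The charts \<open>c\<close> and \<open>d\<close>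
  selected on the two sides are unrelated, but \<open>preserves_form\<close> speaks of all pairs of
  charts, and the chain rule brings in the representative of \<open>f\<close> for just this
  pair.\<close>

lemma form_integral_simplex_map:
  assumes A: "smooth_atlas A" and s: "smooth_simplex A 2 s"
    and f: "smooth_map A f" "preserves_form A \<omega> f"
  shows "form_integral A \<omega> (simplex_map 2 f s) = form_integral A \<omega> s"
  unfolding form_integral_def Let_def
proof (rule integral_cong, clarify)
  fix x y :: real assume xy: "0 < x" "0 < y" "x + y < 1"
  let ?t = "barycentric (x, y)"
  let ?T = "{z :: real \<times> real. 0 < fst z \<and> 0 < snd z \<and> fst z + snd z < 1}"
  define c where "c = (SOME c. c \<in> A \<and> s ?t \<in> fst c)"
  define d where "d = (SOME d. d \<in> A \<and> simplex_map 2 f s ?t \<in> fst d)"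
  have bary: "barycentric z \<in> standard_simplex 2" if "z \<in> ?T" for z
    using that barycentric_in_simplex by auto
  have fs: "simplex_map 2 f s ?t = f (s ?t)"
    using bary xy by (simp add: simplex_map_def)
  have c: "c \<in> A" "s ?t \<in> fst c"
    unfolding c_def using someI_ex[of "\<lambda>c. c \<in> A \<and> s ?t \<in> fst c"] smooth_atlas_cover[OF A] by blast+
  have "d \<in> A \<and> simplex_map 2 f s ?t \<in> fst d"
    unfolding d_def using someI_ex[of "\<lambda>d. d \<in> A \<and> simplex_map 2 f s ?t \<in> fst d"]
      smooth_atlas_cover[OF A] by blast
  then have d: "d \<in> A" "f (s ?t) \<in> fst d"
    using fs by auto
  note chart = smooth_atlas_chart[OF A]
  let ?g = "snd c \<circ> s \<circ> barycentric"
  let ?h = "snd d \<circ> simplex_map 2 f s \<circ> barycentric"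
  let ?E = "frechet_derivative ?g (at (x, y))"
  let ?D = "frechet_derivative (local_rep c d f) (at (snd c (s ?t)))"
  have "(?g has_derivative ?E) (at (x, y))"
    using smooth_simplex_differentiable[OF A s c(1), of "(x, y)"] xy c(2)
    by (simp add: frechet_derivative_works)
  then have chain: "(local_rep c d f \<circ> ?g has_derivative ?D \<circ> ?E) (at (x, y))"
    using local_rep_has_derivative[OF f(1) c(1) d(1) c(2) d(2)]
    by (intro diff_chain_at) auto
  have T: "open ?T"
    by (intro open_Collect_conj open_Collect_less continuous_intros)
  have "continuous_on ?T (\<lambda>z. s (barycentric z))"
    by (rule continuous_on_compose2[of "standard_simplex 2" s])
       (use smooth_simplex_singular[OF s] bary continuous_on_subset[OF continuous_barycentric]
         in \<open>auto simp: singular_simplex_euclidean\<close>)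
  then have V: "open (?T \<inter> (\<lambda>z. s (barycentric z)) -` fst c)"
    using continuous_open_preimage[OF _ T chart_open_domain[OF chart[OF c(1)]]] by blast
  have "(?h has_derivative ?D \<circ> ?E) (at (x, y))"
    by (rule has_derivative_transform_within_open[OF chain V])
       (use xy c chart_inv_chart[OF chart[OF c(1)]] bary in \<open>auto simp: local_rep_def simplex_map_def\<close>)
  then have "frechet_derivative ?h (at (x, y)) = ?D \<circ> ?E"
    using frechet_derivative_at by metis
  moreover have "\<omega> d (snd d (f (s ?t))) (?D v) (?D w) = \<omega> c (snd c (s ?t)) v w" for v w
    using f(2) c d unfolding preserves_form_def Let_def by blast
  ultimately show "\<omega> d (?h (x, y)) (frechet_derivative ?h (at (x, y)) (1, 0)) (frechet_derivative ?h (at (x, y)) (0, 1))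
      = \<omega> c (?g (x, y)) (?E (1, 0)) (?E (0, 1))"
    using fs by simp
qed

section \<open>Singular chains and their boundaries\<close>

text \<open>Regularity and support are carried together, so that one set of closure rules serves
  smooth chains, continuous chains and chains inside a chart ball.\<close>

definition chains_within ::
    "('a::topological_space, 'e::euclidean_space) chart set \<Rightarrow> regularity \<Rightarrow> nat \<Rightarrow> 'a set \<Rightarrow> 'a chain set"
  where "chains_within A r p U =
    {c. Poly_Mapping.keys c \<subseteq> {s \<in> simplices A r p. s ` standard_simplex p \<subseteq> U}}"

lemma chains_eq_within: "chains A r p = chains_within A r p UNIV"
  by (simp add: chains_def chains_within_def)

lemma chains_within_Continuous:
  "c \<in> chains_within A Continuous p U \<longleftrightarrow> singular_chain p (top_of_set U) c"
  by (fastforce simp: chains_within_def simplices_def singular_chain_def singular_simplex_subtopology)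

lemma chains_within_mono: "U \<subseteq> V \<Longrightarrow> c \<in> chains_within A r p U \<Longrightarrow> c \<in> chains_within A r p V"
  by (auto simp: chains_within_def)

lemma simplices_continuous: "simplices A r p \<subseteq> simplices A Continuous p"
  by (cases r) (auto simp: simplices_def smooth_simplex_def)

lemma chains_within_continuous:
  "c \<in> chains_within A r p U \<Longrightarrow> singular_chain p (top_of_set U) c"
  using simplices_continuous[of A r p] unfolding chains_within_Continuous[symmetric, where A = A]
  by (fastforce simp: chains_within_def)

lemma chains_within_0 [simp]: "0 \<in> chains_within A r p U"
  by (simp add: chains_within_def)

lemma chains_within_of [simp]:
  "frag_of s \<in> chains_within A r p U \<longleftrightarrow> s \<in> simplices A r p \<and> s ` standard_simplex p \<subseteq> U"
  by (auto simp: chains_within_def)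

lemma chains_within_add:
  "a \<in> chains_within A r p U \<Longrightarrow> b \<in> chains_within A r p U \<Longrightarrow> a + b \<in> chains_within A r p U"
  using keys_add[of a b] unfolding chains_within_def by blast

lemma chains_within_diff:
  "a \<in> chains_within A r p U \<Longrightarrow> b \<in> chains_within A r p U \<Longrightarrow> a - b \<in> chains_within A r p U"
  using keys_diff[of a b] unfolding chains_within_def by blast

lemma chains_within_cmul:
  "a \<in> chains_within A r p U \<Longrightarrow> frag_cmul k a \<in> chains_within A r p U"
  using keys_cmul[of k a] unfolding chains_within_def by blast

lemma chains_within_sum:
  "(\<And>i. i \<in> I \<Longrightarrow> f i \<in> chains_within A r p U) \<Longrightarrow> (\<Sum>i\<in>I. f i) \<in> chains_within A r p U"
  by (induction I rule: infinite_finite_induct) (auto intro: chains_within_add)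

lemma chains_within_extend:
  "(\<And>s. s \<in> Poly_Mapping.keys c \<Longrightarrow> f s \<in> chains_within A r p U) \<Longrightarrow>
    frag_extend f c \<in> chains_within A r p U"
  unfolding frag_extend_def by (intro chains_within_sum chains_within_cmul)

lemma chains_within_keys:
  "c \<in> chains_within A r p U \<Longrightarrow> s \<in> Poly_Mapping.keys c \<Longrightarrow>
    s \<in> simplices A r p \<and> s ` standard_simplex p \<subseteq> U"
  by (auto simp: chains_within_def)

lemma singular_face_image:
  assumes "1 \<le> p" "k \<le> p"
  shows "singular_face p k s ` standard_simplex (p - 1) \<subseteq> s ` standard_simplex p"
  using simplical_face_in_standard_simplex[OF assms] by (auto simp: singular_face_def)

lemma chain_boundary_extend:
  "chain_boundary p (frag_extend f c) = frag_extend (\<lambda>s. chain_boundary p (f s)) c"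
  using subset_UNIV
  by (induction c rule: frag_induction) (auto simp: frag_extend_diff chain_boundary_diff)

lemma chain_boundary_as_extend:
  "chain_boundary p c = frag_extend (\<lambda>s. chain_boundary p (frag_of s)) c"
  using subset_UNIV
  by (induction c rule: frag_induction) (auto simp: frag_extend_diff chain_boundary_diff)

lemma frag_extend_extend:
  "frag_extend f (frag_extend g c) = frag_extend (\<lambda>s. frag_extend f (g s)) c"
  using subset_UNIV
  by (induction c rule: frag_induction) (auto simp: frag_extend_diff)

lemma frag_extend_diff_fun:
  "frag_extend (\<lambda>s. f s - g s) c = frag_extend f c - frag_extend g c"
  using subset_UNIV
  by (induction c rule: frag_induction) (auto simp: frag_extend_diff)

lemma frag_extend_of_id: "frag_extend frag_of c = c"
  by (rule frag_expansion[symmetric])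

section \<open>Edges, triangles and the divided square\<close>

abbreviation vertex :: "nat \<Rightarrow> nat \<Rightarrow> real" where
  "vertex k \<equiv> \<lambda>j. if j = k then 1 else 0"

abbreviation const_simplex :: "nat \<Rightarrow> 'a \<Rightarrow> (nat \<Rightarrow> real) \<Rightarrow> 'a" where
  "const_simplex p a \<equiv> restrict (\<lambda>_. a) (standard_simplex p)"

lemma standard_simplex_1D:
  assumes "x \<in> standard_simplex 1"
  shows "0 \<le> x 1" "x 1 \<le> 1" "x 0 = 1 - x 1" "i \<noteq> 0 \<Longrightarrow> i \<noteq> 1 \<Longrightarrow> x i = 0"
  using assms by (auto simp: standard_simplex_def)

lemma standard_simplex_2D:
  assumes "x \<in> standard_simplex 2"
  shows "0 \<le> x 0" "0 \<le> x 1" "0 \<le> x 2" "x 0 = 1 - x 1 - x 2"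
    "i \<noteq> 0 \<Longrightarrow> i \<noteq> 1 \<Longrightarrow> i \<noteq> 2 \<Longrightarrow> x i = 0"
  using assms by (auto simp: standard_simplex_def numeral_2_eq_2)

lemma standard_simplex_1I:
  assumes "0 \<le> a" "0 \<le> b" "a + b = 1"
  shows "(\<lambda>i. if i = 0 then a else if i = 1 then b else 0) \<in> standard_simplex 1"
  using assms by (auto simp: standard_simplex_def)

lemma face_1_0: "x \<in> standard_simplex 0 \<Longrightarrow> simplical_face 0 x = vertex 1"
  and face_1_1: "x \<in> standard_simplex 0 \<Longrightarrow> simplical_face (Suc 0) x = vertex 0"
  by (auto simp: standard_simplex_0 simplical_face_def fun_eq_iff)

lemma chain_boundary_path:
  "chain_boundary 1 (frag_of e) =
    frag_of (const_simplex 0 (e (vertex 1))) - frag_of (const_simplex 0 (e (vertex 0)))"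
proof -
  have "singular_face (Suc 0) 0 e = const_simplex 0 (e (vertex 1))"
    "singular_face (Suc 0) (Suc 0) e = const_simplex 0 (e (vertex 0))"
    using face_1_0 face_1_1 by (auto simp: singular_face_def restrict_def intro!: ext)
  then show ?thesis
    by (simp add: chain_boundary_of)
qed

lemma chain_boundary_triangle:
  "chain_boundary 2 (frag_of s) = frag_of (restrict (\<lambda>x. s (simplical_face 0 x)) (standard_simplex 1))
     - frag_of (restrict (\<lambda>x. s (simplical_face 1 x)) (standard_simplex 1))
     + frag_of (restrict (\<lambda>x. s (simplical_face 2 x)) (standard_simplex 1))"
  by (simp add: chain_boundary_of numeral_2_eq_2 singular_face_def o_def)

lemma simplical_face_in_2: "k \<le> 2 \<Longrightarrow> x \<in> standard_simplex 1 \<Longrightarrow> simplical_face k x \<in> standard_simplex 2"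
  using simplical_face_in_standard_simplex[of 2 k x] by simp

lemma chain_boundary_restrict_triangle:
  "chain_boundary 2 (frag_of (restrict s (standard_simplex 2))) =
     frag_of (restrict (\<lambda>x. s (simplical_face 0 x)) (standard_simplex 1))
     - frag_of (restrict (\<lambda>x. s (simplical_face 1 x)) (standard_simplex 1))
     + frag_of (restrict (\<lambda>x. s (simplical_face 2 x)) (standard_simplex 1))"
proof -
  have "restrict (\<lambda>x. restrict s (standard_simplex 2) (simplical_face k x)) (standard_simplex 1) =
      restrict (\<lambda>x. s (simplical_face k x)) (standard_simplex 1)" if "k \<le> 2" for k
    using simplical_face_in_2[OF that] by (auto simp: fun_eq_iff restrict_def)
  then show ?thesis
    by (simp add: chain_boundary_triangle)
qed

text \<open>Two of the three equal faces cancel. A constant edge can therefore be removed from a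
  boundary by a degenerate triangle.\<close>

lemma chain_boundary_const_2:
  "chain_boundary 2 (frag_of (const_simplex 2 a)) = frag_of (const_simplex 1 a)"
  by (simp add: chain_boundary_restrict_triangle)

text \<open>The two triangles into which the diagonal divides the square \<open>[0,1] \<times> \<Delta>\<^sup>1\<close>.\<close>

definition lower_proj :: "(nat \<Rightarrow> real) \<Rightarrow> nat \<Rightarrow> real" where
  "lower_proj u = (\<lambda>i. if i = 0 then u 0 else if i = 1 then u 1 + u 2 else 0)"

definition upper_proj :: "(nat \<Rightarrow> real) \<Rightarrow> nat \<Rightarrow> real" where
  "upper_proj u = (\<lambda>i. if i = 0 then u 0 + u 1 else if i = 1 then u 2 else 0)"

definition lower_triangle :: "(real \<Rightarrow> (nat \<Rightarrow> real) \<Rightarrow> 'a) \<Rightarrow> (nat \<Rightarrow> real) \<Rightarrow> 'a" where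
  "lower_triangle H = restrict (\<lambda>u. H (u 2) (lower_proj u)) (standard_simplex 2)"

definition upper_triangle :: "(real \<Rightarrow> (nat \<Rightarrow> real) \<Rightarrow> 'a) \<Rightarrow> (nat \<Rightarrow> real) \<Rightarrow> 'a" where
  "upper_triangle H = restrict (\<lambda>u. H (u 1 + u 2) (upper_proj u)) (standard_simplex 2)"

text \<open>With time written before position, the lower triangle has the vertices (0,0), (0,1),
  (1,1) and the upper one (0,0), (1,0), (1,1). The diagonal is face 1 of both, so the minus sign
  cancels it.\<close>

definition square_chain :: "(real \<Rightarrow> (nat \<Rightarrow> real) \<Rightarrow> 'a) \<Rightarrow> 'a chain" where
  "square_chain H = frag_of (lower_triangle H) - frag_of (upper_triangle H)"

lemma proj_in_simplex:
  assumes "u \<in> standard_simplex 2"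
  shows "lower_proj u \<in> standard_simplex 1" "upper_proj u \<in> standard_simplex 1"
    "u 2 \<in> {0..1}" "u 1 + u 2 \<in> {0..1}"
  using standard_simplex_2D[OF assms] unfolding lower_proj_def upper_proj_def
  by (auto intro!: standard_simplex_1I simp del: One_nat_def)

lemma chain_boundary_square:
  "chain_boundary 2 (square_chain H) =
     frag_of (restrict (\<lambda>x. H (x 1) (vertex 1)) (standard_simplex 1))
     + frag_of (restrict (H 0) (standard_simplex 1))
     - frag_of (restrict (H 1) (standard_simplex 1))
     - frag_of (restrict (\<lambda>x. H (x 1) (vertex 0)) (standard_simplex 1))"
proof -
  have eq: "lower_proj (simplical_face 0 x) = vertex 1" "lower_proj (simplical_face 1 x) = x"
    "lower_proj (simplical_face 2 x) = x" "upper_proj (simplical_face 0 x) = x"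
    "upper_proj (simplical_face 1 x) = x" "upper_proj (simplical_face 2 x) = vertex 0"
    "simplical_face 0 x 1 = x 0" "simplical_face 0 x 2 = x 1" "x 0 + x 1 = 1"
    "simplical_face 1 x 1 = 0" "simplical_face 1 x 2 = x 1"
    "simplical_face 2 x 1 = x 1" "simplical_face 2 x 2 = 0"
    if "x \<in> standard_simplex 1" for x
    using standard_simplex_1D[OF that]
    by (auto simp: lower_proj_def upper_proj_def simplical_face_def fun_eq_iff)
  show ?thesis
    unfolding square_chain_def lower_triangle_def upper_triangle_def chain_boundary_diff
      chain_boundary_restrict_triangle
    by (simp add: eq del: One_nat_def cong: restrict_cong)
qed

text \<open>The coefficients are the images of the vertices 0, 1, 2: the lower projection sends them
  to 0, 1, 1 and the upper one to 0, 0, 1.\<close>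

lemma coord_affine_proj: "coord_affine lower_proj" "coord_affine upper_proj"
proof -
  have "(\<lambda>x i. \<Sum>j\<le>2. vertex (if j = 0 then 0 else 1) i * x j) = lower_proj"
    "(\<lambda>x i. \<Sum>j\<le>2. vertex (if j = 2 then 1 else 0) i * x j) = upper_proj"
    by (auto simp: lower_proj_def upper_proj_def fun_eq_iff numeral_2_eq_2)
  then show "coord_affine lower_proj" "coord_affine upper_proj"
    using coord_affine_combination[of 2 "\<lambda>j. vertex (if j = 0 then 0 else 1)"]
      coord_affine_combination[of 2 "\<lambda>j. vertex (if j = 2 then 1 else 0)"] by simp_all
qed

lemma coord_affine_continuous: "coord_affine \<tau> \<Longrightarrow> continuous_on S \<tau>"
  unfolding coord_affine_def using continuous_on_subset by blast

lemma square_chain_continuous: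
  assumes H: "continuous_on ({0..1} \<times> standard_simplex 1) (\<lambda>z. H (fst z) (snd z))"
  shows "singular_chain 2 euclidean (square_chain H)"
proof -
  have c: "continuous_on (standard_simplex 2) (\<lambda>u. H (f u) (\<tau> u))"
    if "continuous_on (standard_simplex 2) f" "coord_affine \<tau>"
      "\<And>u. u \<in> standard_simplex 2 \<Longrightarrow> f u \<in> {0..1} \<and> \<tau> u \<in> standard_simplex 1" for f \<tau>
    using continuous_on_compose2[OF H continuous_on_Pair[OF that(1) coord_affine_continuous[OF that(2)]]]
      that(3) by (simp add: image_subset_iff del: One_nat_def)
  have "continuous_on (standard_simplex 2) (\<lambda>u. u 2 :: real)" "continuous_on (standard_simplex 2) (\<lambda>u. u 1 + u 2 :: real)"
    by (auto intro!: continuous_intros continuous_on_subset[OF continuous_on_product_coordinates])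
  then have "continuous_on (standard_simplex 2) (\<lambda>u. H (u 2) (lower_proj u))"
    "continuous_on (standard_simplex 2) (\<lambda>u. H (u 1 + u 2) (upper_proj u))"
    using proj_in_simplex by (intro c coord_affine_proj; auto)+
  then show ?thesis
    unfolding square_chain_def lower_triangle_def upper_triangle_def
    by (intro singular_chain_diff)
       (simp_all add: singular_chain_of singular_simplex_euclidean cong: continuous_on_cong)
qed

text \<open>If each edge bounds up to a term that depends only on its endpoints, these terms add up
  to a linear function of the boundary of \<open>z\<close>, which is zero. This serves contractions
  in a ball as well as systems of paths from a base point.\<close>

lemma boundary_of_cycle_filling:
  assumes z: "chain_boundary 1 z = 0"
    and K: "\<And>e. e \<in> Poly_Mapping.keys z \<Longrightarrow>
      chain_boundary 2 (K e) = frag_of e - (g (e (vertex 1)) - g (e (vertex 0)))"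
  shows "chain_boundary 2 (frag_extend K z) = z"
proof -
  \<comment> \<open>\<open>vertex 0\<close> is the only point of the standard 0-simplex, so
    evaluation there recovers a point from a 0-simplex.\<close>
  define \<phi> where "\<phi> s = g (s (vertex 0))" for s :: "(nat \<Rightarrow> real) \<Rightarrow> 'a"
  have "frag_extend \<phi> (chain_boundary 1 z) =
      frag_extend (\<lambda>e. g (e (vertex 1)) - g (e (vertex 0))) z"
    by (subst chain_boundary_as_extend, unfold frag_extend_extend chain_boundary_path)
       (simp add: frag_extend_diff \<phi>_def)
  then have "frag_extend (\<lambda>e. g (e (vertex 1)) - g (e (vertex 0))) z = 0"
    using z by simp
  moreover have "chain_boundary 2 (frag_extend K z) =
      frag_extend (\<lambda>e. frag_of e - (g (e (vertex 1)) - g (e (vertex 0)))) z"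
    unfolding chain_boundary_extend by (rule frag_extend_eq) (use K in auto)
  ultimately show ?thesis
    by (simp add: frag_extend_diff_fun frag_extend_of_id)
qed

section \<open>Chains in chart balls\<close>

text \<open>Balls are convex, so segments and contractions to the centre remain inside. The ambient
  chart is retained, as its restriction may fail to belong to \<open>A\<close>.\<close>

definition chart_ball ::
    "('a::topological_space, 'e::euclidean_space) chart set \<Rightarrow> 'a set \<Rightarrow> bool" where
  "chart_ball A B \<longleftrightarrow> (\<exists>c\<in>A. \<exists>y \<epsilon>. 0 < \<epsilon> \<and> ball y \<epsilon> \<subseteq> chart_image c \<and> B = chart_inv c ` ball y \<epsilon>)"

lemma chart_ballE:
  assumes A: "smooth_atlas A" and B: "chart_ball A B"
  obtains c y \<epsilon> where "c \<in> A" "is_chart c" "0 < \<epsilon>" "ball y \<epsilon> \<subseteq> chart_image c"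
    "B = chart_inv c ` ball y \<epsilon>" "B = {x \<in> fst c. snd c x \<in> ball y \<epsilon>}"
proof -
  obtain c y \<epsilon> where c: "c \<in> A" "0 < \<epsilon>" "ball y \<epsilon> \<subseteq> chart_image c" "B = chart_inv c ` ball y \<epsilon>"
    using B unfolding chart_ball_def by blast
  note chart = smooth_atlas_chart[OF A c(1)]
  have "chart_inv c ` ball y \<epsilon> = {x \<in> fst c. snd c x \<in> ball y \<epsilon>}"
  proof (intro equalityI subsetI)
    fix x assume "x \<in> chart_inv c ` ball y \<epsilon>"
    then obtain v where v: "v \<in> ball y \<epsilon>" "x = chart_inv c v"
      by blast
    with c(3) have "v \<in> chart_image c" by blast
    with v show "x \<in> {x \<in> fst c. snd c x \<in> ball y \<epsilon>}"
      using chart_inv_in_domain[OF chart] chart_chart_inv[OF chart] by simp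
  next
    fix x assume "x \<in> {x \<in> fst c. snd c x \<in> ball y \<epsilon>}"
    then show "x \<in> chart_inv c ` ball y \<epsilon>"
      using chart_inv_chart[OF chart, of x] by (metis (mono_tags, lifting) imageI mem_Collect_eq)
  qed
  with c chart that show thesis by blast
qed

lemma chart_ball_open:
  assumes A: "smooth_atlas A" and B: "chart_ball A B"
  shows "open B"
proof -
  obtain c y \<epsilon> where "c \<in> A" and c: "is_chart c" and "0 < \<epsilon>" "ball y \<epsilon> \<subseteq> chart_image c"
    "B = chart_inv c ` ball y \<epsilon>" and B': "B = {x \<in> fst c. snd c x \<in> ball y \<epsilon>}"
    by (rule chart_ballE[OF A B])
  have "continuous_on (fst c) (snd c)"
    using chart_homeomorphism[OF c] homeomorphism_cont1 by blast
  from continuous_open_preimage[OF this chart_open_domain[OF c] open_ball, of y \<epsilon>]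
  show ?thesis
    by (simp add: B' vimage_def Int_def)
qed

lemma chart_ball_neighbourhood:
  assumes A: "smooth_atlas A" and U: "open U" "x \<in> U"
  obtains B where "chart_ball A B" "x \<in> B" "B \<subseteq> U"
proof -
  obtain c where c: "c \<in> A" "x \<in> fst c"
    using smooth_atlas_cover[OF A] by blast
  note chart = smooth_atlas_chart[OF A c(1)]
  have "open (snd c ` (fst c \<inter> U))" "snd c x \<in> snd c ` (fst c \<inter> U)"
    using open_chart_image[OF chart U(1)] c U by auto
  then obtain \<epsilon> where \<epsilon>: "\<epsilon> > 0" "ball (snd c x) \<epsilon> \<subseteq> snd c ` (fst c \<inter> U)"
    using open_contains_ball by blast
  show thesis
  proof
    show "chart_ball A (chart_inv c ` ball (snd c x) \<epsilon>)"
      unfolding chart_ball_def chart_image_def using c \<epsilon> by blast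
    show "x \<in> chart_inv c ` ball (snd c x) \<epsilon>"
      using \<epsilon>(1) chart_inv_chart[OF chart c(2)] by (metis centre_in_ball imageI)
    show "chart_inv c ` ball (snd c x) \<epsilon> \<subseteq> U"
      using \<epsilon>(2) chart by auto
  qed
qed

lemma chart_ball_line:
  assumes A: "smooth_atlas A" and B: "chart_ball A B" and ab: "a \<in> B" "b \<in> B"
  obtains l where "frag_of l \<in> chains_within A Smooth 1 B" "l (vertex 0) = a" "l (vertex 1) = b"
proof -
  obtain c y \<epsilon> where c: "c \<in> A" "is_chart c" "0 < \<epsilon>" "ball y \<epsilon> \<subseteq> chart_image c"
    "B = chart_inv c ` ball y \<epsilon>" "B = {x \<in> fst c. snd c x \<in> ball y \<epsilon>}"
    by (rule chart_ballE[OF A B])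
  define G where "G x = x 0 *\<^sub>R snd c a + x 1 *\<^sub>R snd c b" for x :: "nat \<Rightarrow> real"
  have G: "G x \<in> ball y \<epsilon>" if "x \<in> standard_simplex 1" for x
    unfolding G_def using standard_simplex_1D[OF that] ab c(6)
    by (intro convexD[OF convex_ball]) auto
  have smooth: "smooth_simplex A 1 (restrict (\<lambda>u. chart_inv c (G u)) (standard_simplex 1))"
    by (rule smooth_simplex_chart_inv[OF A c(1)])
       (use G c(4) in \<open>auto simp: G_def intro!: loc_smooth_add loc_smooth_scaleR loc_smooth_const loc_smooth_coordinate\<close>)
  show thesis
  proof
    show "frag_of (restrict (\<lambda>u. chart_inv c (G u)) (standard_simplex 1)) \<in> chains_within A Smooth 1 B"
      using smooth G c(5) by (auto simp: simplices_def)
    have "vertex 0 \<in> standard_simplex 1" "vertex 1 \<in> standard_simplex 1"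
      by (simp_all only: basis_in_standard_simplex)
    then show "restrict (\<lambda>u. chart_inv c (G u)) (standard_simplex 1) (vertex 0) = a"
      "restrict (\<lambda>u. chart_inv c (G u)) (standard_simplex 1) (vertex 1) = b"
      using ab c(2,6) by (simp_all add: G_def)
  qed
qed

text \<open>Each edge is contracted to the centre in coordinates. A square is used rather than a
  cone over the edge, because dividing by \<open>u 0 + u 1\<close> to recover the edge parameter is
  not smooth at the apex. The sides traced by the endpoints depend on these endpoints alone and
  cancel for a cycle.\<close>

lemma chart_ball_smooth_cycle:
  assumes A: "smooth_atlas A" and B: "chart_ball A B"
    and z: "z \<in> chains_within A Smooth 1 B" "chain_boundary 1 z = 0"
  obtains K where "K \<in> chains_within A Smooth 2 B" "chain_boundary 2 K = z"
proof -
  obtain c y \<epsilon> where c: "c \<in> A" "is_chart c" "0 < \<epsilon>" "ball y \<epsilon> \<subseteq> chart_image c"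
    "B = chart_inv c ` ball y \<epsilon>" "B = {x \<in> fst c. snd c x \<in> ball y \<epsilon>}"
    by (rule chart_ballE[OF A B])
  define H where "H e s x = chart_inv c ((1 - s) *\<^sub>R snd c (e x) + s *\<^sub>R y)"
    for e and s :: real and x :: "nat \<Rightarrow> real"
  define o' where "o' = chart_inv c y"
  define side where "side x = frag_of (restrict (\<lambda>u. chart_inv c ((1 - u 1) *\<^sub>R snd c x + u 1 *\<^sub>R y))
      (standard_simplex 1))" for x
  \<comment> \<open>The constant triangle cancels the far side of the square, where the edge has
    shrunk to the centre.\<close>
  define K where "K e = square_chain (H e) + frag_of (const_simplex 2 o')" for e
  have smooth: "frag_of (restrict (\<lambda>u. H e (f u) (\<tau> u)) (standard_simplex 2)) \<in> chains_within A Smooth 2 B"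
    if e: "e \<in> Poly_Mapping.keys z" and \<tau>: "coord_affine \<tau>"
      and dom: "\<And>u. u \<in> standard_simplex 2 \<Longrightarrow> f u \<in> {0..1} \<and> \<tau> u \<in> standard_simplex 1"
      and f: "\<And>t. loc_smooth 2 f t" for e f \<tau>
  proof -
    \<comment> \<open>\<open>1 - f u\<close> is spelled as a sum with a scalar multiple to match the
      closure rules of \<open>loc_smooth\<close>.\<close>
    let ?G = "\<lambda>u. (1 + (-1) *\<^sub>R f u) *\<^sub>R snd c (e (\<tau> u)) + f u *\<^sub>R y"
    have e': "smooth_simplex A 1 e" "\<And>x. x \<in> standard_simplex 1 \<Longrightarrow> e x \<in> B"
      using chains_within_keys[OF z(1) e] by (auto simp: simplices_def)
    have G: "?G u \<in> ball y \<epsilon>" if "u \<in> standard_simplex 2" for u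
      using dom[OF that] e'(2)[of "\<tau> u"] c(3,6) by (intro convexD[OF convex_ball]) auto
    have "loc_smooth 2 ?G t" if t: "t \<in> standard_simplex 2" for t
    proof (intro loc_smooth_add loc_smooth_scaleR loc_smooth_const f)
      have "loc_smooth 1 (\<lambda>u. snd c (e u)) (\<tau> t)"
        by (rule smooth_simplex_local_chart[OF A e'(1) _ c(1)]) (use dom[OF t] e'(2) c(6) in auto)
      then show "loc_smooth 2 (\<lambda>u. snd c (e (\<tau> u))) t"
        by (rule loc_smooth_affine) (use \<tau> dom in auto)
    qed
    then have "smooth_simplex A 2 (restrict (\<lambda>u. chart_inv c (?G u)) (standard_simplex 2))"
      using G c(4) by (intro smooth_simplex_chart_inv[OF A c(1)]) auto
    then show ?thesis
      using G c(5) by (auto simp: H_def simplices_def)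
  qed
  have o'B: "o' \<in> B"
    using c(3,5) by (simp add: o'_def)
  show thesis
  proof
    show "frag_extend K z \<in> chains_within A Smooth 2 B"
    proof (rule chains_within_extend)
      fix e assume e: "e \<in> Poly_Mapping.keys z"
      have "frag_of (const_simplex 2 o') \<in> chains_within A Smooth 2 B"
        using smooth_simplex_const[OF A] o'B by (auto simp: simplices_def)
      moreover have "frag_of (lower_triangle (H e)) \<in> chains_within A Smooth 2 B"
        unfolding lower_triangle_def
        by (rule smooth[OF e coord_affine_proj(1)]) (use proj_in_simplex loc_smooth_coordinate in auto)
      moreover have "frag_of (upper_triangle (H e)) \<in> chains_within A Smooth 2 B"
        unfolding upper_triangle_def
        by (rule smooth[OF e coord_affine_proj(2)])
           (use proj_in_simplex loc_smooth_add[OF loc_smooth_coordinate loc_smooth_coordinate] in auto)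
      ultimately show "K e \<in> chains_within A Smooth 2 B"
        unfolding K_def square_chain_def by (intro chains_within_add chains_within_diff)
    qed
    show "chain_boundary 2 (frag_extend K z) = z"
    \<comment> \<open>The minus sign arises because the sides run from the edge to the centre, not
      from the centre to the edge.\<close>
    proof (rule boundary_of_cycle_filling[OF z(2), where g = "\<lambda>x. - side x"])
      fix e assume e: "e \<in> Poly_Mapping.keys z"
      have e': "smooth_simplex A 1 e" "\<And>x. x \<in> standard_simplex 1 \<Longrightarrow> e x \<in> B"
        using chains_within_keys[OF z(1) e] by (auto simp: simplices_def)
      have "e \<in> extensional (standard_simplex 1)"
        using smooth_simplex_singular[OF e'(1)] by (simp add: singular_simplex_def)
      moreover have "H e 0 x = e x" if "x \<in> standard_simplex 1" for x
        using e'(2)[OF that] c(2,6) by (simp add: H_def)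
      ultimately have "restrict (H e 0) (standard_simplex 1) = e"
        by (intro ext) (simp add: restrict_def extensional_def)
      moreover have "restrict (H e 1) (standard_simplex 1) = const_simplex 1 o'"
        by (simp add: H_def[abs_def] o'_def)
      moreover have "frag_of (restrict (\<lambda>x. H e (x 1) (vertex k)) (standard_simplex 1)) = side (e (vertex k))" for k
        by (simp add: H_def side_def)
      ultimately show "chain_boundary 2 (K e) = frag_of e - (- side (e (vertex 1)) - - side (e (vertex 0)))"
        unfolding K_def chain_boundary_add chain_boundary_square chain_boundary_const_2 by simp
    qed
  qed
qed

lemma chart_ball_contractible:
  assumes A: "smooth_atlas A" and B: "chart_ball A B"
  shows "contractible_space (top_of_set B)"
proof -
  obtain c y \<epsilon> where c: "c \<in> A" "is_chart c" "0 < \<epsilon>" "ball y \<epsilon> \<subseteq> chart_image c"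
    "B = chart_inv c ` ball y \<epsilon>" "B = {x \<in> fst c. snd c x \<in> ball y \<epsilon>}"
    by (rule chart_ballE[OF A B])
  have "homeomorphic_maps (top_of_set B) (top_of_set (ball y \<epsilon>)) (snd c) (chart_inv c)"
    unfolding homeomorphic_maps_def
  proof (intro conjI ballI)
    have "continuous_on B (snd c)"
      by (rule continuous_on_subset[OF homeomorphism_cont1[OF chart_homeomorphism[OF c(2)]]]) (use c(6) in auto)
    moreover have "continuous_on (ball y \<epsilon>) (chart_inv c)"
      by (rule continuous_on_subset[OF homeomorphism_cont2[OF chart_homeomorphism[OF c(2)]] c(4)])
    ultimately show "continuous_map (top_of_set B) (top_of_set (ball y \<epsilon>)) (snd c)"
      "continuous_map (top_of_set (ball y \<epsilon>)) (top_of_set B) (chart_inv c)"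
      using c(5,6) by (auto simp: continuous_map_in_subtopology)
  qed (use c in auto)
  then have "top_of_set B homeomorphic_space top_of_set (ball y \<epsilon>)"
    unfolding homeomorphic_space_def by blast
  then show ?thesis
    using homeomorphic_space_contractibility convex_imp_contractible[OF convex_ball]
      contractible_space_top_of_set by blast
qed

text \<open>The identity is homotopic to a constant map, whose chain map factors through a one-point
  space; there every cycle of positive degree bounds.\<close>

lemma contractible_cycle_boundary:
  assumes X: "contractible_space X" and z: "singular_chain p X z" "chain_boundary p z = 0" and p: "1 \<le> p"
  obtains d where "singular_chain (Suc p) X d" "chain_boundary (Suc p) d = z"
proof (cases "topspace X = {}")
  \<comment> \<open>An empty space counts as contractible, but \<open>a\<close> is then not a point
    of it.\<close>
  case True
  then have "z = 0"
    using z singular_chain_empty by blast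
  then show ?thesis
    using that[of 0] by simp
next
  case False
  have z': "singular_relcycle p X {} z"
    using z by (simp add: singular_cycle)
  obtain a where a: "homotopic_with (\<lambda>x. True) X X id (\<lambda>x. a)"
    using X unfolding contractible_space_def by blast
  then have cont: "continuous_map X X (\<lambda>x. a)"
    using homotopic_with_imp_continuous_maps by blast
  with False have aX: "a \<in> topspace X"
    by (auto simp: continuous_map_def)
  have "homotopic_with (\<lambda>h. h \<in> {} \<rightarrow> {}) X X id (\<lambda>x. a)"
    using a by simp
  from homotopic_imp_homologous_rel_chain_maps[OF this z']
  have *: "homologous_rel p X {} z (chain_map p (\<lambda>x. a) z)"
    using chain_map_ident[OF z(1)] by simp
  have "continuous_map X (subtopology X {a}) (\<lambda>x. a)"
    using cont by (simp add: continuous_map_in_subtopology)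
  then have "singular_relcycle p (subtopology X {a}) {} (chain_map p (\<lambda>x. a) z)"
    using singular_relcycle_chain_map[OF z'] by (metis Pi_empty UNIV_I)
  then have "singular_relboundary p (subtopology X {a}) {} (chain_map p (\<lambda>x. a) z)"
    using singular_boundary_eq_cycle_singleton[of "subtopology X {a}" a p] aX p by simp
  then have "singular_relboundary p X {} (chain_map p (\<lambda>x. a) z)"
    using singular_boundary_mono[of "{a}" "topspace X" p X] aX by simp
  with * have "singular_relboundary p X {} z"
    unfolding homologous_rel_def using singular_relboundary_add by fastforce
  then show ?thesis
    using that unfolding singular_boundary by blast
qed

lemma small_iterated_subdivision:
  assumes "\<And>U. U \<in> \<C> \<Longrightarrow> openin X U" "topspace X \<subseteq> \<Union>\<C>" "singular_chain p X c"
  shows "\<exists>n. \<forall>f\<in>Poly_Mapping.keys ((singular_subdivision p ^^ n) c). \<exists>V\<in>\<C>. f \<in> standard_simplex p \<rightarrow> V"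
proof (rule sufficient_iterated_singular_subdivision_exists[OF assms])
  fix n
  assume "\<And>m f. n \<le> m \<Longrightarrow> f \<in> Poly_Mapping.keys ((singular_subdivision p ^^ m) c) \<Longrightarrow>
      \<exists>V\<in>\<C>. f \<in> standard_simplex p \<rightarrow> V"
  from this[OF order_refl] show ?thesis
    by blast
qed

text \<open>The quantifiers matter: one \<open>h\<close> serves all degrees and all spaces. It
  therefore respects every subspace, even a single point, and its values in degrees 0 and 1 belong
  together.\<close>

lemma iterated_subdivision_homotopy:
  shows "\<exists>h :: nat \<Rightarrow> 'a chain \<Rightarrow> 'a chain. (\<forall>p c1 c2. h p (c1 - c2) = h p c1 - h p c2) \<and>
    (\<forall>p X c. singular_chain p X c \<longrightarrow> singular_chain (Suc p) X (h p c) \<and>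
      chain_boundary (Suc p) (h p c) + h (p - Suc 0) (chain_boundary p c)
        = (singular_subdivision p ^^ n) c - c)"
proof (rule chain_homotopic_iterated_singular_subdivision[of n])
  fix h :: "nat \<Rightarrow> 'a chain \<Rightarrow> 'a chain"
  assume "\<And>p c1 c2. h p (c1 - c2) = h p c1 - h p c2"
    and "\<And>p X c. singular_chain p X c \<Longrightarrow> singular_chain (Suc p) X (h p c)"
    and "\<And>p X c. singular_chain p X c \<Longrightarrow>
      chain_boundary (Suc p) (h p c) + h (p - Suc 0) (chain_boundary p c)
        = (singular_subdivision p ^^ n) c - c"
  then show ?thesis
    by (intro exI[of _ h]) simp
qed

section \<open>Smoothing of chains\<close>

text \<open>The pieces of a fine subdivision are replaced by coordinate segments with the same
  endpoints; piece minus segment is a cycle in a contractible ball. The subdivision homotopy also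
  contributes \<open>h 0\<close> of the endpoints of \<open>e\<close>, which has to be absorbed into
  \<open>l\<close>.\<close>

lemma edge_smoothing:
  fixes A :: "('a::topological_space, 'e::euclidean_space) chart set"
  assumes A: "smooth_atlas A" and U: "open U" and e: "singular_simplex 1 (top_of_set U) e"
  obtains l D where "l \<in> chains_within A Smooth 1 U" "singular_chain 2 (top_of_set U) D"
    "chain_boundary 2 D = frag_of e - l"
proof -
  let ?C = "{B. chart_ball A B \<and> B \<subseteq> U}"
  have C1: "\<And>B. B \<in> ?C \<Longrightarrow> openin (top_of_set U) B"
    using chart_ball_open[OF A] by (auto intro: open_subset)
  have C2: "topspace (top_of_set U) \<subseteq> \<Union>?C"
  proof
    fix x assume "x \<in> topspace (top_of_set U)"
    then have "x \<in> U" by simp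
    then obtain B where "chart_ball A B" "x \<in> B" "B \<subseteq> U"
      by (rule chart_ball_neighbourhood[OF A U])
    then show "x \<in> \<Union>?C" by blast
  qed
  have e': "singular_chain 1 (top_of_set U) (frag_of e)"
    using e by (simp add: singular_chain_of)
  obtain n where n: "\<forall>f\<in>Poly_Mapping.keys ((singular_subdivision 1 ^^ n) (frag_of e)).
      \<exists>B\<in>?C. f \<in> standard_simplex 1 \<rightarrow> B"
    using small_iterated_subdivision[OF C1 C2 e'] by blast
  obtain h :: "nat \<Rightarrow> 'a chain \<Rightarrow> 'a chain" where h_diff: "\<And>p c1 c2. h p (c1 - c2) = h p c1 - h p c2"
    and h: "\<And>p X c. singular_chain p X c \<Longrightarrow> singular_chain (Suc p) X (h p c) \<and>
      chain_boundary (Suc p) (h p c) + h (p - Suc 0) (chain_boundary p c)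
        = (singular_subdivision p ^^ n) c - c"
    using iterated_subdivision_homotopy[of n] by auto
  let ?c = "(singular_subdivision 1 ^^ n) (frag_of e)"
  have hpt: "h 0 (frag_of (const_simplex 0 a)) \<in> chains_within A Smooth 1 U" if "a \<in> U" for a
  proof -
    have "singular_chain 0 (top_of_set {a}) (frag_of (const_simplex 0 a))"
      by (auto simp: singular_chain_of singular_simplex_subtopology singular_simplex_euclidean
          cong: continuous_on_cong)
    from h[OF this] obtain b where "h 0 (frag_of (const_simplex 0 a)) = frag_cmul b (frag_of (const_simplex 1 a))"
      using singular_chain_singleton[of "top_of_set {a}" a] by auto
    then show ?thesis
      using smooth_simplex_const[OF A] that by (auto simp: simplices_def intro!: chains_within_cmul)
  qed
  have "singular_chain 1 (top_of_set U) ((singular_subdivision 1 ^^ m) (frag_of e))" for m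
    by (induction m) (simp_all add: e' singular_chain_singular_subdivision del: One_nat_def)
  then have cU: "singular_chain 1 (top_of_set U) ?c" by blast
  have "\<exists>l D. l \<in> chains_within A Smooth 1 U \<and> singular_chain 2 (top_of_set U) D \<and>
      chain_boundary 2 D = frag_of f - l" if f: "f \<in> Poly_Mapping.keys ?c" for f
  proof -
    obtain B where B: "chart_ball A B" "B \<subseteq> U" "f \<in> standard_simplex 1 \<rightarrow> B"
      using n f by blast
    have "singular_simplex 1 (top_of_set U) f"
      using cU f by (auto simp: singular_chain_def)
    then have fB: "singular_chain 1 (top_of_set B) (frag_of f)"
      using B(3) by (auto simp: singular_chain_of singular_simplex_subtopology)
    have v: "vertex 0 \<in> standard_simplex 1" "vertex 1 \<in> standard_simplex 1"
      by (simp_all only: basis_in_standard_simplex)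
    then have "f (vertex 0) \<in> B" "f (vertex 1) \<in> B"
      using B(3) by auto
    then obtain l where l: "frag_of l \<in> chains_within A Smooth 1 B"
      "l (vertex 0) = f (vertex 0)" "l (vertex 1) = f (vertex 1)"
      by (rule chart_ball_line[OF A B(1)])
    have "chain_boundary 1 (frag_of f - frag_of l) = 0"
      unfolding chain_boundary_diff chain_boundary_path l by simp
    moreover have "singular_chain 1 (top_of_set B) (frag_of f - frag_of l)"
      by (rule singular_chain_diff[OF fB chains_within_continuous[OF l(1)]])
    ultimately obtain D where D: "singular_chain 2 (top_of_set B) D" "chain_boundary 2 D = frag_of f - frag_of l"
      using contractible_cycle_boundary[OF chart_ball_contractible[OF A B(1)], of 1]
      by (metis One_nat_def order_refl Suc_1)
    then show ?thesis
      using B(2) l(1) chains_within_mono singular_chain_mono by metis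
  qed
  then obtain l D where lD: "\<And>f. f \<in> Poly_Mapping.keys ?c \<Longrightarrow> l f \<in> chains_within A Smooth 1 U \<and>
      singular_chain 2 (top_of_set U) (D f) \<and> chain_boundary 2 (D f) = frag_of f - l f"
    by metis
  show thesis
  proof
    have "e ` standard_simplex 1 \<subseteq> U"
      using e by (auto simp: singular_simplex_subtopology)
    then have "e (vertex k) \<in> U" if "k \<le> 1" for k
      using that basis_in_standard_simplex[of k 1] by blast
    then have "h 0 (chain_boundary 1 (frag_of e)) \<in> chains_within A Smooth 1 U"
      unfolding chain_boundary_path h_diff by (intro chains_within_diff hpt) auto
    then show "frag_extend l ?c - h 0 (chain_boundary 1 (frag_of e)) \<in> chains_within A Smooth 1 U"
      using lD by (intro chains_within_diff chains_within_extend) auto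
    show "singular_chain 2 (top_of_set U) (frag_extend D ?c - h 1 (frag_of e))"
      using lD h[OF e'] by (intro singular_chain_diff singular_chain_extend) (auto simp: numeral_2_eq_2)
    have "chain_boundary 2 (frag_extend D ?c) = frag_extend (\<lambda>f. frag_of f - l f) ?c"
      unfolding chain_boundary_extend by (rule frag_extend_eq) (use lD in auto)
    then show "chain_boundary 2 (frag_extend D ?c - h 1 (frag_of e)) =
        frag_of e - (frag_extend l ?c - h 0 (chain_boundary 1 (frag_of e)))"
      using h[OF e'] by (simp add: chain_boundary_diff frag_extend_diff_fun frag_extend_of_id
          numeral_2_eq_2 algebra_simps)
  qed
qed

lemma keys_chain_boundary_of:
  assumes "f \<in> Poly_Mapping.keys (chain_boundary (Suc p) (frag_of s))"
  shows "\<exists>k\<le>Suc p. f = singular_face (Suc p) k s"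
proof -
  have "Poly_Mapping.keys (chain_boundary (Suc p) (frag_of s)) \<subseteq>
      (\<Union>k\<le>Suc p. Poly_Mapping.keys (frag_cmul ((- 1) ^ k) (frag_of (singular_face (Suc p) k s))))"
    unfolding chain_boundary_of by (simp add: keys_sum del: sum.atMost_Suc)
  then obtain k where "k \<le> Suc p" "f \<in> Poly_Mapping.keys (frag_cmul ((- 1) ^ k) (frag_of (singular_face (Suc p) k s)))"
    using assms by blast
  then show ?thesis
    using keys_cmul[of "(- 1) ^ k" "frag_of (singular_face (Suc p) k s)"] by (auto simp: keys_frag_of)
qed

text \<open>Each edge is replaced inside the intersection of the chart balls of the triangles which it
  bounds, so that the boundary of a triangle is replaced inside the chart ball of that triangle.\<close>

lemma small_chain_smoothing:
  fixes A :: "('a::topological_space, 'e::euclidean_space) chart set"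
  assumes A: "smooth_atlas A" and D: "singular_chain 2 euclidean D"
    and small: "\<And>s. s \<in> Poly_Mapping.keys D \<Longrightarrow> \<exists>B. chart_ball A B \<and> s ` standard_simplex 2 \<subseteq> B"
    and bd: "chain_boundary 2 D \<in> chains A Smooth 1"
  obtains D' E where "D' \<in> chains A Smooth 2" "chain_boundary 2 D' = chain_boundary 2 D"
    "singular_chain 3 euclidean E" "chain_boundary 3 E = D - D'"
proof -
  let ?K = "Poly_Mapping.keys D"
  obtain B where B: "\<And>s. s \<in> ?K \<Longrightarrow> chart_ball A (B s) \<and> s ` standard_simplex 2 \<subseteq> B s"
    using small by metis
  \<comment> \<open>A finite intersection, hence open as \<open>edge_smoothing\<close> requires; it
    is the whole space if \<open>e\<close> is a face of no triangle in \<open>D\<close>.\<close>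
  define U where "U e = (\<Inter>s\<in>{s \<in> ?K. \<exists>k\<le>2. e = singular_face 2 k s}. B s)" for e
  have openU: "open (U e)" for e
    unfolding U_def using B chart_ball_open[OF A] by (intro open_INT) auto
  have UB: "U e \<subseteq> B s" if "s \<in> ?K" "k \<le> 2" "e = singular_face 2 k s" for e s k
    unfolding U_def using that by blast
  have face_in_U: "singular_simplex 1 (top_of_set (U e)) e"
    if "s \<in> ?K" "k \<le> 2" "e = singular_face 2 k s" for e s k
  proof -
    have "singular_simplex 2 euclidean s"
      using D that by (auto simp: singular_chain_def)
    then have "singular_simplex 1 euclidean e"
      using singular_simplex_singular_face[of 2 euclidean s k] that by simp
    moreover have "e ` standard_simplex 1 \<subseteq> B s'" if s': "s' \<in> ?K" "k' \<le> 2" "e = singular_face 2 k' s'" for s' k'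
      using singular_face_image[of 2 k' s'] B[OF s'(1)] s' by auto
    ultimately show ?thesis
      by (auto simp: singular_simplex_subtopology U_def simp del: One_nat_def)
  qed
  \<comment> \<open>An edge that is already smooth is kept, with zero homology \<open>M\<close>;
    this is what preserves the boundary of \<open>D\<close>.\<close>
  have "\<exists>l M. singular_simplex 1 (top_of_set (U e)) e \<longrightarrow>
      l \<in> chains_within A Smooth 1 (U e) \<and> singular_chain 2 (top_of_set (U e)) M \<and>
      chain_boundary 2 M = frag_of e - l \<and> (smooth_simplex A 1 e \<longrightarrow> l = frag_of e \<and> M = 0)" for e
  proof (cases "smooth_simplex A 1 e")
    case True
    then show ?thesis
      by (intro exI[of _ "frag_of e"] exI[of _ 0])
         (auto simp: simplices_def singular_simplex_subtopology simp del: One_nat_def)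
  next
    case False
    show ?thesis
    proof (cases "singular_simplex 1 (top_of_set (U e)) e")
      case True
      from edge_smoothing[OF A openU True] False show ?thesis
        by metis
    qed blast
  qed
  then obtain l M where lM: "\<And>e. singular_simplex 1 (top_of_set (U e)) e \<Longrightarrow>
      l e \<in> chains_within A Smooth 1 (U e) \<and> singular_chain 2 (top_of_set (U e)) (M e) \<and>
      chain_boundary 2 (M e) = frag_of e - l e \<and> (smooth_simplex A 1 e \<longrightarrow> l e = frag_of e \<and> M e = 0)"
    by metis
  have edge: "singular_simplex 1 (top_of_set (U e)) e \<and> U e \<subseteq> B s"
    if "s \<in> ?K" "e \<in> Poly_Mapping.keys (chain_boundary 2 (frag_of s))" for s e
    using keys_chain_boundary_of[of e 1 s] that face_in_U UB by (metis Suc_1)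
  have "\<exists>S E. S \<in> chains_within A Smooth 2 (B s) \<and>
      chain_boundary 2 S = frag_extend l (chain_boundary 2 (frag_of s)) \<and>
      singular_chain 3 euclidean E \<and>
      chain_boundary 3 E = frag_of s - frag_extend M (chain_boundary 2 (frag_of s)) - S" if s: "s \<in> ?K" for s
  proof -
    let ?c = "chain_boundary 2 (frag_of s)"
    note Bs = B[OF s]
    have sB: "singular_chain 2 (top_of_set (B s)) (frag_of s)"
      using D s Bs by (auto simp: singular_chain_of singular_simplex_subtopology singular_chain_def)
    have L: "frag_extend l ?c \<in> chains_within A Smooth 1 (B s)"
    proof (rule chains_within_extend)
      fix e assume "e \<in> Poly_Mapping.keys ?c"
      with edge[OF s] have "singular_simplex 1 (top_of_set (U e)) e" "U e \<subseteq> B s" by auto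
      with lM show "l e \<in> chains_within A Smooth 1 (B s)"
        using chains_within_mono by blast
    qed
    have MM: "singular_chain 2 (top_of_set (B s)) (frag_extend M ?c)"
    proof (rule singular_chain_extend)
      fix e assume "e \<in> Poly_Mapping.keys ?c"
      with edge[OF s] have "singular_simplex 1 (top_of_set (U e)) e" "U e \<subseteq> B s" by auto
      with lM show "singular_chain 2 (top_of_set (B s)) (M e)"
        using singular_chain_mono by blast
    qed
    have "chain_boundary 2 (frag_extend M ?c) = frag_extend (\<lambda>e. frag_of e - l e) ?c"
      unfolding chain_boundary_extend by (rule frag_extend_eq) (use edge[OF s] lM in auto)
    then have bdM: "chain_boundary 2 (frag_extend M ?c) = ?c - frag_extend l ?c"
      by (simp add: frag_extend_diff_fun frag_extend_of_id)
    have "chain_boundary 1 ?c = 0" "chain_boundary 1 (chain_boundary 2 (frag_extend M ?c)) = 0"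
      using chain_boundary_boundary_alt[of 1] sB MM by (simp_all add: numeral_2_eq_2)
    then have "chain_boundary 1 (frag_extend l ?c) = 0"
      unfolding bdM by (simp add: chain_boundary_diff)
    \<comment> \<open>The replaced boundary is a smooth cycle in the ball of \<open>s\<close> and is
      filled there. Triangle, edge homologies and filling then combine to a two-cycle in the same
      contractible ball, which yields \<open>E\<close>.\<close>
    then obtain S where S: "S \<in> chains_within A Smooth 2 (B s)" "chain_boundary 2 S = frag_extend l ?c"
      using chart_ball_smooth_cycle[OF A _ L] Bs by blast
    have bd0: "chain_boundary 2 (frag_of s - frag_extend M ?c - S) = 0"
      by (simp add: chain_boundary_diff bdM S(2))
    have "singular_chain 2 (top_of_set (B s)) (frag_of s - frag_extend M ?c - S)"
      by (intro singular_chain_diff sB MM chains_within_continuous[OF S(1)])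
    then obtain E where E: "singular_chain (Suc 2) (top_of_set (B s)) E"
      "chain_boundary (Suc 2) E = frag_of s - frag_extend M ?c - S"
      by (rule contractible_cycle_boundary[OF chart_ball_contractible[OF A conjunct1[OF Bs]] _ bd0 one_le_numeral])
    have "Suc 2 = 3" by simp
    with E have "singular_chain 3 euclidean E" "chain_boundary 3 E = frag_of s - frag_extend M ?c - S"
      by (simp_all only: singular_chain_subtopology)
    with S show ?thesis
      by blast
  qed
  then obtain S E where SE: "\<And>s. s \<in> ?K \<Longrightarrow> S s \<in> chains_within A Smooth 2 (B s) \<and>
      chain_boundary 2 (S s) = frag_extend l (chain_boundary 2 (frag_of s)) \<and>
      singular_chain 3 euclidean (E s) \<and>
      chain_boundary 3 (E s) = frag_of s - frag_extend M (chain_boundary 2 (frag_of s)) - S s"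
    by metis
  have smooth_edges: "smooth_simplex A 1 e \<and> l e = frag_of e \<and> M e = 0"
    if e: "e \<in> Poly_Mapping.keys (chain_boundary 2 D)" for e
  proof -
    have "smooth_simplex A 1 e"
      using bd e by (auto simp: chains_def simplices_def)
    moreover have "\<exists>s\<in>?K. e \<in> Poly_Mapping.keys (chain_boundary 2 (frag_of s))"
      using e keys_frag_extend[of "\<lambda>s. chain_boundary 2 (frag_of s)" D]
      by (subst (asm) chain_boundary_as_extend) blast
    ultimately show ?thesis
      using edge lM by blast
  qed
  have ext: "frag_extend (\<lambda>s. frag_extend f (chain_boundary 2 (frag_of s))) D = frag_extend f (chain_boundary 2 D)"
    for f :: "((nat \<Rightarrow> real) \<Rightarrow> 'a) \<Rightarrow> 'a chain"
    unfolding frag_extend_extend[symmetric] chain_boundary_as_extend[symmetric] ..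
  show thesis
  proof
    show "frag_extend S D \<in> chains A Smooth 2"
      unfolding chains_eq_within using SE chains_within_mono[OF subset_UNIV] by (metis chains_within_extend)
    have "chain_boundary 2 (frag_extend S D) = frag_extend l (chain_boundary 2 D)"
      unfolding ext[symmetric] chain_boundary_extend by (rule frag_extend_eq) (use SE in auto)
    also have "\<dots> = frag_extend frag_of (chain_boundary 2 D)"
      by (rule frag_extend_eq) (use smooth_edges in auto)
    finally show "chain_boundary 2 (frag_extend S D) = chain_boundary 2 D"
      by (simp add: frag_extend_of_id)
    show "singular_chain 3 euclidean (frag_extend E D)"
      using SE by (intro singular_chain_extend) auto
    have "chain_boundary 3 (frag_extend E D) =
        frag_extend (\<lambda>s. frag_of s - frag_extend M (chain_boundary 2 (frag_of s)) - S s) D"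
      unfolding chain_boundary_extend by (rule frag_extend_eq) (use SE in auto)
    also have "\<dots> = D - frag_extend M (chain_boundary 2 D) - frag_extend S D"
      by (simp add: frag_extend_diff_fun frag_extend_of_id ext)
    \<comment> \<open>The homologies of interior edges have cancelled in the sum over
      \<open>D\<close>; those of the boundary edges are zero by choice.\<close>
    also have "frag_extend M (chain_boundary 2 D) = 0"
      by (rule frag_extend_eq_0) (use smooth_edges in auto)
    finally show "chain_boundary 3 (frag_extend E D) = D - frag_extend S D"
      by simp
  qed
qed

lemma chart_ball_cover:
  assumes A: "smooth_atlas A"
  shows "\<And>B. B \<in> {B. chart_ball A B} \<Longrightarrow> openin euclidean B" "topspace euclidean \<subseteq> \<Union>{B. chart_ball A B}"
proof -
  show "\<And>B. B \<in> {B. chart_ball A B} \<Longrightarrow> openin euclidean B"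
    using chart_ball_open[OF A] by simp
  show "topspace euclidean \<subseteq> \<Union>{B. chart_ball A B}"
  proof
    fix x :: 'a
    obtain B where "chart_ball A B" "x \<in> B" "B \<subseteq> UNIV"
      by (rule chart_ball_neighbourhood[OF A open_UNIV UNIV_I])
    then show "x \<in> \<Union>{B. chart_ball A B}" by blast
  qed
qed

text \<open>A zero boundary is trivially smooth, so the smoothing of small chains applies to a small
  cycle in the class of \<open>z\<close>.\<close>

lemma cycle_homologous_smooth:
  assumes A: "smooth_atlas A" and z: "singular_chain 2 euclidean z" "chain_boundary 2 z = 0"
  obtains z' E where "z' \<in> chains A Smooth 2" "chain_boundary 2 z' = 0"
    "singular_chain 3 euclidean E" "chain_boundary 3 E = z - z'"
proof -
  have zc: "singular_relcycle 2 euclidean {} z"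
    using z by (simp add: singular_cycle)
  obtain c where c: "singular_relcycle 2 euclidean {} c" "homologous_rel 2 euclidean {} z c"
    and small: "\<forall>f\<in>Poly_Mapping.keys c. \<exists>V\<in>{B. chart_ball A B}. f \<in> standard_simplex 2 \<rightarrow> V"
  proof (rule small_homologous_rel_relcycle_exists[OF chart_ball_cover[OF A] zc])
    fix c' assume "singular_relcycle 2 euclidean {} c'" "homologous_rel 2 euclidean {} z c'"
      "\<And>f. f \<in> Poly_Mapping.keys c' \<Longrightarrow> \<exists>V\<in>{B. chart_ball A B}. f \<in> standard_simplex 2 \<rightarrow> V"
    then show thesis by (intro that[of c']) auto
  qed
  have c': "singular_chain 2 euclidean c" "chain_boundary 2 c = 0"
    using c(1) by (simp_all add: singular_cycle)
  have "\<exists>B. chart_ball A B \<and> s ` standard_simplex 2 \<subseteq> B" if "s \<in> Poly_Mapping.keys c" for s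
    using small that by (metis image_subset_iff_funcset mem_Collect_eq)
  moreover have "chain_boundary 2 c \<in> chains A Smooth 1"
    by (simp add: c' chains_eq_within)
  ultimately obtain D' E where D': "D' \<in> chains A Smooth 2" "chain_boundary 2 D' = chain_boundary 2 c"
    "singular_chain 3 euclidean E" "chain_boundary 3 E = c - D'"
    using small_chain_smoothing[OF A c'(1)] by metis
  obtain d where d: "singular_chain 3 euclidean d" "chain_boundary 3 d = z - c"
    using c(2) unfolding homologous_rel_def singular_boundary by (auto simp: numeral_3_eq_3 numeral_2_eq_2)
  show thesis
  proof
    show "singular_chain 3 euclidean (d + E)" "chain_boundary 3 (d + E) = z - D'"
      using d D' by (auto intro: singular_chain_add simp: chain_boundary_add)
  qed (use D' c' in auto)
qed

section \<open>Subdivision in the smooth complex\<close>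

lemma smooth_simplicial_composite:
  assumes A: "smooth_atlas A" and s: "smooth_simplex A p s"
    and t: "simplicial_simplex q (standard_simplex p) t"
  shows "smooth_simplex A q (simplex_map q s t)"
proof -
  obtain l where l: "t = oriented_simplex q l"
    using t simplicial_simplex by blast
  let ?\<tau> = "\<lambda>x i. \<Sum>j\<le>q. l j i * x j"
  have im: "?\<tau> ` standard_simplex q \<subseteq> standard_simplex p"
    using t unfolding l simplicial_simplex_oriented_simplex .
  \<comment> \<open>Each \<open>l j\<close> is the image of a vertex, so it lies in a standard
    simplex and has finite support.\<close>
  have fin: "finite {m. l j m \<noteq> 0}" if "j \<le> q" for j
  proof -
    have "?\<tau> (vertex j) \<in> standard_simplex p"
      using im that by (auto simp del: sum.atMost_Suc)
    moreover have "?\<tau> (vertex j) = l j"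
      using that by (simp add: fun_eq_iff if_distrib cong: if_cong)
    ultimately have "l j \<in> standard_simplex p"
      by simp
    then have "{m. l j m \<noteq> 0} \<subseteq> {..p}"
      by (auto simp: standard_simplex_def) (metis not_le)
    then show ?thesis
      by (rule finite_subset) simp
  qed
  have "simplex_map q s t = restrict (s \<circ> ?\<tau>) (standard_simplex q)"
    by (auto simp: simplex_map_def l oriented_simplex_def fun_eq_iff)
  then show ?thesis
    using smooth_simplex_affine[OF A s coord_affine_combination[OF fin] im] by simp
qed

lemma smooth_chain_map_simplicial:
  assumes A: "smooth_atlas A" and s: "smooth_simplex A p s"
    and c: "simplicial_chain q (standard_simplex p) c"
  shows "chain_map q s c \<in> chains A Smooth q"
  unfolding chain_map_def chains_eq_within
  by (rule chains_within_extend)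
     (use c smooth_simplicial_composite[OF A s] in \<open>auto simp: simplicial_chain_def simplices_def\<close>)

text \<open>On an edge \<open>e\<close>, the subdivision and its homotopy to the identity are images
  under \<open>e\<close> of fixed chains of affine simplices in the standard 1-simplex. Hence both
  are smooth along with \<open>e\<close>.\<close>

lemma smooth_subdivision_homologous:
  fixes A :: "('a::topological_space, 'e::euclidean_space) chart set"
  assumes A: "smooth_atlas A" and c: "c \<in> chains A Smooth 1"
  shows "singular_subdivision 1 c \<in> chains A Smooth 1"
    "\<exists>J\<in>chains A Smooth 2. chain_boundary 2 J = singular_subdivision 1 c - c"
proof -
  let ?id = "frag_of (restrict id (standard_simplex 1))"
  let ?sub = "simplicial_subdivision 1 ?id"
  have id: "simplicial_chain 1 (standard_simplex 1) ?id"
    by (simp del: One_nat_def)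
  have e: "smooth_simplex A 1 e" if "e \<in> Poly_Mapping.keys c" for e
    using c that by (auto simp: chains_def simplices_def)
  show "singular_subdivision 1 c \<in> chains A Smooth 1"
    unfolding singular_subdivision_def chains_eq_within
    using smooth_chain_map_simplicial[OF A e simplicial_chain_simplicial_subdivision[OF id]]
    by (intro chains_within_extend) (simp add: chains_eq_within)
  define J where "J = frag_extend (\<lambda>e. chain_map 2 e (subd 1 ?id)) c"
  have sub2: "simplicial_chain 2 (standard_simplex 1) (subd 1 ?id)"
    using chain_homotopic_simplicial_subdivision2[OF id] by (simp add: numeral_2_eq_2)
  have "chain_boundary 2 (subd 1 ?id) = ?sub - ?id"
    using chain_homotopic_simplicial_subdivision3[OF id] by (simp add: numeral_2_eq_2)
  then have "chain_boundary 2 (chain_map 2 e (subd 1 ?id)) = chain_map 1 e ?sub - frag_of e"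
    if "e \<in> Poly_Mapping.keys c" for e
    using chain_boundary_chain_map[OF simplicial_imp_singular_chain[OF sub2], of e]
      singular_simplex_chain_map_id[OF smooth_simplex_singular[OF e[OF that]]]
    by (simp add: chain_map_diff)
  then have "chain_boundary 2 J = frag_extend (\<lambda>e. chain_map 1 e ?sub - frag_of e) c"
    unfolding J_def chain_boundary_extend by (intro frag_extend_eq) auto
  also have "\<dots> = singular_subdivision 1 c - c"
    by (simp add: singular_subdivision_def frag_extend_diff_fun frag_extend_of_id)
  finally have "chain_boundary 2 J = singular_subdivision 1 c - c" .
  moreover have "J \<in> chains A Smooth 2"
    unfolding J_def chains_eq_within
    using smooth_chain_map_simplicial[OF A e sub2] by (intro chains_within_extend) (simp add: chains_eq_within)
  ultimately show "\<exists>J\<in>chains A Smooth 2. chain_boundary 2 J = singular_subdivision 1 c - c"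
    by blast
qed

lemma smooth_iterated_subdivision_homologous:
  assumes A: "smooth_atlas A" and c: "c \<in> chains A Smooth 1"
  shows "(singular_subdivision 1 ^^ n) c \<in> chains A Smooth 1 \<and>
    (\<exists>J\<in>chains A Smooth 2. chain_boundary 2 J = (singular_subdivision 1 ^^ n) c - c)"
proof (induction n)
  case 0
  show ?case
    using c by (auto simp: chains_eq_within intro!: bexI[of _ 0])
next
  case (Suc n)
  then obtain J where J: "J \<in> chains A Smooth 2" "chain_boundary 2 J = (singular_subdivision 1 ^^ n) c - c"
    by blast
  obtain J' where J': "J' \<in> chains A Smooth 2" "chain_boundary 2 J' =
      (singular_subdivision 1 ^^ Suc n) c - (singular_subdivision 1 ^^ n) c"
    using smooth_subdivision_homologous(2)[OF A, of "(singular_subdivision 1 ^^ n) c"] Suc by auto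
  have "J + J' \<in> chains A Smooth 2" "chain_boundary 2 (J + J') = (singular_subdivision 1 ^^ Suc n) c - c"
    using J J' by (auto simp: chains_eq_within chain_boundary_add intro: chains_within_add)
  then show ?case
    using smooth_subdivision_homologous(1)[OF A] Suc by (metis comp_apply funpow.simps(2))
qed

section \<open>First homology of simply connected manifolds\<close>

lemma const_simplex_singular: "singular_simplex p euclidean (const_simplex p a)"
  by (simp add: singular_simplex_euclidean cong: continuous_on_cong)

text \<open>Triangles that factor through an interval supply the homologies between paths, their
  concatenations and their reversals.\<close>

lemma triangle_of_path:
  assumes "path \<gamma>" and f: "continuous_on UNIV f" "f ` standard_simplex 2 \<subseteq> {0..1}"
  shows "singular_chain 2 euclidean (frag_of (restrict (\<lambda>u. \<gamma> (f u)) (standard_simplex 2)))"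
  using continuous_on_compose2[OF _ continuous_on_subset[OF f(1)] f(2), of \<gamma>] assms(1)
  by (simp add: path_def singular_chain_of singular_simplex_euclidean cong: continuous_on_cong)

lemma boundary_join:
  assumes "path p" "path q" "pathfinish p = pathstart q"
  obtains T where "singular_chain 2 euclidean T" "chain_boundary 2 T =
    frag_of (path_simplex p) + frag_of (path_simplex q) - frag_of (path_simplex (p +++ q))"
proof
  \<comment> \<open>The values at the vertices are 0, 1/2, 1: faces 0, 1, 2 run through the second
    half, the whole and the first half of \<open>p +++ q\<close>.\<close>
  let ?f = "\<lambda>u :: nat \<Rightarrow> real. u 1 / 2 + u 2"
  have "?f ` standard_simplex 2 \<subseteq> {0..1}"
  proof
    fix y assume "y \<in> ?f ` standard_simplex 2"
    then obtain u where u: "u \<in> standard_simplex 2" "y = ?f u" by blast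
    show "y \<in> {0..1}" using standard_simplex_2D[OF u(1)] u(2) by simp
  qed
  moreover have "continuous_on UNIV ?f"
    by (intro continuous_intros continuous_on_product_coordinates) simp
  ultimately show "singular_chain 2 euclidean (frag_of (restrict (\<lambda>u. (p +++ q) (?f u)) (standard_simplex 2)))"
    using assms by (intro triangle_of_path) auto
  have face0: "(p +++ q) (?f (simplical_face 0 x)) = q (x 1)"
    and face1: "?f (simplical_face 1 x) = x 1"
    and face2: "(p +++ q) (?f (simplical_face 2 x)) = p (x 1)" if "x \<in> standard_simplex 1" for x
  proof -
    have *: "?f (simplical_face 0 x) = (1 + x 1) / 2" "?f (simplical_face 2 x) = x 1 / 2"
      using standard_simplex_1D[OF that] by (simp_all add: simplical_face_def field_simps)
    show "?f (simplical_face 1 x) = x 1"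
      by (simp add: simplical_face_def)
    show "(p +++ q) (?f (simplical_face 2 x)) = p (x 1)"
      unfolding * using standard_simplex_1D[OF that] by (simp add: joinpaths_def)
    \<comment> \<open>At the midpoint \<open>+++\<close> evaluates \<open>p\<close>, so the first
      point of face 0 needs the matching of endpoints.\<close>
    have "q (x 1) = p 1" if "x 1 = 0"
      using that assms(3) by (simp add: pathfinish_def pathstart_def)
    then show "(p +++ q) (?f (simplical_face 0 x)) = q (x 1)"
      unfolding * using standard_simplex_1D[OF that] by (auto simp: joinpaths_def field_simps)
  qed
  show "chain_boundary 2 (frag_of (restrict (\<lambda>u. (p +++ q) (?f u)) (standard_simplex 2))) =
    frag_of (path_simplex p) + frag_of (path_simplex q) - frag_of (path_simplex (p +++ q))"
    unfolding chain_boundary_restrict_triangle path_simplex_def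
    by (simp add: face0 face1 face2 del: One_nat_def cong: restrict_cong)
qed

lemma boundary_reverse:
  assumes "path p"
  obtains T where "singular_chain 2 euclidean T" "chain_boundary 2 T =
    frag_of (path_simplex p) + frag_of (path_simplex (reversepath p))"
proof
  \<comment> \<open>\<open>u 1\<close> takes the values 0, 1, 0 at the vertices: face 0 is the
    reversed path, face 2 the path itself, and face 1 is constant and calls for the extra constant
    triangle.\<close>
  let ?T = "frag_of (restrict (\<lambda>u. p (u 1)) (standard_simplex 2))"
  have "(\<lambda>u. u 1) ` standard_simplex 2 \<subseteq> {0..1::real}"
    by (auto simp: standard_simplex_def simp del: One_nat_def)
  then have "singular_chain 2 euclidean ?T"
    using assms by (intro triangle_of_path continuous_on_product_coordinates) auto
  then show "singular_chain 2 euclidean (?T + frag_of (const_simplex 2 (p 0)))"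
    using const_simplex_singular by (intro singular_chain_add) (simp_all add: singular_chain_of)
  have "p (simplical_face 0 x 1) = reversepath p (x 1)" "simplical_face 1 x 1 = 0" "simplical_face 2 x 1 = x 1"
    if "x \<in> standard_simplex 1" for x :: "nat \<Rightarrow> real"
    using standard_simplex_1D[OF that] by (simp_all add: simplical_face_def reversepath_def)
  then show "chain_boundary 2 (?T + frag_of (const_simplex 2 (p 0))) =
      frag_of (path_simplex p) + frag_of (path_simplex (reversepath p))"
    unfolding chain_boundary_add chain_boundary_const_2 chain_boundary_restrict_triangle path_simplex_def
    by (simp del: One_nat_def cong: restrict_cong)
qed

text \<open>In a homotopy through loops the two sides traced by the endpoints coincide and cancel;
  the far side is constant.\<close>

lemma boundary_loop:
  assumes sc: "simply_connected (UNIV :: 'a::topological_space set)"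
    and p: "path p" "pathfinish p = (pathstart p :: 'a)"
  obtains T where "singular_chain 2 euclidean T" "chain_boundary 2 T = frag_of (path_simplex p)"
proof -
  have "path (\<lambda>_. pathstart p)" "pathfinish (\<lambda>_. pathstart p) = pathstart (\<lambda>_. pathstart p)"
    by (auto simp: path_def pathfinish_def pathstart_def)
  then have "homotopic_loops UNIV p (\<lambda>_. pathstart p)"
    using sc p unfolding simply_connected_def by blast
  then obtain h where h: "continuous_on ({0..1} \<times> {0..1}) h" "\<forall>x\<in>{0..1}. h (0, x) = p x"
    "\<forall>x\<in>{0..1}. h (1, x) = pathstart p" "\<forall>t\<in>{0..1::real}. h (t, 1) = h (t, 0)"
    unfolding homotopic_loops by (auto simp: pathfinish_def pathstart_def)
  define H where "H s x = h (s, x 1)" for s :: real and x :: "nat \<Rightarrow> real"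
  have x01: "x 1 \<in> {0..1}" if "x \<in> standard_simplex 1" for x
    using standard_simplex_1D[OF that] by simp
  show thesis
  proof
    have "continuous_on ({0..1} \<times> standard_simplex 1) (\<lambda>z. (fst z, snd z 1 :: real))"
      by (intro continuous_on_Pair continuous_intros
          continuous_on_compose2[OF continuous_on_product_coordinates continuous_on_snd[OF continuous_on_id]]) auto
    then have "continuous_on ({0..1} \<times> standard_simplex 1) (\<lambda>z. H (fst z) (snd z))"
      unfolding H_def by (rule continuous_on_compose2[OF h(1)]) (use x01 in auto)
    then show "singular_chain 2 euclidean (square_chain H + frag_of (const_simplex 2 (pathstart p)))"
      using square_chain_continuous const_simplex_singular
      by (intro singular_chain_add) (auto simp: singular_chain_of)
    show "chain_boundary 2 (square_chain H + frag_of (const_simplex 2 (pathstart p))) = frag_of (path_simplex p)"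
      unfolding chain_boundary_add chain_boundary_square chain_boundary_const_2 path_simplex_def
      using h x01 by (simp add: H_def[abs_def] del: One_nat_def cong: restrict_cong)
  qed
qed

lemma path_simplex_of_simplex:
  assumes "singular_simplex 1 euclidean e"
  obtains \<gamma> where "path \<gamma>" "pathstart \<gamma> = e (vertex 0)" "pathfinish \<gamma> = e (vertex 1)" "path_simplex \<gamma> = e"
proof
  let ?f = "\<lambda>t i. if i = (0::nat) then 1 - t else if i = 1 then t else (0::real)"
  have "continuous_on {0..1} ?f"
  proof (rule continuous_on_coordinatewise_then_product)
    fix i show "continuous_on {0..1} (\<lambda>t. ?f t i)"
      by (cases "i = 0"; cases "i = 1") (auto intro!: continuous_intros)
  qed
  moreover have "?f ` {0..1} \<subseteq> standard_simplex 1"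
    by (auto intro!: standard_simplex_1I simp del: One_nat_def)
  ultimately show "path (\<lambda>t. e (?f t))"
    using assms continuous_on_compose2 unfolding singular_simplex_euclidean path_def by blast
  have "?f 0 = vertex 0" "?f 1 = vertex 1"
    by auto
  then show "pathstart (\<lambda>t. e (?f t)) = e (vertex 0)" "pathfinish (\<lambda>t. e (?f t)) = e (vertex 1)"
    by (simp_all add: pathstart_def pathfinish_def)
  have "?f (x 1) = x" if "x \<in> standard_simplex 1" for x
    using standard_simplex_1D[OF that] by auto
  then show "path_simplex (\<lambda>t. e (?f t)) = e"
    using assms by (auto simp: path_simplex_def singular_simplex_def extensional_def fun_eq_iff simp del: One_nat_def)
qed

text \<open>The easy half of the Hurewicz theorem: chosen paths from \<open>a\<close> complete every
  edge to a loop, the loop bounds, and the chosen paths cancel along a cycle.\<close>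

lemma simply_connected_cycle_boundary:
  assumes sc: "simply_connected (UNIV :: 'a::topological_space set)"
    and z: "singular_chain 1 euclidean (z :: 'a chain)" "chain_boundary 1 z = 0"
  obtains D where "singular_chain 2 euclidean D" "chain_boundary 2 D = z"
proof -
  obtain a :: 'a where True by blast
  have "\<exists>\<gamma>. path \<gamma> \<and> pathstart \<gamma> = a \<and> pathfinish \<gamma> = x" for x
  proof -
    \<comment> \<open>Simple connectedness is phrased as free homotopy of any two loops, so two
      constant loops already give a path between their points.\<close>
    have "homotopic_loops UNIV (\<lambda>_. a) (\<lambda>_. x)"
      using sc unfolding simply_connected_def by (auto simp: path_def pathfinish_def pathstart_def)
    then obtain h where h: "continuous_on ({0..1::real} \<times> {0..1::real}) h"
      "\<forall>x\<in>{0..1}. h (0, x) = a" "\<forall>y\<in>{0..1}. h (1, y) = x"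
      unfolding homotopic_loops by auto
    have "path (\<lambda>t. h (t, 0))"
      unfolding path_def by (rule continuous_on_compose2[OF h(1)]) (auto intro!: continuous_intros)
    then show ?thesis
      using h by (intro exI[of _ "\<lambda>t. h (t, 0)"]) (simp add: pathstart_def pathfinish_def)
  qed
  then obtain \<gamma> where \<gamma>: "\<And>x. path (\<gamma> x) \<and> pathstart (\<gamma> x) = a \<and> pathfinish (\<gamma> x) = x"
    by metis
  let ?g = "\<lambda>x. frag_of (path_simplex (\<gamma> x))"
  have "\<exists>K. singular_chain 2 euclidean K \<and>
      chain_boundary 2 K = frag_of e - (?g (e (vertex 1)) - ?g (e (vertex 0)))"
    if e: "e \<in> Poly_Mapping.keys z" for e
  proof -
    have "singular_simplex 1 euclidean e"
      using z e by (auto simp: singular_chain_def)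
    then obtain \<epsilon> where \<epsilon>: "path \<epsilon>" "pathstart \<epsilon> = e (vertex 0)" "pathfinish \<epsilon> = e (vertex 1)" "path_simplex \<epsilon> = e"
      by (rule path_simplex_of_simplex)
    let ?p = "\<gamma> (e (vertex 0))" and ?q = "\<gamma> (e (vertex 1))"
    have pe: "path (?p +++ \<epsilon>)" "pathstart (?p +++ \<epsilon>) = a" "pathfinish (?p +++ \<epsilon>) = e (vertex 1)"
      using \<gamma> \<epsilon> by auto
    obtain T1 where T1: "singular_chain 2 euclidean T1" "chain_boundary 2 T1 =
        ?g (e (vertex 0)) + frag_of e - frag_of (path_simplex (?p +++ \<epsilon>))"
      using boundary_join[of ?p \<epsilon>] \<gamma> \<epsilon> by metis
    obtain T2 where T2: "singular_chain 2 euclidean T2" "chain_boundary 2 T2 =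
        frag_of (path_simplex (?p +++ \<epsilon>)) + frag_of (path_simplex (reversepath ?q))
          - frag_of (path_simplex ((?p +++ \<epsilon>) +++ reversepath ?q))"
      using boundary_join[of "?p +++ \<epsilon>" "reversepath ?q"] pe \<gamma> by (metis path_reversepath pathstart_reversepath)
    obtain T3 where T3: "singular_chain 2 euclidean T3" "chain_boundary 2 T3 =
        ?g (e (vertex 1)) + frag_of (path_simplex (reversepath ?q))"
      using boundary_reverse[of ?q] \<gamma> by metis
    have "path ((?p +++ \<epsilon>) +++ reversepath ?q)"
      "pathfinish ((?p +++ \<epsilon>) +++ reversepath ?q) = pathstart ((?p +++ \<epsilon>) +++ reversepath ?q)"
      using pe \<gamma> by auto
    then obtain T4 where T4: "singular_chain 2 euclidean T4" "chain_boundary 2 T4 =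
        frag_of (path_simplex ((?p +++ \<epsilon>) +++ reversepath ?q))"
      by (rule boundary_loop[OF sc])
    \<comment> \<open>In this combination both concatenations and the reversed path cancel.\<close>
    have "singular_chain 2 euclidean (T1 + T2 - T3 + T4)"
      by (intro singular_chain_add singular_chain_diff T1 T2 T3 T4)
    moreover have "chain_boundary 2 (T1 + T2 - T3 + T4) = frag_of e - (?g (e (vertex 1)) - ?g (e (vertex 0)))"
      unfolding chain_boundary_add chain_boundary_diff T1 T2 T3 T4 by simp
    ultimately show ?thesis by blast
  qed
  then obtain K where K: "\<And>e. e \<in> Poly_Mapping.keys z \<Longrightarrow> singular_chain 2 euclidean (K e) \<and>
      chain_boundary 2 (K e) = frag_of e - (?g (e (vertex 1)) - ?g (e (vertex 0)))"
    by metis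
  show thesis
  proof
    show "singular_chain 2 euclidean (frag_extend K z)"
      using K by (intro singular_chain_extend) auto
    show "chain_boundary 2 (frag_extend K z) = z"
      by (rule boundary_of_cycle_filling[OF z(2), where g = ?g]) (use K in auto)
  qed
qed

text \<open>In the smooth case a continuous filling is subdivided until it is small. Its boundary is
  then a subdivision of \<open>z\<close>, which is smooth and so survives the smoothing of the
  filling; \<open>J\<close> leads back to \<open>z\<close> through smooth triangles.\<close>

lemma one_cycle_boundary:
  fixes A :: "('a::topological_space, 'e::euclidean_space) chart set"
  assumes A: "smooth_atlas A" and sc: "simply_connected (UNIV :: 'a set)"
    and z: "z \<in> chains A r 1" "chain_boundary 1 z = 0"
  shows "\<exists>K\<in>chains A r 2. chain_boundary 2 K = z"
proof -
  have "singular_chain 1 euclidean z"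
    using z(1) chains_within_continuous[of z A r 1 UNIV] by (simp add: chains_eq_within)
  then obtain D where D: "singular_chain 2 euclidean D" "chain_boundary 2 D = z"
    using simply_connected_cycle_boundary[OF sc _ z(2)] by metis
  show ?thesis
  proof (cases r)
    case Continuous
    then show ?thesis
      using D chains_within_Continuous[of D A 2 UNIV] by (auto simp: chains_eq_within)
  next
    case Smooth
    obtain n where n: "\<forall>f\<in>Poly_Mapping.keys ((singular_subdivision 2 ^^ n) D).
        \<exists>V\<in>{B. chart_ball A B}. f \<in> standard_simplex 2 \<rightarrow> V"
      using small_iterated_subdivision[OF chart_ball_cover[OF A] D(1)] by blast
    have sub: "singular_chain 2 euclidean ((singular_subdivision 2 ^^ m) D) \<and>
        chain_boundary 2 ((singular_subdivision 2 ^^ m) D) = (singular_subdivision 1 ^^ m) z" for m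
      by (induction m) (use D in \<open>auto simp: singular_chain_singular_subdivision chain_boundary_singular_subdivision\<close>)
    obtain J where J: "J \<in> chains A Smooth 2" "chain_boundary 2 J = (singular_subdivision 1 ^^ n) z - z"
      and zn: "(singular_subdivision 1 ^^ n) z \<in> chains A Smooth 1"
      using smooth_iterated_subdivision_homologous[OF A] z(1) Smooth by blast
    have "\<exists>B. chart_ball A B \<and> s ` standard_simplex 2 \<subseteq> B"
      if "s \<in> Poly_Mapping.keys ((singular_subdivision 2 ^^ n) D)" for s
      using n that by (metis image_subset_iff_funcset mem_Collect_eq)
    then obtain D' where D': "D' \<in> chains A Smooth 2" "chain_boundary 2 D' = (singular_subdivision 1 ^^ n) z"
      using small_chain_smoothing[OF A, of "(singular_subdivision 2 ^^ n) D"] sub zn by metis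
    have "D' - J \<in> chains A Smooth 2" "chain_boundary 2 (D' - J) = z"
      using J D' by (auto simp: chains_eq_within chain_boundary_diff intro: chains_within_diff)
    then show ?thesis
      using Smooth by blast
  qed
qed

section \<open>Cocycles on cycles\<close>

lemma pairing_superset:
  assumes "finite K" "Poly_Mapping.keys c \<subseteq> K"
  shows "pairing w c = (\<Sum>s\<in>K. of_int (Poly_Mapping.lookup c s) * w s)"
  unfolding pairing_def by (rule sum.mono_neutral_left) (use assms in \<open>auto simp: in_keys_iff\<close>)

lemma pairing_diff: "pairing w (a - b) = pairing w a - pairing w b"
proof -
  let ?K = "Poly_Mapping.keys a \<union> Poly_Mapping.keys b"
  have "Poly_Mapping.keys (a - b) \<subseteq> ?K"
    by (rule keys_diff)
  then show ?thesis
    by (simp add: pairing_superset[of ?K] lookup_minus left_diff_distrib sum_subtractf)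
qed

lemma pairing_0 [simp]: "pairing w 0 = 0"
  by (simp add: pairing_def)

lemma pairing_add: "pairing w (a + b) = pairing w a + pairing w b"
  using pairing_diff[of w "a + b" b] by simp

lemma pairing_of [simp]: "pairing w (frag_of s) = w s"
  by (simp add: pairing_def keys_frag_of)

lemma pairing_extend: "pairing w (frag_extend f c) = pairing (\<lambda>s. pairing w (f s)) c"
  using subset_UNIV
  by (induction c rule: frag_induction) (auto simp: frag_extend_diff pairing_diff)

lemma pairing_fun_diff: "pairing (\<lambda>s. v s - w s) c = pairing v c - pairing w c"
  by (simp add: pairing_def right_diff_distrib sum_subtractf)

lemma pairing_fun_add: "pairing (\<lambda>s. v s + w s) c = pairing v c + pairing w c"
  by (simp add: pairing_def distrib_left sum.distrib)

lemma pairing_cong: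
  "(\<And>s. s \<in> Poly_Mapping.keys c \<Longrightarrow> v s = w s) \<Longrightarrow> pairing v c = pairing w c"
  by (simp add: pairing_def)

lemma pairing_chain_map: "pairing w (chain_map p f c) = pairing (pullback p f w) c"
  unfolding chain_map_def pairing_extend by (simp add: pullback_def[abs_def])

lemma pairing_boundary: "pairing w (chain_boundary p c) = pairing (\<lambda>s. pairing w (chain_boundary p (frag_of s))) c"
  by (subst chain_boundary_as_extend) (simp add: pairing_extend)

lemma of_int_pairing: "real_of_int (pairing w c) = pairing (\<lambda>s. real_of_int (w s)) c"
  by (simp add: pairing_def)

lemma chain_map_chains:
  assumes A: "smooth_atlas A" and f: "smooth_map A f" and c: "c \<in> chains A r p"
  shows "chain_map p f c \<in> chains A r p"
  unfolding chain_map_def chains_eq_within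
proof (rule chains_within_extend)
  fix s assume "s \<in> Poly_Mapping.keys c"
  then have "s \<in> simplices A r p"
    using c by (auto simp: chains_def)
  then have "simplex_map p f s \<in> simplices A r p"
    using smooth_simplex_map[OF A _ f] singular_simplex_simplex_map[of p euclidean s euclidean f]
      smooth_map_continuous[OF f] by (auto simp: simplices_def split: regularity.splits)
  then show "(frag_of \<circ> simplex_map p f) s \<in> chains_within A r p UNIV"
    by simp
qed

lemma chains_singular: "c \<in> chains A r p \<Longrightarrow> singular_chain p euclidean c"
  using chains_within_continuous[of c A r p UNIV] by (simp add: chains_eq_within)

lemma chain_boundary_map:
  "singular_chain (Suc p) euclidean c \<Longrightarrow>
    chain_boundary (Suc p) (chain_map (Suc p) f c) = chain_map p f (chain_boundary (Suc p) c)"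
  using chain_boundary_chain_map[of "Suc p" euclidean c f] by simp

text \<open>The correction \<eta> is evaluated on the boundary of \<open>z\<close>, so integration
  alone remains.\<close>

lemma class_on_smooth_cycle:
  assumes "represents_integral_class A \<omega> r w" "z \<in> chains A Smooth 2" "chain_boundary 2 z = 0"
  shows "real_of_int (pairing w z) = pairing (form_integral A \<omega>) z"
proof -
  obtain \<eta> where \<eta>: "\<And>s. s \<in> simplices A Smooth 2 \<Longrightarrow>
      real_of_int (w s) = form_integral A \<omega> s + pairing \<eta> (chain_boundary 2 (frag_of s))"
    using assms(1) unfolding represents_integral_class_def by blast
  have "real_of_int (pairing w z) =
      pairing (\<lambda>s. form_integral A \<omega> s + pairing \<eta> (chain_boundary 2 (frag_of s))) z"
    unfolding of_int_pairing by (rule pairing_cong) (use assms(2) \<eta> in \<open>auto simp: chains_def\<close>)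
  then show ?thesis
    using pairing_boundary[of \<eta> 2 z] assms(3) by (simp add: pairing_fun_add)
qed

lemma form_integral_chain_map:
  assumes A: "smooth_atlas A" and f: "f \<in> carrier (Symp A \<omega>)" and z: "z \<in> chains A Smooth 2"
  shows "pairing (form_integral A \<omega>) (chain_map 2 f z) = pairing (form_integral A \<omega>) z"
  unfolding pairing_chain_map
  by (rule pairing_cong)
     (use z form_integral_simplex_map[OF A _ Symp_smooth[OF f]] f
       in \<open>auto simp: pullback_def chains_def simplices_def Symp_carrier\<close>)

text \<open>\<open>z'\<close> is chosen before \<open>w\<close>, so that two representatives can be
  compared on the same smooth cycle. The last clause holds because \<open>f\<close> maps a chain
  bounding the difference of the cycles to one bounding the difference of their images.\<close>

lemma smooth_representative:
  assumes A: "smooth_atlas A" and z: "z \<in> chains A r 2" "chain_boundary 2 z = 0"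
  obtains z' where "z' \<in> chains A Smooth 2" "chain_boundary 2 z' = 0"
    "\<And>\<omega> w. represents_integral_class A \<omega> r w \<Longrightarrow> pairing w z' = pairing w z"
    "\<And>\<omega> w f. represents_integral_class A \<omega> r w \<Longrightarrow> continuous_on UNIV f \<Longrightarrow>
      pairing w (chain_map 2 f z') = pairing w (chain_map 2 f z)"
proof (cases r)
  case Smooth
  then show ?thesis
    using z that by blast
next
  case Continuous
  obtain z' E where z': "z' \<in> chains A Smooth 2" "chain_boundary 2 z' = 0"
    and E: "singular_chain 3 euclidean E" "chain_boundary 3 E = z - z'"
    by (rule cycle_homologous_smooth[OF A chains_singular[OF z(1)] z(2)])
  have van: "pairing w (chain_boundary 3 F) = 0"
    if "represents_integral_class A \<omega> r w" "singular_chain 3 euclidean F" for F w \<omega>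
  proof -
    have "pairing w (chain_boundary 3 F) = pairing (\<lambda>_. 0) F"
      by (subst pairing_boundary, rule pairing_cong)
         (use that Continuous in \<open>auto simp: represents_integral_class_def simplices_def singular_chain_def\<close>)
    then show ?thesis
      by (simp add: pairing_def)
  qed
  have "chain_boundary 3 (chain_map 3 f E) = chain_map 2 f z - chain_map 2 f z'" for f
    using chain_boundary_map[of 2 E f] E by (simp add: chain_map_diff)
  moreover have "singular_chain 3 euclidean (chain_map 3 f E)" if "continuous_on UNIV f" for f
    by (rule singular_chain_chain_map[OF E(1)]) (use that in simp)
  ultimately show ?thesis
    using that[OF z'] van van[OF _ E(1)] E(2) by (metis eq_iff_diff_eq_0 pairing_diff)
qed

text \<open>On a smooth representative of the cycle both integers equal the same real
  integral.\<close>

lemma cycle_independent: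
  assumes A: "smooth_atlas A" and z: "z \<in> chains A r 2" "chain_boundary 2 z = 0"
    and w: "represents_integral_class A \<omega> r w" "represents_integral_class A \<omega> r w'"
  shows "pairing w z = pairing w' z"
proof -
  obtain z' where z': "z' \<in> chains A Smooth 2" "chain_boundary 2 z' = 0"
    "\<And>\<omega> w. represents_integral_class A \<omega> r w \<Longrightarrow> pairing w z' = pairing w z"
    by (rule smooth_representative[OF A z]) blast
  have "real_of_int (pairing w z') = real_of_int (pairing w' z')"
    using class_on_smooth_cycle[OF w(1) z'(1,2)] class_on_smooth_cycle[OF w(2) z'(1,2)] by simp
  then show ?thesis
    using z'(3)[OF w(1)] z'(3)[OF w(2)] by simp
qed

text \<open>Pushing a smooth representative forward does not change the integral of \<omega>, which
  determines the value of \<open>w\<close> on both smooth cycles.\<close>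

lemma cycle_invariant:
  assumes A: "smooth_atlas A" and z: "z \<in> chains A r 2" "chain_boundary 2 z = 0"
    and w: "represents_integral_class A \<omega> r w" and f: "f \<in> carrier (Symp A \<omega>)"
  shows "pairing w (chain_map 2 f z) = pairing w z"
proof -
  obtain z' where z': "z' \<in> chains A Smooth 2" "chain_boundary 2 z' = 0"
    "\<And>\<omega> w. represents_integral_class A \<omega> r w \<Longrightarrow> pairing w z' = pairing w z"
    "\<And>\<omega> w f. represents_integral_class A \<omega> r w \<Longrightarrow> continuous_on UNIV f \<Longrightarrow>
      pairing w (chain_map 2 f z') = pairing w (chain_map 2 f z)"
    by (rule smooth_representative[OF A z]) blast
  have "chain_map 2 f z' \<in> chains A Smooth 2"
    by (rule chain_map_chains[OF A Symp_smooth[OF f] z'(1)])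
  moreover have "chain_boundary 2 (chain_map 2 f z') = 0"
    using chain_boundary_map[of 1 z' f] chains_singular[OF z'(1)] z'(2) by (simp add: numeral_2_eq_2)
  ultimately have "real_of_int (pairing w (chain_map 2 f z')) = real_of_int (pairing w z')"
    using class_on_smooth_cycle[OF w] z'(1,2) form_integral_chain_map[OF A f z'(1)] by metis
  then show ?thesis
    using z'(3)[OF w] z'(4)[OF w smooth_map_continuous[OF Symp_smooth[OF f]]] by simp
qed

section \<open>Group cohomology\<close>

lemma alt_sign_add: "alt_sign i (a + b) = alt_sign i a + alt_sign i b"
  by (simp add: alt_sign_def)

lemma grp_delta_add:
  "grp_delta G p (\<lambda>gs. a gs + b gs) = (\<lambda>gs. grp_delta G p a gs + grp_delta G p b gs)"
  by (auto simp: grp_delta_def fun_eq_iff alt_sign_add sum.distrib algebra_simps)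

lemma grp_delta_minus: "grp_delta G p (\<lambda>gs. - a gs) = (\<lambda>gs. - grp_delta G p a gs)"
proof -
  have "alt_sign i (- x) = - alt_sign i x" for i and x :: 'b
    by (simp add: alt_sign_def)
  then show ?thesis
    by (auto simp: grp_delta_def fun_eq_iff sum_negf algebra_simps)
qed

text \<open>Translation by the coboundary of \<open>b\<close> gives one inclusion of cosets,
  translation by that of \<open>- b\<close> the other.\<close>

lemma grp_class_eqI:
  assumes "b \<in> grp_cochains G p" "\<And>gs. c' gs = c gs + grp_delta G p b gs"
  shows "grp_class G (Suc p) c = grp_class G (Suc p) c'"
proof -
  have sub: "grp_class G (Suc p) c1 \<subseteq> grp_class G (Suc p) c2"
    if b: "b \<in> grp_cochains G p" and eq: "\<And>gs. c1 gs = c2 gs + grp_delta G p b gs" for b c1 c2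
  proof
    fix x assume "x \<in> grp_class G (Suc p) c1"
    then obtain a where a: "a \<in> grp_cochains G p" "x = (\<lambda>gs. grp_delta G p a gs + c1 gs)"
      by (auto simp: grp_class_def r_coset_def grp_coboundaries_def grp_cocycles_def)
    have "x = (\<lambda>gs. grp_delta G p (\<lambda>gs. a gs + b gs) gs + c2 gs)"
      by (simp add: a(2) eq grp_delta_add algebra_simps)
    moreover have "(\<lambda>gs. a gs + b gs) \<in> grp_cochains G p"
      using a b by (simp add: grp_cochains_def)
    ultimately show "x \<in> grp_class G (Suc p) c2"
      by (auto simp: grp_class_def r_coset_def grp_coboundaries_def grp_cocycles_def)
  qed
  have "(\<lambda>gs. - b gs) \<in> grp_cochains G p"
    using assms(1) by (simp add: grp_cochains_def)
  then have "grp_class G (Suc p) c \<subseteq> grp_class G (Suc p) c'"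
    by (rule sub) (simp add: assms(2) grp_delta_minus)
  then show ?thesis
    using sub[OF assms] by blast
qed

lemma grp_class_in_cohomology:
  "c \<in> grp_cochains G p \<Longrightarrow> grp_delta G p c = (\<lambda>_. 0) \<Longrightarrow>
    grp_class G p c \<in> carrier (grp_cohomology G p)"
  by (auto simp: grp_class_def grp_cohomology_def FactGroup_def RCOSETS_def grp_cocycles_def)

lemma tuples_SucE:
  assumes "gs \<in> tuples G (Suc p)"
  obtains g hs where "gs = g # hs" "g \<in> carrier G" "hs \<in> tuples G p"
  using assms by (cases gs) (auto simp: tuples_def)

lemma tuples_0: "gs \<in> tuples G 0 \<longleftrightarrow> gs = []"
  by (auto simp: tuples_def)

lemma grp_delta_2:
  assumes "f \<in> carrier G" "g \<in> carrier G" "h \<in> carrier G"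
  shows "grp_delta G 2 c [f, g, h] =
    c [g, h] - c [f \<otimes>\<^bsub>G\<^esub> g, h] + c [f, g \<otimes>\<^bsub>G\<^esub> h] - c [f, g]"
proof -
  have "{1..2} = {1, 2::nat}" by auto
  then show ?thesis
    using assms by (simp add: grp_delta_def tuples_def merge_def alt_sign_def)
qed

lemma grp_delta_3:
  assumes "f \<in> carrier G" "g \<in> carrier G" "h \<in> carrier G" "k \<in> carrier G"
  shows "grp_delta G 3 c [f, g, h, k] =
    c [g, h, k] - c [f \<otimes>\<^bsub>G\<^esub> g, h, k] + c [f, g \<otimes>\<^bsub>G\<^esub> h, k] - c [f, g, h \<otimes>\<^bsub>G\<^esub> k] + c [f, g, h]"
proof -
  have "{1..3} = {1, 2, 3::nat}" by auto
  then show ?thesis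
    using assms by (simp add: grp_delta_def tuples_def merge_def alt_sign_def)
qed

section \<open>The cocycle of the disks and its class\<close>

lemma symp_cocycle_apply:
  assumes "f \<in> carrier (Symp A \<omega>)" "g \<in> carrier (Symp A \<omega>)" "h \<in> carrier (Symp A \<omega>)"
  shows "symp_cocycle A \<omega> \<Delta> w [f, g, h] = pairing w (chain_map 2 f (\<Delta> g h)) - pairing w (\<Delta> g h)"
  using assms by (simp add: symp_cocycle_def tuples_def pairing_fun_diff pairing_chain_map)

text \<open>Written as a chain map, the action on paths is functorial, so that boundaries of
  translated disks cancel by rewriting.\<close>

lemma path_simplex_compose:
  "frag_of (path_simplex (g \<circ> \<gamma>)) = chain_map 1 g (frag_of (path_simplex \<gamma>))"
proof -
  have "path_simplex (g \<circ> \<gamma>) = simplex_map 1 g (path_simplex \<gamma>)"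
    by (auto simp: path_simplex_def simplex_map_def restrict_def)
  then show ?thesis
    by simp
qed

lemma spanning_disksD:
  assumes "spanning_disks A \<omega> r x0 \<sigma> \<Delta>" "g \<in> carrier (Symp A \<omega>)" "h \<in> carrier (Symp A \<omega>)"
  shows "\<Delta> g h \<in> chains A r 2"
    "chain_boundary 2 (\<Delta> g h) = frag_of (path_simplex (\<sigma> (g x0)))
      - frag_of (path_simplex (\<sigma> (g (h x0)))) + chain_map 1 g (frag_of (path_simplex (\<sigma> (h x0))))"
  using assms unfolding spanning_disks_def path_simplex_compose by blast+

text \<open>The tetrahedron on the orbit points of \<open>f\<close>, \<open>fg\<close>, \<open>fgh\<close>.\<close>

lemma disk_cycle:
  assumes A: "smooth_atlas A" and \<Delta>: "spanning_disks A \<omega> r x0 \<sigma> \<Delta>"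
    and f: "f \<in> carrier (Symp A \<omega>)" and g: "g \<in> carrier (Symp A \<omega>)" and h: "h \<in> carrier (Symp A \<omega>)"
  defines "z \<equiv> \<Delta> f g + \<Delta> (f \<circ> g) h - \<Delta> f (g \<circ> h) - chain_map 2 f (\<Delta> g h)"
  shows "z \<in> chains A r 2" "chain_boundary 2 z = 0"
proof -
  note D = spanning_disksD[OF \<Delta>]
  note comp = Symp_comp_closed[OF A]
  have "chain_map 2 f (\<Delta> g h) \<in> chains A r 2"
    by (rule chain_map_chains[OF A Symp_smooth[OF f] D(1)[OF g h]])
  then show "z \<in> chains A r 2"
    unfolding z_def chains_eq_within
    by (intro chains_within_diff chains_within_add D(1)[unfolded chains_eq_within] f g h comp)
  have "chain_boundary 2 (chain_map 2 f (\<Delta> g h)) = chain_map 1 f (chain_boundary 2 (\<Delta> g h))"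
    using chain_boundary_map[of 1 "\<Delta> g h" f] chains_singular[OF D(1)[OF g h]]
    by (simp add: numeral_2_eq_2)
  \<comment> \<open>Each of the six path terms occurs twice with opposite signs; functoriality
    identifies the translate by \<open>f \<circ> g\<close> with the translate by \<open>f\<close> of
    the one by \<open>g\<close>.\<close>
  then show "chain_boundary 2 z = 0"
    unfolding z_def chain_boundary_add chain_boundary_diff
    by (simp add: D(2) f g h comp chain_map_add chain_map_diff chain_map_compose
        del: One_nat_def chain_map_of)
qed

text \<open>The coboundary at \<open>f, g, h, k\<close> is the change of \<open>w\<close> under
  \<open>f\<close> on the two-cycle formed from \<open>g, h, k\<close>. Its first two terms combine
  to the contribution of the disk of \<open>h, k\<close> translated by \<open>g\<close>.\<close>

lemma symp_cocycle_cocycle: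
  assumes A: "smooth_atlas A" and \<Delta>: "spanning_disks A \<omega> r x0 \<sigma> \<Delta>"
    and w: "represents_integral_class A \<omega> r w"
  shows "grp_delta (Symp A \<omega>) 3 (symp_cocycle A \<omega> \<Delta> w) = (\<lambda>_. 0)"
proof
  fix gs
  let ?G = "Symp A \<omega>" and ?c = "symp_cocycle A \<omega> \<Delta> w"
  note comp = Symp_comp_closed[OF A]
  show "grp_delta ?G 3 ?c gs = 0"
  proof (cases "gs \<in> tuples ?G 4")
    case True
    then obtain f g h k where gs: "gs = [f, g, h, k]" and
      G: "f \<in> carrier ?G" "g \<in> carrier ?G" "h \<in> carrier ?G" "k \<in> carrier ?G"
      by (auto simp: eval_nat_numeral tuples_0 elim!: tuples_SucE)
    let ?z = "\<Delta> g h + \<Delta> (g \<circ> h) k - \<Delta> g (h \<circ> k) - chain_map 2 g (\<Delta> h k)"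
    have "pairing w (chain_map 2 f ?z) = pairing w ?z"
      by (rule cycle_invariant[OF A disk_cycle[OF A \<Delta> G(2-4)] w G(1)])
    then show ?thesis
      unfolding gs grp_delta_3[OF G] Symp_mult
      by (simp add: symp_cocycle_apply G comp chain_map_compose chain_map_add chain_map_diff
          pairing_add pairing_diff)
  next
    case False
    then show ?thesis
      by (simp add: grp_delta_def)
  qed
qed

lemma symp_cocycle_cochain: "symp_cocycle A \<omega> \<Delta> w \<in> grp_cochains (Symp A \<omega>) 3"
  by (simp add: grp_cochains_def symp_cocycle_def)

text \<open>Equality of classes is reduced to a formula on triples, with a two-variable function
  \<open>b\<close> in place of a cochain on lists; \<open>B\<close> is its extension by
  zero.\<close>

lemma symp_class_eqI:
  assumes A: "smooth_atlas A"
    and eq: "\<And>f g h. f \<in> carrier (Symp A \<omega>) \<Longrightarrow> g \<in> carrier (Symp A \<omega>) \<Longrightarrow> h \<in> carrier (Symp A \<omega>) \<Longrightarrow>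
      symp_cocycle A \<omega> \<Delta>' w' [f, g, h] = symp_cocycle A \<omega> \<Delta> w [f, g, h]
        + b g h - b (f \<circ> g) h + b f (g \<circ> h) - b f g"
  shows "grp_class (Symp A \<omega>) 3 (symp_cocycle A \<omega> \<Delta> w) = grp_class (Symp A \<omega>) 3 (symp_cocycle A \<omega> \<Delta>' w')"
proof -
  let ?G = "Symp A \<omega>"
  define B where "B gs = (if gs \<in> tuples ?G 2 then b (gs ! 0) (gs ! 1) else 0)" for gs
  have B: "B [f, g] = b f g" if "f \<in> carrier ?G" "g \<in> carrier ?G" for f g
    using that by (simp add: B_def tuples_def)
  note comp = Symp_comp_closed[OF A]
  have "symp_cocycle A \<omega> \<Delta>' w' gs = symp_cocycle A \<omega> \<Delta> w gs + grp_delta ?G 2 B gs" for gs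
  proof (cases "gs \<in> tuples ?G 3")
    case True
    then obtain f g h where gs: "gs = [f, g, h]" and
      G: "f \<in> carrier ?G" "g \<in> carrier ?G" "h \<in> carrier ?G"
      by (auto simp: eval_nat_numeral tuples_0 elim!: tuples_SucE)
    show ?thesis
      unfolding gs grp_delta_2[OF G] Symp_mult by (simp add: eq G B comp)
  next
    case False
    then show ?thesis
      by (simp add: grp_delta_def symp_cocycle_def)
  qed
  then have "grp_class ?G (Suc 2) (symp_cocycle A \<omega> \<Delta> w) = grp_class ?G (Suc 2) (symp_cocycle A \<omega> \<Delta>' w')"
    by (intro grp_class_eqI[of B]) (simp add: grp_cochains_def B_def)
  moreover have "Suc 2 = 3" by simp
  ultimately show ?thesis
    by (simp only:)
qed

text \<open>The cocycle involves the disk of \<open>g, h\<close> translated by \<open>f\<close>.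
  Since \<open>w - w'\<close> vanishes on the two-cycle \<open>?z\<close>, its value on this
  translate is expressed through the three other, untranslated disks.\<close>

lemma symp_class_cocycle_choice:
  assumes A: "smooth_atlas A" and \<Delta>: "spanning_disks A \<omega> r x0 \<sigma> \<Delta>"
    and w: "represents_integral_class A \<omega> r w" "represents_integral_class A \<omega> r w'"
  shows "grp_class (Symp A \<omega>) 3 (symp_cocycle A \<omega> \<Delta> w) = grp_class (Symp A \<omega>) 3 (symp_cocycle A \<omega> \<Delta> w')"
proof (rule symp_class_eqI[OF A, where b = "\<lambda>g h. pairing w (\<Delta> g h) - pairing w' (\<Delta> g h)"])
  fix f g h assume G: "f \<in> carrier (Symp A \<omega>)" "g \<in> carrier (Symp A \<omega>)" "h \<in> carrier (Symp A \<omega>)"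
  let ?z = "\<Delta> f g + \<Delta> (f \<circ> g) h - \<Delta> f (g \<circ> h) - chain_map 2 f (\<Delta> g h)"
  have "pairing w ?z = pairing w' ?z"
    by (rule cycle_independent[OF A disk_cycle[OF A \<Delta> G] w])
  then show "symp_cocycle A \<omega> \<Delta> w' [f, g, h] = symp_cocycle A \<omega> \<Delta> w [f, g, h]
      + (pairing w (\<Delta> g h) - pairing w' (\<Delta> g h)) - (pairing w (\<Delta> (f \<circ> g) h) - pairing w' (\<Delta> (f \<circ> g) h))
      + (pairing w (\<Delta> f (g \<circ> h)) - pairing w' (\<Delta> f (g \<circ> h))) - (pairing w (\<Delta> f g) - pairing w' (\<Delta> f g))"
    by (simp add: symp_cocycle_apply G pairing_add pairing_diff)
qed

lemma path_sectionD:
  assumes "path_section A r x0 \<sigma>"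
  shows "frag_of (path_simplex (\<sigma> x)) \<in> chains A r 1"
    "chain_boundary 1 (frag_of (path_simplex (\<sigma> x))) =
      frag_of (const_simplex 0 x) - frag_of (const_simplex 0 x0)"
proof -
  have *: "\<sigma> x \<in> path_space A r x0" "pathfinish (\<sigma> x) = x"
    using assms by (auto simp: path_section_def)
  then show "frag_of (path_simplex (\<sigma> x)) \<in> chains A r 1"
    by (simp add: path_space_def chains_def keys_frag_of)
  have "path_simplex (\<sigma> x) (vertex 0) = \<sigma> x 0" "path_simplex (\<sigma> x) (vertex 1) = \<sigma> x 1"
    by (simp_all add: path_simplex_def)
  then show "chain_boundary 1 (frag_of (path_simplex (\<sigma> x))) =
      frag_of (const_simplex 0 x) - frag_of (const_simplex 0 x0)"
    using * unfolding chain_boundary_path by (simp add: path_space_def pathstart_def pathfinish_def)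
qed

text \<open>\<open>K g\<close> fills the quadrilateral formed by the old path to
  \<open>g x0\<close>, the new path to \<open>g x0'\<close>, the connecting path \<rho> and its
  translate. Two disks and three such fillings close up to a prism, on which \<open>f\<close> does
  not change \<open>w\<close>.\<close>

lemma symp_class_section_choice:
  fixes A :: "('a::{t2_space,second_countable_topology}, 'e::euclidean_space) chart set"
  assumes A: "smooth_atlas A" and sc: "simply_connected (UNIV :: 'a set)"
    and \<sigma>: "path_section A r x0 \<sigma>" "path_section A r x0' \<sigma>'"
    and \<Delta>: "spanning_disks A \<omega> r x0 \<sigma> \<Delta>" "spanning_disks A \<omega> r x0' \<sigma>' \<Delta>'"
    and w: "represents_integral_class A \<omega> r w"
  shows "grp_class (Symp A \<omega>) 3 (symp_cocycle A \<omega> \<Delta> w) = grp_class (Symp A \<omega>) 3 (symp_cocycle A \<omega> \<Delta>' w)"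
proof -
  let ?G = "Symp A \<omega>"
  define T where "T x = frag_of (path_simplex (\<sigma> x))" for x
  define T' where "T' x = frag_of (path_simplex (\<sigma>' x))" for x
  \<comment> \<open>The old section itself supplies a path from \<open>x0\<close> to
    \<open>x0'\<close>.\<close>
  define \<rho> where "\<rho> = T x0'"
  note comp = Symp_comp_closed[OF A]
  note T = path_sectionD[OF \<sigma>(1), folded T_def] and T' = path_sectionD[OF \<sigma>(2), folded T'_def]
  note D = spanning_disksD[OF \<Delta>(1), folded T_def] and D' = spanning_disksD[OF \<Delta>(2), folded T'_def]
  have "\<exists>K\<in>chains A r 2. chain_boundary 2 K = T' (g x0') - T (g x0) - chain_map 1 g \<rho> + \<rho>"
    if g: "g \<in> carrier ?G" for g
  proof (rule one_cycle_boundary[OF A sc])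
    have \<rho>: "\<rho> \<in> chains A r 1" "chain_map 1 g \<rho> \<in> chains A r 1"
      unfolding \<rho>_def using T(1) chain_map_chains[OF A Symp_smooth[OF g]] by blast+
    with T(1) T'(1) show "T' (g x0') - T (g x0) - chain_map 1 g \<rho> + \<rho> \<in> chains A r 1"
      unfolding chains_eq_within by (intro chains_within_diff chains_within_add)
    have "chain_boundary 1 (chain_map 1 g \<rho>) = chain_map 0 g (chain_boundary 1 \<rho>)"
      using chain_boundary_map[of 0 \<rho> g] chains_singular[OF \<rho>(1)] by simp
    also have "\<dots> = frag_of (const_simplex 0 (g x0')) - frag_of (const_simplex 0 (g x0))"
      unfolding \<rho>_def T chain_map_diff chain_map_of
      by (simp add: simplex_map_def restrict_def fun_eq_iff o_def cong: if_cong)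
    \<comment> \<open>The points \<open>x0\<close>, \<open>x0'\<close>, \<open>g x0\<close> and
      \<open>g x0'\<close> each occur twice with opposite signs.\<close>
    finally show "chain_boundary 1 (T' (g x0') - T (g x0) - chain_map 1 g \<rho> + \<rho>) = 0"
      unfolding chain_boundary_add chain_boundary_diff T T' \<rho>_def by simp
  qed
  then obtain K where K: "\<And>g. g \<in> carrier ?G \<Longrightarrow> K g \<in> chains A r 2"
    "\<And>g. g \<in> carrier ?G \<Longrightarrow> chain_boundary 2 (K g) = T' (g x0') - T (g x0) - chain_map 1 g \<rho> + \<rho>"
    by metis
  show ?thesis
  proof (rule symp_class_eqI[OF A, where b = "\<lambda>f g. pairing w (K g) - pairing w (chain_map 2 f (K g))"])
    fix f g h assume G: "f \<in> carrier ?G" "g \<in> carrier ?G" "h \<in> carrier ?G"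
    \<comment> \<open>The translates of \<rho> by the identity, \<open>g\<close> and
      \<open>g \<circ> h\<close> telescope among the three fillings, and what they leave is the
      difference of the boundaries of the two disks.\<close>
    let ?z = "\<Delta>' g h - \<Delta> g h - (K g - K (g \<circ> h) + chain_map 2 g (K h))"
    have "chain_map 2 g (K h) \<in> chains A r 2"
      by (rule chain_map_chains[OF A Symp_smooth[OF G(2)] K(1)[OF G(3)]])
    then have z1: "?z \<in> chains A r 2"
      using D(1) D'(1) K(1) G comp unfolding chains_eq_within
      by (intro chains_within_diff chains_within_add) auto
    have "chain_boundary 2 (chain_map 2 g (K h)) = chain_map 1 g (chain_boundary 2 (K h))"
      using chain_boundary_map[of 1 "K h" g] chains_singular[OF K(1)[OF G(3)]]
      by (simp add: numeral_2_eq_2)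
    then have z2: "chain_boundary 2 ?z = 0"
      unfolding chain_boundary_add chain_boundary_diff
      by (simp add: K(2) D(2) D'(2) G comp chain_map_add chain_map_diff chain_map_compose
          del: One_nat_def)
    have "pairing w (chain_map 2 f ?z) = pairing w ?z"
      by (rule cycle_invariant[OF A z1 z2 w G(1)])
    \<comment> \<open>The two plain values of \<open>w\<close> on \<open>K h\<close> cancel. What
      remains of the coboundary is the change of \<open>w\<close> under \<open>f\<close> on the
      combination of fillings subtracted in \<open>?z\<close>.\<close>
    then show "symp_cocycle A \<omega> \<Delta>' w [f, g, h] = symp_cocycle A \<omega> \<Delta> w [f, g, h]
        + (pairing w (K h) - pairing w (chain_map 2 g (K h)))
        - (pairing w (K h) - pairing w (chain_map 2 (f \<circ> g) (K h)))
        + (pairing w (K (g \<circ> h)) - pairing w (chain_map 2 f (K (g \<circ> h))))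
        - (pairing w (K g) - pairing w (chain_map 2 f (K g)))"
      by (simp add: symp_cocycle_apply G chain_map_compose chain_map_add chain_map_diff
          pairing_add pairing_diff)
  qed
qed

theorem proposition3p5:
  fixes A :: "('a::{t2_space,second_countable_topology}, 'e::euclidean_space) chart set"
    and \<omega> :: "('a, 'e) coord_form"
    and r :: regularity
    and x0 x0' :: 'a
    and \<sigma> \<sigma>' :: "'a \<Rightarrow> real \<Rightarrow> 'a"
    and \<Delta> \<Delta>' :: "('a \<Rightarrow> 'a) \<Rightarrow> ('a \<Rightarrow> 'a) \<Rightarrow> 'a chain"
    and w w' :: "((nat \<Rightarrow> real) \<Rightarrow> 'a) \<Rightarrow> int"
  assumes "symplectic_manifold A \<omega>"
    and "one_connected (UNIV :: 'a set)"
    and "integral_form A \<omega>"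
    and "path_section A r x0 \<sigma>" and "path_section A r x0' \<sigma>'"
    and "spanning_disks A \<omega> r x0 \<sigma> \<Delta>" and "spanning_disks A \<omega> r x0' \<sigma>' \<Delta>'"
    and "represents_integral_class A \<omega> r w" and "represents_integral_class A \<omega> r w'"
  shows "grp_class (Symp A \<omega>) 3 (symp_cocycle A \<omega> \<Delta> w)
           \<in> carrier (grp_cohomology (Symp A \<omega>) 3) \<and>
         grp_class (Symp A \<omega>) 3 (symp_cocycle A \<omega> \<Delta> w)
           = grp_class (Symp A \<omega>) 3 (symp_cocycle A \<omega> \<Delta>' w')"
proof -
  have A: "smooth_atlas A" and sc: "simply_connected (UNIV :: 'a set)"
    using assms(1,2) by (auto simp: symplectic_manifold_def one_connected_def)
  have "grp_class (Symp A \<omega>) 3 (symp_cocycle A \<omega> \<Delta> w) \<in> carrier (grp_cohomology (Symp A \<omega>) 3)"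
    by (intro grp_class_in_cohomology symp_cocycle_cochain symp_cocycle_cocycle[OF A assms(6,8)])
  \<comment> \<open>Base point, section and disks change while \<open>w\<close> is fixed, then
    \<open>w\<close> changes over the new disks. Equal base points and sections are allowed, so
    independence of the disks is included.\<close>
  then show ?thesis
    using symp_class_section_choice[OF A sc assms(4-8)]
      symp_class_cocycle_choice[OF A assms(7,8,9)] by simp
qed

end
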